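(* Let $G$ be a finitely generated solvable group. If there exist $\epsilon\in(0,1)$ and $c>0$ such that for any large enough integer $n$ we have $$\mathrm{Sep}_G(n)\le c\, n^{1-\epsilon},$$ then $G$ is virtually nilpotent.
   Context: $\mathrm{Sep}_G$ denotes the separation profile of a Cayley graph of $G$ with respect to some finite generating set (a change of finite generating set changes it only up to multiplicative constants). For a graph $\Gamma$ with vertex set $V\Gamma$ and edge set $E\Gamma\subset V\Gamma\times V\Gamma$ (adjacency undirected), and $A\subset V\Gamma$, $\partial A=\{(a,b)\in E\Gamma : \text{exactly one of } a,b \text{ lies in } A\}$. For a finite graph $H$, the Cheeger constant is $h(H)=\min\{|\partial_H A|/|A| : \emptyset\ne A\subset VH,\ |A|\le |VH|/2\}$, where $\partial_H$ is the boundary in $H$. For a finite $F\subset V\Gamma$, $h(F)$ is the Cheeger constant of the subgraph of $\Gamma$ induced on $F$, with the convention $h(F)=0$ if $|F|\le1$. The separation profile of $\Gamma$ is $\mathrm{Sep}_\Gamma(n)=\sup\{|F|\, h(F) : F\subset V\Gamma,\ |F|\le n\}$. *)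

theory Defs
  imports
    Complex_Main
    "HOL-Algebra.Generated_Groups"
    "HOL-Algebra.Solvable_Groups"
    "Graph_Theory.Pair_Digraph"
    "Graph_Theory.Digraph_Component"
begin

section \<open>Separation profile of a graph\<close>

text \<open>Graphs are pairs of a vertex set and an edge set of ordered pairs of vertices.  The boundary
  of \<open>A\<close> does not depend on the orientation of the edges; an edge present in both orientations
  contributes both of its orientations.\<close>

definition edge_boundary :: "'v pair_pre_digraph \<Rightarrow> 'v set \<Rightarrow> ('v \<times> 'v) set" where
  "edge_boundary \<Gamma> A = {(a, b) \<in> parcs \<Gamma>. (a \<in> A) \<noteq> (b \<in> A)}"

definition induced_pair_subgraph :: "'v pair_pre_digraph \<Rightarrow> 'v set \<Rightarrow> 'v pair_pre_digraph" where
  "induced_pair_subgraph \<Gamma> F = \<lparr> pverts = F, parcs = parcs \<Gamma> \<inter> F \<times> F \<rparr>"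

lemma with_proj_induced_pair_subgraph:
  "with_proj (induced_pair_subgraph \<Gamma> F) = induce_subgraph (with_proj \<Gamma>) F"
  by (auto simp: induced_pair_subgraph_def Digraph_Component.induce_subgraph_def with_proj_def)

text \<open>Meant for graphs with a finite vertex set; the minimum is over a nonempty finite set as soon
  as there are at least two vertices.\<close>

definition cheeger :: "'v pair_pre_digraph \<Rightarrow> real" where
  "cheeger H =
     (if card (pverts H) \<le> 1 then 0
      else Min ((\<lambda>A. real (card (edge_boundary H A)) / real (card A)) `
             {A. A \<noteq> {} \<and> A \<subseteq> pverts H \<and> real (card A) \<le> real (card (pverts H)) / 2}))"

definition sep_profile :: "'v pair_pre_digraph \<Rightarrow> nat \<Rightarrow> real" where
  "sep_profile \<Gamma> n =
     (SUP F \<in> {F. F \<subseteq> pverts \<Gamma> \<and> finite F \<and> card F \<le> n}.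
        real (card F) * cheeger (induced_pair_subgraph \<Gamma> F))"

text \<open>The real supremum is a genuine one: the set of values is bounded above (and contains
  \<open>0\<close>, the value at the empty set).\<close>

lemma cheeger_induced_le:
  assumes "finite F"
  shows "cheeger (induced_pair_subgraph \<Gamma> F) \<le> real (card F * card F)"
proof (cases "card F \<le> 1")
  case True
  then show ?thesis by (simp add: cheeger_def induced_pair_subgraph_def)
next
  case False
  let ?H = "induced_pair_subgraph \<Gamma> F"
  obtain x where x: "x \<in> F" using False by fastforce
  have "edge_boundary ?H {x} \<subseteq> F \<times> F"
    by (auto simp: edge_boundary_def induced_pair_subgraph_def)
  then have c: "card (edge_boundary ?H {x}) \<le> card F * card F"
    using card_mono[of "F \<times> F"] assms by (simp add: card_cartesian_product)
  have "finite {A. A \<noteq> {} \<and> A \<subseteq> F \<and> real (card A) \<le> real (card F) / 2}"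
    using assms by (auto intro: finite_subset[of _ "Pow F"])
  then have "cheeger ?H \<le> real (card (edge_boundary ?H {x})) / real (card {x})"
    unfolding cheeger_def using False x
    by (simp add: induced_pair_subgraph_def) (rule Min_le, auto intro!: image_eqI[of _ _ "{x}"])
  then show ?thesis using c by (smt (verit) card_1_singleton_iff div_by_1 of_nat_1 of_nat_mono One_nat_def)
qed

lemma sep_profile_bdd_above:
  "bdd_above ((\<lambda>F. real (card F) * cheeger (induced_pair_subgraph \<Gamma> F)) `
     {F. F \<subseteq> pverts \<Gamma> \<and> finite F \<and> card F \<le> n})"
proof (rule bdd_aboveI2)
  fix F assume "F \<in> {F. F \<subseteq> pverts \<Gamma> \<and> finite F \<and> card F \<le> n}"
  then have F: "finite F" "card F \<le> n" by auto
  have "real (card F) * cheeger (induced_pair_subgraph \<Gamma> F) \<le> real (card F) * real (card F * card F)"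
    using cheeger_induced_le[OF F(1)] by (intro mult_left_mono) auto
  also have "\<dots> \<le> real (n * (n * n))"
    using F(2) by (metis mult_le_mono of_nat_mono of_nat_mult)
  finally show "real (card F) * cheeger (induced_pair_subgraph \<Gamma> F) \<le> real (n * (n * n))" .
qed


section \<open>Cayley graphs\<close>

text \<open>Adjacency is undirected, so both \<open>(x, x s)\<close> and \<open>(x s, x)\<close> are edges; \<open>S\<close> need not be closed
  under inverses.  Loops, coming from \<open>\<one> \<in> S\<close>, lie in no boundary.\<close>

definition cayley_graph :: "('a, 'm) monoid_scheme \<Rightarrow> 'a set \<Rightarrow> 'a pair_pre_digraph" where
  "cayley_graph G S =
     \<lparr> pverts = carrier G,
       parcs = {(x, y). x \<in> carrier G \<and> y \<in> carrier G \<and>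
                  (\<exists>s \<in> S. y = x \<otimes>\<^bsub>G\<^esub> s \<or> x = y \<otimes>\<^bsub>G\<^esub> s)} \<rparr>"


section \<open>Virtually nilpotent groups\<close>

primrec lower_central :: "('a, 'm) monoid_scheme \<Rightarrow> nat \<Rightarrow> 'a set" where
  "lower_central G 0 = carrier G"
| "lower_central G (Suc n) =
     generate G (\<Union>x \<in> lower_central G n. \<Union>y \<in> carrier G.
       {x \<otimes>\<^bsub>G\<^esub> y \<otimes>\<^bsub>G\<^esub> inv\<^bsub>G\<^esub> x \<otimes>\<^bsub>G\<^esub> inv\<^bsub>G\<^esub> y})"

definition nilpotent_group :: "('a, 'm) monoid_scheme \<Rightarrow> bool" where
  "nilpotent_group G \<longleftrightarrow> (\<exists>n. lower_central G n = {\<one>\<^bsub>G\<^esub>})"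

definition virtually_nilpotent :: "('a, 'm) monoid_scheme \<Rightarrow> bool" where
  "virtually_nilpotent G \<longleftrightarrow>
     (\<exists>H. subgroup H G \<and> finite (rcosets\<^bsub>G\<^esub> H) \<and> nilpotent_group (G \<lparr> carrier := H \<rparr>))"

end

(* A finite set F of boundary ratio at most lam can be cut, by the separation hypothesis, into A and
   F - A with few edges between them; one of the two halves has boundary ratio almost lam.  Starting
   from Foelner sets, which exist because solvable groups are amenable, this descent yields for every n
   a set of at most n elements with boundary ratio O(n^-eps).  The isoperimetric inequality of Coulhon
   and Saloff-Coste then bounds the growth of G by a polynomial.

   Polynomial growth forces coincidences among the words k^b0 t k^b1 t ... with exponents 0 and 1.
   They make the kernels of maps onto cyclic groups finitely generated, so that G is polycyclic
   (Milnor), and they show that an element t acts on every abelian section with eigenvalues in the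
   closed unit disc, hence roots of unity by Kronecker's theorem: some power of t acts unipotently.
   Induction along the polycyclic series then gives a nilpotent subgroup of finite index (Wolf). *)
theory Submission
  imports Defs "HOL-Computational_Algebra.Polynomial_Factorial"
    "HOL-Computational_Algebra.Fundamental_Theorem_Algebra"
begin

section \<open>Groups as a type class\<close>

text \<open>Abelian sections of the groups met here may have torsion, so there is no matrix whose
  eigenvalues could be taken. Instead each element a of a section is studied through its
  annihilator, an ideal of Z[x] where x acts as conjugation by t. Z[x] is not a principal ideal
  domain: division controls such an ideal only up to an integer factor, and removing that factor is
  the delicate point on the way from roots of unity to a power of t acting unipotently.

  Words in t^j and a are compared for every j > 0. A single j would bound the roots only by 2; the
  bound 2 for all their j-th powers puts them into the closed unit disc.

  The terms of the derived series may be infinitely generated before growth is known to be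
  polynomial. Hence Foelner sets are sought for arbitrary finite sets of translations, and
  polynomial growth is stated for all finite subsets.

  Calculations take place in a type all of whose values are group elements, with subgroups as sets;
  G itself enters only at the end, through its left translations.\<close>

class mult_group = monoid_mult + inverse +
  assumes inverse_mult_self [simp]: "inverse a * a = 1"
begin

lemma inverse_mult_cancel [simp]: "inverse a * (a * b) = b"
  by (simp flip: mult.assoc)

lemma mult_inverse_self [simp]: "a * inverse a = 1"
proof -
  have "a * inverse a = inverse (inverse a) * inverse a * (a * inverse a)" by simp
  also have "\<dots> = inverse (inverse a) * (inverse a * a * inverse a)" by (simp only: mult.assoc)
  finally show ?thesis by simp
qed

lemma mult_inverse_cancel [simp]: "a * (inverse a * b) = b"
  by (simp flip: mult.assoc)

lemma group_inverse_unique: "a * b = 1 \<Longrightarrow> inverse a = b"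
  by (metis inverse_mult_cancel mult_1_right)

lemma group_inverse_inverse [simp]: "inverse (inverse a) = a"
  by (rule group_inverse_unique) simp

lemma group_inverse_one [simp]: "inverse 1 = 1"
  by (rule group_inverse_unique) simp

lemma group_inverse_mult [simp]: "inverse (a * b) = inverse b * inverse a"
  by (rule group_inverse_unique) (simp add: mult.assoc)

lemma group_left_cancel [simp]: "a * b = a * c \<longleftrightarrow> b = c"
  by (metis inverse_mult_cancel)

lemma group_right_cancel [simp]: "b * a = c * a \<longleftrightarrow> b = c"
  by (metis mult.assoc mult_1_right mult_inverse_self)

lemma group_inverse_power: "inverse (a ^ n) = inverse a ^ n"
proof (induction n)
  case (Suc n)
  then show ?case by (metis group_inverse_mult power_Suc power_Suc2)
qed simp

lemma conj_power: "(g * x * inverse g) ^ n = g * x ^ n * inverse g"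
  by (induction n) (simp_all add: mult.assoc)

end

definition zpow :: "'a::mult_group \<Rightarrow> int \<Rightarrow> 'a" where
  "zpow x i = (if i \<ge> 0 then x ^ nat i else inverse x ^ nat (- i))"

lemma zpow_of_nat [simp]: "zpow x (int n) = x ^ n"
  by (simp add: zpow_def)

lemma zpow_0 [simp]: "zpow x 0 = 1" and zpow_1 [simp]: "zpow x 1 = x"
  and zpow_neg1 [simp]: "zpow x (- 1) = inverse x"
  by (simp_all add: zpow_def)

lemma zpow_plus1: "zpow x (i + 1) = zpow x i * x"
proof (cases "i \<ge> 0")
  case True
  then have "nat (i + 1) = Suc (nat i)" by simp
  with True show ?thesis by (simp add: zpow_def power_Suc2 del: power_Suc)
next
  case False
  then have "nat (- i) = Suc (nat (- (i + 1)))" by simp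
  with False show ?thesis
    by (auto simp: zpow_def power_Suc2 mult.assoc simp del: power_Suc)
qed

lemma zpow_minus1: "zpow x (i - 1) = zpow x i * inverse x"
  using zpow_plus1[of x "i - 1"] by (simp add: mult.assoc)

lemma zpow_add: "zpow x (i + j) = zpow x i * zpow x j"
proof (induction j rule: int_induct[where k = 0])
  case (step1 j)
  then show ?case using zpow_plus1[of x "i + j"] by (simp add: zpow_plus1 mult.assoc add.assoc)
next
  case (step2 j)
  then show ?case using zpow_minus1[of x "i + j"]
    by (simp add: zpow_minus1 mult.assoc add_diff_eq)
qed simp

lemma zpow_minus: "zpow x (- i) = inverse (zpow x i)"
  using zpow_add[of x i "- i"] group_inverse_unique[of "zpow x i" "zpow x (- i)"] by simp

lemma zpow_mult: "zpow x (i * j) = zpow (zpow x i) j"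
proof (induction j rule: int_induct[where k = 0])
  case (step1 j)
  then show ?case by (simp add: zpow_add distrib_left zpow_plus1)
next
  case (step2 j)
  have "i * (j - 1) = i * j + - i" by (simp add: algebra_simps)
  with step2 show ?case by (simp only: zpow_add zpow_minus zpow_minus1)
qed simp

subsection \<open>Subgroups and generation\<close>

definition subgrp :: "'a::mult_group set \<Rightarrow> bool" where
  "subgrp H \<longleftrightarrow> 1 \<in> H \<and> (\<forall>x\<in>H. \<forall>y\<in>H. x * y \<in> H) \<and> (\<forall>x\<in>H. inverse x \<in> H)"

lemma subgrpI:
  assumes "1 \<in> H" "\<And>x y. x \<in> H \<Longrightarrow> y \<in> H \<Longrightarrow> x * y \<in> H" "\<And>x. x \<in> H \<Longrightarrow> inverse x \<in> H"
  shows "subgrp H"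
  using assms by (auto simp: subgrp_def)

lemma subgrp_one: "subgrp H \<Longrightarrow> 1 \<in> H"
  and subgrp_mult: "subgrp H \<Longrightarrow> x \<in> H \<Longrightarrow> y \<in> H \<Longrightarrow> x * y \<in> H"
  and subgrp_inv: "subgrp H \<Longrightarrow> x \<in> H \<Longrightarrow> inverse x \<in> H"
  by (auto simp: subgrp_def)

lemma subgrp_power: "subgrp H \<Longrightarrow> x \<in> H \<Longrightarrow> x ^ n \<in> H"
  by (induction n) (auto simp: subgrp_def)

lemma subgrp_zpow: "subgrp H \<Longrightarrow> x \<in> H \<Longrightarrow> zpow x i \<in> H"
  by (auto simp: zpow_def intro: subgrp_power subgrp_inv)

lemma subgrp_mult_left_iff: "subgrp H \<Longrightarrow> x \<in> H \<Longrightarrow> x * y \<in> H \<longleftrightarrow> y \<in> H"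
  by (metis inverse_mult_cancel subgrp_inv subgrp_mult)

lemma subgrp_mult_right_iff: "subgrp H \<Longrightarrow> y \<in> H \<Longrightarrow> x * y \<in> H \<longleftrightarrow> x \<in> H"
proof -
  assume "subgrp H" "y \<in> H"
  then show ?thesis
    using subgrp_mult[of H "x * y" "inverse y"] subgrp_mult[of H x y] subgrp_inv[of H y]
    by (auto simp: mult.assoc)
qed

lemma subgrp_Int: "subgrp H \<Longrightarrow> subgrp K \<Longrightarrow> subgrp (H \<inter> K)"
  by (auto simp: subgrp_def)

inductive_set gen :: "'a::mult_group set \<Rightarrow> 'a set" for S where
  gen_one: "1 \<in> gen S"
| gen_base: "s \<in> S \<Longrightarrow> s \<in> gen S"
| gen_mult: "x \<in> gen S \<Longrightarrow> y \<in> gen S \<Longrightarrow> x * y \<in> gen S"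
| gen_inv: "x \<in> gen S \<Longrightarrow> inverse x \<in> gen S"

lemma subgrp_gen: "subgrp (gen S)"
  by (auto simp: subgrp_def intro: gen.intros)

lemma gen_incl: "S \<subseteq> gen S"
  by (auto intro: gen_base)

lemma gen_least: "subgrp H \<Longrightarrow> S \<subseteq> H \<Longrightarrow> gen S \<subseteq> H"
proof
  fix x assume H: "subgrp H" "S \<subseteq> H" and "x \<in> gen S"
  from this(3) show "x \<in> H"
    by induction (use H in \<open>auto simp: subgrp_def\<close>)
qed

lemma gen_mono: "S \<subseteq> T \<Longrightarrow> gen S \<subseteq> gen T"
  by (meson gen_incl gen_least order_trans subgrp_gen)

lemma gen_eqI: "subgrp H \<Longrightarrow> S \<subseteq> H \<Longrightarrow> H \<subseteq> gen S \<Longrightarrow> gen S = H"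
  using gen_least by blast

lemma gen_self: "subgrp H \<Longrightarrow> gen H = H"
  by (rule gen_eqI) (auto intro: gen_base)

lemma gen_gen_Un: "gen (gen S \<union> T) = gen (S \<union> T)"
proof (rule gen_eqI)
  show "gen S \<union> T \<subseteq> gen (S \<union> T)" by (meson Un_least gen_incl gen_mono le_sup_iff order_refl)
  show "gen (S \<union> T) \<subseteq> gen (gen S \<union> T)" by (intro gen_mono) (use gen_incl in blast)
qed (rule subgrp_gen)

definition fin_gen :: "'a::mult_group set \<Rightarrow> bool" where
  "fin_gen H \<longleftrightarrow> (\<exists>S. finite S \<and> H = gen S)"

text \<open>For infinite K the inclusion g K g^-1 in K can be strict. Asking for both conjugations
  makes this the true normalizer, which is a subgroup.\<close>

definition normz :: "'a::mult_group set \<Rightarrow> 'a set" where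
  "normz K = {g. \<forall>x\<in>K. g * x * inverse g \<in> K \<and> inverse g * x * g \<in> K}"

lemma normz_conj: "g \<in> normz K \<Longrightarrow> x \<in> K \<Longrightarrow> g * x * inverse g \<in> K"
  and normz_conj': "g \<in> normz K \<Longrightarrow> x \<in> K \<Longrightarrow> inverse g * x * g \<in> K"
  by (auto simp: normz_def)

lemma subgrp_normz: "subgrp (normz K)"
proof (rule subgrpI)
  fix x y assume "x \<in> normz K" "y \<in> normz K"
  then show "x * y \<in> normz K"
    unfolding normz_def by (auto simp: mult.assoc) (metis mult.assoc)+
qed (auto simp: normz_def)

lemma subset_normz: "subgrp K \<Longrightarrow> K \<subseteq> normz K"
  by (auto simp: normz_def subgrp_def)

lemma normz_Int: "normz K \<inter> normz L \<subseteq> normz (K \<inter> L)"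
  by (auto simp: normz_def)

lemma conj_gen_in:
  assumes "subgrp T" "\<And>x. x \<in> S \<Longrightarrow> g * x * inverse g \<in> T" "x \<in> gen S"
  shows "g * x * inverse g \<in> T"
  using assms(3)
proof induction
  case (gen_mult x y)
  have "g * (x * y) * inverse g = (g * x * inverse g) * (g * y * inverse g)"
    by (simp add: mult.assoc)
  with gen_mult show ?case by (metis subgrp_mult[OF assms(1)])
next
  case (gen_inv x)
  have "g * inverse x * inverse g = inverse (g * x * inverse g)"
    by (simp add: mult.assoc)
  with gen_inv show ?case by (metis subgrp_inv[OF assms(1)])
qed (use assms(2) subgrp_one[OF assms(1)] in auto)

lemma normz_gen:
  assumes "\<And>x. x \<in> S \<Longrightarrow> g * x * inverse g \<in> gen S"
    and "\<And>x. x \<in> S \<Longrightarrow> inverse g * x * g \<in> gen S"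
  shows "g \<in> normz (gen S)"
  using conj_gen_in[OF subgrp_gen, of S g] conj_gen_in[OF subgrp_gen, of S "inverse g"] assms
  by (auto simp: normz_def)

text \<open>A conjugate is a commutator times the element itself: h x h^-1 = [h, x] x.\<close>

lemma normz_if_commutators:
  assumes "subgrp H" "subgrp K" "K \<subseteq> H"
    and "\<And>x y. x \<in> H \<Longrightarrow> y \<in> H \<Longrightarrow> x * y * inverse x * inverse y \<in> K"
  shows "H \<subseteq> normz K"
proof
  fix g assume g: "g \<in> H"
  have *: "h * x * inverse h \<in> K" if "h \<in> H" "x \<in> K" for h x
  proof -
    have "h * x * inverse h * inverse x \<in> K" using that assms by blast
    then show ?thesis using that subgrp_mult_right_iff[OF assms(2)] subgrp_inv[OF assms(2)] by blast
  qed
  show "g \<in> normz K"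
    using *[OF g] *[OF subgrp_inv[OF assms(1) g]] by (auto simp: normz_def)
qed

text \<open>Since t normalizes K, powers of t can be moved to the right past K. The form k t^i need
  not be unique: some power of t may lie in K.\<close>

lemma gen_insert_eq:
  assumes K: "subgrp K" and t: "t \<in> normz K"
  shows "gen (insert t K) = {k * zpow t i | k i. k \<in> K}"
proof (rule gen_eqI)
  have z: "zpow t i * k * inverse (zpow t i) \<in> K" if "k \<in> K" for k i
    using normz_conj[OF subgrp_zpow[OF subgrp_normz t] that] .
  show "subgrp {k * zpow t i | k i. k \<in> K}"
  proof (rule subgrpI)
    show "1 \<in> {k * zpow t i | k i. k \<in> K}"
      using subgrp_one[OF K] by (auto intro!: exI[of _ 1] exI[of _ 0])
  next
    fix x y assume "x \<in> {k * zpow t i | k i. k \<in> K}" "y \<in> {k * zpow t i | k i. k \<in> K}"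
    then obtain k i k' i' where *: "x = k * zpow t i" "y = k' * zpow t i'" "k \<in> K" "k' \<in> K" by blast
    have "x * y = (k * (zpow t i * k' * inverse (zpow t i))) * zpow t (i + i')"
      by (simp add: * mult.assoc zpow_add)
    moreover have "k * (zpow t i * k' * inverse (zpow t i)) \<in> K"
      using * z subgrp_mult[OF K] by blast
    ultimately show "x * y \<in> {k * zpow t i | k i. k \<in> K}" by blast
  next
    fix x assume "x \<in> {k * zpow t i | k i. k \<in> K}"
    then obtain k i where *: "x = k * zpow t i" "k \<in> K" by blast
    have "inverse x = (zpow t (- i) * inverse k * inverse (zpow t (- i))) * zpow t (- i)"
      by (simp add: * mult.assoc zpow_minus)
    moreover have "zpow t (- i) * inverse k * inverse (zpow t (- i)) \<in> K"
      using * z subgrp_inv[OF K] by blast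
    ultimately show "inverse x \<in> {k * zpow t i | k i. k \<in> K}" by blast
  qed
  show "insert t K \<subseteq> {k * zpow t i | k i. k \<in> K}"
  proof
    fix x assume "x \<in> insert t K"
    then consider "x = 1 * zpow t 1" | "x \<in> K" "x = x * zpow t 0" by auto
    then show "x \<in> {k * zpow t i | k i. k \<in> K}"
      by cases (use subgrp_one[OF K] in blast)+
  qed
  show "{k * zpow t i | k i. k \<in> K} \<subseteq> gen (insert t K)"
    by (auto intro!: gen_mult subgrp_zpow[OF subgrp_gen] intro: gen_base)
qed

text \<open>The least positive element divides everything, by division with remainder; m = 0 covers
  the zero subgroup. It is applied to the exponents of t that occur in a given subgroup.\<close>

lemma int_subgroup_cyclic:
  fixes Z :: "int set"
  assumes "0 \<in> Z" and sub: "\<And>x y. x \<in> Z \<Longrightarrow> y \<in> Z \<Longrightarrow> x - y \<in> Z"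
  shows "\<exists>m\<in>Z. \<forall>z\<in>Z. m dvd z"
proof (cases "Z = {0}")
  case True
  then show ?thesis by simp
next
  case False
  have neg: "- x \<in> Z" if "x \<in> Z" for x using sub[OF assms(1) that] by simp
  from False assms(1) obtain z where "z \<in> Z" "z \<noteq> 0" by blast
  with neg[of z] have "\<exists>n. n > 0 \<and> int n \<in> Z"
    by (cases "z > 0") (force intro: exI[of _ "nat \<bar>z\<bar>"])+
  define m where "m = (LEAST n. n > 0 \<and> int n \<in> Z)"
  from LeastI_ex[OF \<open>\<exists>n. n > 0 \<and> int n \<in> Z\<close>] have m: "m > 0" "int m \<in> Z"
    by (auto simp: m_def)
  have min: "n \<ge> m" if "n > 0" "int n \<in> Z" for n
    using Least_le[of "\<lambda>n. n > 0 \<and> int n \<in> Z" n] that by (simp add: m_def)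
  have mult: "int m * q \<in> Z" for q
  proof (induction q rule: int_induct[where k = 0])
    case (step1 i)
    then show ?case using sub[OF step1(2) neg[OF m(2)]] by (simp add: distrib_left)
  next
    case (step2 i)
    then show ?case using sub[OF step2(2) m(2)] by (simp add: right_diff_distrib)
  qed (use assms in simp)
  have "int m dvd z" if "z \<in> Z" for z
  proof -
    have "z mod int m \<in> Z"
      using sub[OF that mult[of "z div int m"]] by (simp add: minus_mult_div_eq_mod)
    moreover have "0 \<le> z mod int m" "z mod int m < int m" using m by auto
    ultimately have "z mod int m = 0"
      using min[of "nat (z mod int m)"] by (cases "z mod int m = 0") auto
    then show ?thesis by auto
  qed
  with m show ?thesis by blast
qed

subsection \<open>Growth\<close>

primrec word_ball :: "'a::mult_group set \<Rightarrow> nat \<Rightarrow> 'a set" where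
  "word_ball S 0 = {1}"
| "word_ball S (Suc n) = word_ball S n \<union> (\<lambda>(x, s). x * s) ` (word_ball S n \<times> (S \<union> inverse ` S))"

lemma word_ball_mono_Suc: "word_ball S n \<subseteq> word_ball S (Suc n)"
  by simp

lemma word_ball_mono: "m \<le> n \<Longrightarrow> word_ball S m \<subseteq> word_ball S n"
  by (rule lift_Suc_mono_le) (rule word_ball_mono_Suc)

lemma one_in_word_ball [simp]: "1 \<in> word_ball S n"
  by (induction n) auto

lemma finite_word_ball: "finite S \<Longrightarrow> finite (word_ball S n)"
  by (induction n) auto

lemma word_ball_mult: "x \<in> word_ball S m \<Longrightarrow> y \<in> word_ball S n \<Longrightarrow> x * y \<in> word_ball S (m + n)"
proof (induction n arbitrary: y)
  case (Suc n)
  from Suc.prems(2) consider "y \<in> word_ball S n"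
    | z s where "y = z * s" "z \<in> word_ball S n" "s \<in> S \<union> inverse ` S"
    by auto
  then show ?case
  proof cases
    case 1
    with Suc show ?thesis by auto
  next
    case 2
    then have "x * z \<in> word_ball S (m + n)" using Suc by blast
    then have "(x * z) * s \<in> word_ball S (Suc (m + n))" using 2(3) by force
    then show ?thesis by (simp add: 2 mult.assoc)
  qed
qed simp

lemma word_ball_1: "s \<in> S \<union> inverse ` S \<Longrightarrow> s \<in> word_ball S 1"
  by force

lemma word_ball_inverse: "x \<in> word_ball S n \<Longrightarrow> inverse x \<in> word_ball S n"
proof (induction n arbitrary: x)
  case (Suc n)
  from Suc.prems consider "x \<in> word_ball S n"
    | z s where "x = z * s" "z \<in> word_ball S n" "s \<in> S \<union> inverse ` S"
    by auto
  then show ?case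
  proof cases
    case 1
    with Suc show ?thesis by auto
  next
    case 2
    then have "inverse s \<in> word_ball S 1" by (intro word_ball_1) auto
    with Suc.IH[OF 2(2)] word_ball_mult[of "inverse s" S 1 "inverse z" n] show ?thesis
      by (simp add: 2)
  qed
qed simp

lemma gen_eq_word_balls: "gen S = (\<Union>n. word_ball S n)"
proof
  show "gen S \<subseteq> (\<Union>n. word_ball S n)"
  proof
    fix x assume "x \<in> gen S"
    then show "x \<in> (\<Union>n. word_ball S n)"
    proof induction
      case (gen_base s)
      then show ?case using word_ball_1[of s S] by blast
    qed (blast intro: word_ball_mult word_ball_inverse one_in_word_ball)+
  qed
  have "word_ball S n \<subseteq> gen S" for n
    by (induction n) (auto intro: gen.intros)
  then show "(\<Union>n. word_ball S n) \<subseteq> gen S" by blast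
qed

lemma word_ball_subset_gen: "word_ball S n \<subseteq> gen S"
  by (auto simp: gen_eq_word_balls)

lemma word_ball_subset_word_ball:
  assumes "S \<subseteq> word_ball T L"
  shows "word_ball S n \<subseteq> word_ball T (n * L)"
proof (induction n)
  case (Suc n)
  have "x * s \<in> word_ball T (n * L + L)" if "x \<in> word_ball S n" "s \<in> S \<union> inverse ` S" for x s
    using that Suc assms by (intro word_ball_mult) (auto intro: word_ball_inverse)
  with Suc word_ball_mono[of "n * L" "n * L + L" T] show ?case by (auto simp: add.commute)
qed simp

text \<open>Quantifying over all finite subsets makes the notion pass to subgroups whose finite
  generation is still to be shown.\<close>

definition poly_growth :: "'a::mult_group set \<Rightarrow> bool" where
  "poly_growth H \<longleftrightarrow> (\<forall>S. finite S \<and> S \<subseteq> H \<longrightarrow>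
     (\<exists>C d. \<forall>n. card (word_ball S n) \<le> C * (n + 1) ^ d))"

lemma poly_growth_subset: "poly_growth H \<Longrightarrow> K \<subseteq> H \<Longrightarrow> poly_growth K"
  unfolding poly_growth_def by (meson order_trans)

text \<open>Any finite S in the group lies in some T-ball of radius L, so an S-ball of radius n lies
  in the T-ball of radius n L.\<close>

lemma poly_growth_gen:
  assumes "finite T" and "\<And>n. card (word_ball T n) \<le> C * (n + 1) ^ d"
  shows "poly_growth (gen T)"
  unfolding poly_growth_def
proof (intro allI impI)
  fix S assume S: "finite S \<and> S \<subseteq> gen T"
  then have "\<forall>s\<in>S. \<exists>L. s \<in> word_ball T L" by (auto simp: gen_eq_word_balls)
  then obtain l where l: "\<And>s. s \<in> S \<Longrightarrow> s \<in> word_ball T (l s)" by metis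
  have "S \<subseteq> word_ball T (Max (l ` S))"
  proof
    fix s assume s: "s \<in> S"
    with S have "l s \<le> Max (l ` S)" by simp
    with l[OF s] show "s \<in> word_ball T (Max (l ` S))" using word_ball_mono by blast
  qed
  then obtain L where L: "S \<subseteq> word_ball T L" by blast
  have "card (word_ball S n) \<le> (C * (L + 1) ^ d) * (n + 1) ^ d" for n
  proof -
    have "card (word_ball S n) \<le> card (word_ball T (n * L))"
      using word_ball_subset_word_ball[OF L] finite_word_ball[OF assms(1)] by (rule card_mono[rotated])
    also have "\<dots> \<le> C * (n * L + 1) ^ d" by (rule assms)
    also have "\<dots> \<le> C * ((L + 1) * (n + 1)) ^ d"
      by (intro mult_left_mono power_mono) (auto simp: algebra_simps)
    finally show ?thesis by (simp only: power_mult_distrib mult.assoc)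
  qed
  then show "\<exists>C d. \<forall>n. card (word_ball S n) \<le> C * (n + 1) ^ d" by blast
qed

section \<open>Polycyclicity of solvable groups of polynomial growth\<close>

primrec bword :: "'a::mult_group \<Rightarrow> 'a \<Rightarrow> bool list \<Rightarrow> 'a" where
  "bword t k [] = 1"
| "bword t k (b # l) = (if b then k else 1) * t * bword t k l"

lemma bword_append: "bword t k (l @ l') = bword t k l * bword t k l'"
  by (induction l) (simp_all add: mult.assoc)

lemma bword_in_word_ball: "bword t k l \<in> word_ball {t, k} (length l * 2)"
proof (induction l)
  case (Cons b l)
  have "(if b then k else 1) * t \<in> word_ball {t, k} (1 + 1)"
    by (intro word_ball_mult) (auto simp: word_ball_1[unfolded One_nat_def] simp del: word_ball.simps)
  from word_ball_mult[OF this Cons] show ?case by (simp del: word_ball.simps)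
qed simp

lemma square_le_two_power: "4 \<le> n \<Longrightarrow> n\<^sup>2 \<le> (2::nat) ^ n"
proof (induction n rule: dec_induct)
  case (step n)
  then have "4 * n \<le> n * n" by simp
  with step have "2 * n + 1 \<le> n\<^sup>2" unfolding power2_eq_square by linarith
  moreover have "(Suc n)\<^sup>2 = n\<^sup>2 + (2 * n + 1)" by (simp add: power2_eq_square)
  ultimately show ?case using step by simp
qed simp

lemma poly_less_two_power: "\<exists>n. C * (n * 2 + 1) ^ d < (2::nat) ^ n"
proof -
  \<comment> \<open>The witness is n = 2^j. The left side is then below 2^(C + (j + 2) d), whose
    exponent is linear in j, and j is large enough for j^2 to exceed it.\<close>
  define j where "j = C + d + 4"
  have "C + (j + 2) * d < j\<^sup>2" by (simp add: j_def power2_eq_square algebra_simps)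
  also have "j\<^sup>2 \<le> 2 ^ j" by (rule square_le_two_power) (simp add: j_def)
  finally have 1: "C + (j + 2) * d < 2 ^ j" .
  have "C * (2 ^ j * 2 + 1) ^ d \<le> 2 ^ C * (2 ^ (j + 2)) ^ d"
    by (intro mult_mono power_mono) (use less_exp[of C] in auto)
  also have "\<dots> = 2 ^ (C + (j + 2) * d)" by (simp only: power_add[of 2 C] power_mult)
  also have "\<dots> < 2 ^ 2 ^ j" by (rule power_strict_increasing[OF 1]) simp
  finally show ?thesis by blast
qed

text \<open>Pigeonhole: the 2^n words with n letters t lie in a ball of radius 2 n, which has only
  polynomially many elements.\<close>

lemma growth_collision:
  assumes "poly_growth H" "t \<in> H" "k \<in> H"
  obtains l l' where "length l = length l'" "l \<noteq> l'" "bword t k l = bword t k l'"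
proof -
  obtain C d where C: "\<And>n. card (word_ball {t, k} n) \<le> C * (n + 1) ^ d"
    using assms unfolding poly_growth_def
    by (metis empty_subsetI finite.emptyI finite_insert insert_subset)
  obtain n where n: "C * (n * 2 + 1) ^ d < 2 ^ n" using poly_less_two_power by blast
  let ?W = "{l :: bool list. length l = n}"
  have "card (bword t k ` ?W) \<le> card (word_ball {t, k} (n * 2))"
    by (rule card_mono) (use bword_in_word_ball in \<open>auto intro: finite_word_ball\<close>)
  also have "\<dots> < card ?W"
    using C[of "n * 2"] n card_lists_length_eq[of "UNIV :: bool set" n] by simp
  finally have "\<not> inj_on (bword t k) ?W" using card_image by fastforce
  then show ?thesis using that by (auto simp: inj_on_def)
qed

text \<open>Moving every t to the right turns a factor k preceded by i letters t into t^i k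
  t^-i.\<close>

lemma bword_decompose:
  "\<exists>y \<in> gen ((\<lambda>i. t ^ i * k * inverse (t ^ i)) ` {..<length l}). bword t k l = y * t ^ length l"
proof (induction l rule: rev_induct)
  case Nil
  then show ?case by (auto intro: gen_one)
next
  case (snoc b l)
  let ?X = "\<lambda>i. t ^ i * k * inverse (t ^ i)" and ?n = "length l"
  from snoc obtain y where y: "y \<in> gen (?X ` {..<?n})" "bword t k l = y * t ^ ?n" by blast
  have "bword t k (l @ [b]) = (y * (if b then ?X ?n else 1)) * t ^ Suc ?n"
    by (simp add: bword_append y(2) mult.assoc power_Suc2 del: power_Suc)
  moreover have "?X ` {..<?n} \<subseteq> ?X ` {..<Suc ?n}" by (intro image_mono) auto
  then have "y \<in> gen (?X ` {..<Suc ?n})" using y(1) gen_mono by blast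
  then have "y * (if b then ?X ?n else 1) \<in> gen (?X ` {..<Suc ?n})"
    by (auto intro: gen_mult gen_base)
  ultimately show ?case by auto
qed

text \<open>Cancel the common right end. At the last difference, position i, one word has k and the
  other does not, so t^i k t^-i is a quotient of two products of conjugates with smaller
  exponents.\<close>

lemma bword_collision_imp:
  assumes "length l = length l'" "l \<noteq> l'" "bword t k l = bword t k l'"
  shows "\<exists>i. t ^ i * k * inverse (t ^ i) \<in> gen ((\<lambda>i. t ^ i * k * inverse (t ^ i)) ` {..<i})"
  using assms
proof (induction l arbitrary: l' rule: rev_induct)
  case (snoc b p)
  let ?X = "\<lambda>i. t ^ i * k * inverse (t ^ i)"
  obtain p' b' where l': "l' = p' @ [b']" using snoc.prems(1) by (cases l' rule: rev_cases) auto
  have len: "length p = length p'" using snoc.prems l' by simp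
  have eq: "bword t k p * (if b then k else 1) = bword t k p' * (if b' then k else 1)"
    using snoc.prems(3) by (simp add: l' bword_append flip: mult.assoc)
  show ?case
  proof (cases "b = b'")
    case True
    then have "bword t k p = bword t k p'" "p \<noteq> p'" using eq snoc.prems l' by auto
    then show ?thesis using snoc.IH[OF len] by blast
  next
    case False
    obtain y where y: "y \<in> gen (?X ` {..<length p})" "bword t k p = y * t ^ length p"
      using bword_decompose by blast
    obtain y' where y': "y' \<in> gen (?X ` {..<length p})" "bword t k p' = y' * t ^ length p"
      using bword_decompose[of t k p'] len by auto
    have "?X (length p) = inverse y * y' \<or> ?X (length p) = inverse y' * y"
    proof (cases b)
      case True
      with False eq have "y * t ^ length p * k = y' * t ^ length p" by (simp add: y y')
      then have "t ^ length p * k = inverse y * y' * t ^ length p"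
        by (metis inverse_mult_cancel mult.assoc)
      then show ?thesis by (simp add: mult.assoc)
    next
      case b: False
      with False eq have "y' * t ^ length p * k = y * t ^ length p" by (simp add: y y')
      then have "t ^ length p * k = inverse y' * y * t ^ length p"
        by (metis inverse_mult_cancel mult.assoc)
      then show ?thesis by (simp add: mult.assoc)
    qed
    moreover have "inverse y * y' \<in> gen (?X ` {..<length p})" "inverse y' * y \<in> gen (?X ` {..<length p})"
      by (intro gen_mult gen_inv y(1) y'(1))+
    ultimately show ?thesis by (intro exI[of _ "length p"]) auto
  qed
qed simp

text \<open>Conjugation by t sends the j-th conjugate to the next one. As the i-th lies in the group
  generated by those before it, this group is stable under t and contains the whole forward
  orbit.\<close>

lemma conj_orbit_pos:
  assumes "poly_growth H" "t \<in> H" "k \<in> H"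
  obtains i where "\<And>m. t ^ m * k * inverse (t ^ m) \<in> gen ((\<lambda>i. t ^ i * k * inverse (t ^ i)) ` {..<i})"
proof -
  let ?X = "\<lambda>i. t ^ i * k * inverse (t ^ i)"
  obtain l l' where "length l = length l'" "l \<noteq> l'" "bword t k l = bword t k l'"
    using growth_collision[OF assms] .
  then obtain i where i: "?X i \<in> gen (?X ` {..<i})" using bword_collision_imp by blast
  have conj: "t * x * inverse t \<in> gen (?X ` {..<i})" if "x \<in> gen (?X ` {..<i})" for x
  proof (rule conj_gen_in[OF subgrp_gen _ that])
    fix x assume "x \<in> ?X ` {..<i}"
    then obtain j where j: "j < i" "x = ?X j" by blast
    then have "t * x * inverse t = ?X (Suc j)" by (simp add: mult.assoc)
    moreover have "?X (Suc j) \<in> gen (?X ` {..<i})"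
    proof (cases "Suc j = i")
      case False
      with j have "Suc j \<in> {..<i}" by simp
      then show ?thesis by (intro gen_base imageI)
    qed (use i in simp)
    ultimately show "t * x * inverse t \<in> gen (?X ` {..<i})" by simp
  qed
  have "?X m \<in> gen (?X ` {..<i})" for m
  proof (induction m)
    case 0
    show ?case
    proof (cases "i = 0")
      case False
      then show ?thesis by (intro gen_base imageI) simp
    qed (use i in simp)
  next
    case (Suc m)
    then show ?case using conj[of "?X m"] by (simp add: mult.assoc)
  qed
  then show ?thesis using that by blast
qed

text \<open>The forward orbits of t and of its inverse are treated separately. F stays inside the
  orbit, so it lies in every subgroup that contains k and is normalized by t.\<close>

lemma conj_orbit_finite:
  assumes "poly_growth H" "subgrp H" "t \<in> H" "k \<in> H"
  obtains F where "finite F" "F \<subseteq> (\<lambda>i. zpow t i * k * inverse (zpow t i)) ` UNIV"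
    "\<And>i. zpow t i * k * inverse (zpow t i) \<in> gen F"
proof -
  let ?X = "\<lambda>i. zpow t i * k * inverse (zpow t i)"
  obtain m where m: "\<And>j. t ^ j * k * inverse (t ^ j) \<in> gen ((\<lambda>i. t ^ i * k * inverse (t ^ i)) ` {..<m})"
    using conj_orbit_pos[OF assms(1,3,4)] by blast
  obtain n where n: "\<And>j. inverse t ^ j * k * inverse (inverse t ^ j) \<in>
      gen ((\<lambda>i. inverse t ^ i * k * inverse (inverse t ^ i)) ` {..<n})"
    using conj_orbit_pos[OF assms(1) subgrp_inv[OF assms(2,3)] assms(4)] by blast
  have neg: "inverse t ^ j = zpow t (- int j)" for j
    by (simp add: zpow_minus group_inverse_power)
  let ?F = "?X ` (int ` {..<m} \<union> (\<lambda>j. - int j) ` {..<n})"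
  show ?thesis
  proof (rule that[of ?F])
    fix i :: int
    show "?X i \<in> gen ?F"
    proof (cases "i \<ge> 0")
      case True
      then obtain j where j: "i = int j" using nonneg_int_cases by blast
      have "?X i \<in> gen ((\<lambda>i. t ^ i * k * inverse (t ^ i)) ` {..<m})" using m[of j] by (simp add: j)
      moreover have "(\<lambda>i. t ^ i * k * inverse (t ^ i)) ` {..<m} \<subseteq> ?F"
        by (auto simp: image_image image_Un)
      ultimately show ?thesis using gen_mono by blast
    next
      case False
      then obtain j where j: "i = - int j" by (metis int_cases2 of_nat_0_le_iff)
      have "?X i \<in> gen ((\<lambda>i. inverse t ^ i * k * inverse (inverse t ^ i)) ` {..<n})"
        using n[of j] by (simp add: j neg)
      moreover have "(\<lambda>i. inverse t ^ i * k * inverse (inverse t ^ i)) ` {..<n} \<subseteq> ?F"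
        by (auto simp: image_image image_Un neg)
      ultimately show ?thesis using gen_mono by blast
    qed
  qed auto
qed

text \<open>Milnor's argument: the conjugates \<open>t\<^sup>i k t\<^sup>-\<^sup>i\<close> of finitely many elements of \<open>K\<close> span, together
  with \<open>t\<close>, the whole group, and each orbit of conjugates lies in a finitely generated group.\<close>

lemma fin_gen_cyclic_kernel:
  assumes K: "subgrp K" "t \<in> normz K"
    and fg: "fin_gen (gen (insert t K))" and gr: "poly_growth (gen (insert t K))"
  shows "fin_gen K"
proof -
  let ?H = "gen (insert t K)" and ?X = "\<lambda>k i. zpow t i * k * inverse (zpow t i)"
  have tH: "t \<in> ?H" and KH: "K \<subseteq> ?H" by (auto intro: gen_base)
  obtain S where S: "finite S" "?H = gen S" using fg by (auto simp: fin_gen_def)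
  have "\<forall>s\<in>S. \<exists>k\<in>K. \<exists>i. s = k * zpow t i"
    using gen_incl[of S] unfolding S(2)[symmetric] gen_insert_eq[OF K] by blast
  then obtain k e where k: "\<And>s. s \<in> S \<Longrightarrow> k s \<in> K \<and> s = k s * zpow t (e s)" by metis
  have "\<forall>s\<in>S. \<exists>F. finite F \<and> F \<subseteq> range (?X (k s)) \<and> (\<forall>i. ?X (k s) i \<in> gen F)"
  proof
    fix s assume "s \<in> S"
    then have "k s \<in> ?H" using k KH by blast
    from conj_orbit_finite[OF gr subgrp_gen tH this]
    show "\<exists>F. finite F \<and> F \<subseteq> range (?X (k s)) \<and> (\<forall>i. ?X (k s) i \<in> gen F)" by metis
  qed
  then obtain F where F: "\<And>s. s \<in> S \<Longrightarrow> finite (F s) \<and> F s \<subseteq> range (?X (k s)) \<and>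
      (\<forall>i. ?X (k s) i \<in> gen (F s))" by metis
  define U where "U = (\<Union>s\<in>S. F s)"
  have finU: "finite U" using S(1) F by (auto simp: U_def)
  have orb: "?X (k s) i \<in> gen U" if "s \<in> S" for s i
    using F[OF that] gen_mono[of "F s" U] that by (auto simp: U_def)
  have UK: "U \<subseteq> K"
    using F k normz_conj[OF subgrp_zpow[OF subgrp_normz K(2)]] by (fastforce simp: U_def)
  have shift: "?X a (i + j) = zpow t i * ?X a j * inverse (zpow t i)" for a i j
    by (simp add: zpow_add mult.assoc)
  have "t \<in> normz (gen U)"
  proof (rule normz_gen)
    fix x assume "x \<in> U"
    then obtain s i where s: "s \<in> S" "x = ?X (k s) i" using F unfolding U_def by blast
    show "t * x * inverse t \<in> gen U"
      using orb[OF s(1), of "1 + i"] shift[of 1 i "k s"] by (simp add: s)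
    show "inverse t * x * t \<in> gen U"
      using orb[OF s(1), of "- 1 + i"] shift[of "- 1" i "k s"] by (simp add: s)
  qed
  then have ins: "gen (insert t (gen U)) = {l * zpow t i | l i. l \<in> gen U}"
    by (rule gen_insert_eq[OF subgrp_gen])
  have "S \<subseteq> gen (insert t (gen U))"
  proof
    fix s assume s: "s \<in> S"
    then have "k s \<in> gen U" using orb[OF s, of 0] by simp
    then show "s \<in> gen (insert t (gen U))" unfolding ins using k[OF s] by blast
  qed
  then have Hsub: "?H \<subseteq> gen (insert t (gen U))" using S(2) gen_least[OF subgrp_gen] by blast
  \<comment> \<open>Elements of K are l t^i with l in \<open>gen U\<close>, and then t^i lies in K.
    These exponents are the multiples of one m, so \<open>zpow t m\<close> is the only generator
    missing from U.\<close>
  define Z where "Z = {i. zpow t i \<in> K}"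
  have Z0: "0 \<in> Z" by (simp add: Z_def subgrp_one[OF K(1)])
  have "x - y \<in> Z" if "x \<in> Z" "y \<in> Z" for x y
    using that zpow_add[of t x "- y"] by (simp add: Z_def zpow_minus subgrp_mult subgrp_inv K(1))
  from int_subgroup_cyclic[OF Z0 this]
  obtain m where m: "m \<in> Z" "\<And>z. z \<in> Z \<Longrightarrow> m dvd z" by metis
  have "gen (insert (zpow t m) U) = K"
  proof (rule gen_eqI[OF K(1)])
    show "insert (zpow t m) U \<subseteq> K" using UK m(1) by (simp add: Z_def)
    show "K \<subseteq> gen (insert (zpow t m) U)"
    proof
      fix x assume x: "x \<in> K"
      then obtain l i where l: "x = l * zpow t i" "l \<in> gen U" using KH Hsub ins by blast
      have "gen U \<subseteq> K" by (rule gen_least[OF K(1) UK])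
      then have "i \<in> Z" using x l subgrp_mult_left_iff[OF K(1)] by (auto simp: Z_def)
      then obtain q where "i = m * q" using m(2) by (auto elim: dvdE)
      moreover have "l \<in> gen (insert (zpow t m) U)" using l gen_mono[of U] by blast
      ultimately show "x \<in> gen (insert (zpow t m) U)"
        using gen_mult[OF _ subgrp_zpow[OF subgrp_gen gen_base]] by (auto simp: l zpow_mult)
    qed
  qed
  then show ?thesis using finU by (auto simp: fin_gen_def intro!: exI[of _ "insert (zpow t m) U"])
qed

section \<open>From solvable to polycyclic groups\<close>

inductive solv :: "'a::mult_group set \<Rightarrow> bool" where
  solv_trivial: "solv {1}"
| solv_extend: "solv K \<Longrightarrow> subgrp K \<Longrightarrow> subgrp H \<Longrightarrow> K \<subseteq> H \<Longrightarrow>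
    (\<And>x y. x \<in> H \<Longrightarrow> y \<in> H \<Longrightarrow> x * y * inverse x * inverse y \<in> K) \<Longrightarrow> solv H"

inductive polycyclic :: "'a::mult_group set \<Rightarrow> bool" where
  polycyclic_trivial: "polycyclic {1}"
| polycyclic_extend: "polycyclic K \<Longrightarrow> subgrp K \<Longrightarrow> t \<in> normz K \<Longrightarrow> polycyclic (gen (insert t K))"

text \<open>The elements of A are adjoined one at a time. Every intermediate group contains all
  commutators, hence is normalized by H; finite generation descends from the top and polycyclicity
  climbs from K.\<close>

lemma polycyclic_abelian_extension:
  assumes "finite A" "A \<subseteq> H" "subgrp H" "subgrp K" "K \<subseteq> H" "poly_growth H"
    and "\<And>x y. x \<in> H \<Longrightarrow> y \<in> H \<Longrightarrow> x * y * inverse x * inverse y \<in> K"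
    and "fin_gen (gen (K \<union> A))"
  shows "fin_gen K \<and> (polycyclic K \<longrightarrow> polycyclic (gen (K \<union> A)))"
  using assms(1,2,8)
proof (induction A)
  case empty
  then show ?case by (simp add: gen_self[OF assms(4)])
next
  case (insert a A)
  let ?K = "gen (K \<union> A)"
  have KH: "?K \<subseteq> H" using gen_least[OF assms(3)] assms(5) insert.prems by simp
  have "H \<subseteq> normz ?K"
    by (rule normz_if_commutators[OF assms(3) subgrp_gen KH]) (use assms(7) gen_incl in blast)
  then have a: "a \<in> normz ?K" using insert.prems by blast
  have eq: "gen (K \<union> insert a A) = gen (insert a ?K)"
    using gen_gen_Un[of "K \<union> A" "{a}"] by simp
  have "gen (insert a ?K) \<subseteq> H" by (rule gen_least[OF assms(3)]) (use KH insert.prems in auto)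
  from fin_gen_cyclic_kernel[OF subgrp_gen a _ poly_growth_subset[OF assms(6) this]]
  have "fin_gen ?K" using insert.prems(2) unfolding eq by blast
  moreover have "A \<subseteq> H" using insert.prems by blast
  ultimately show ?case
    using insert.IH polycyclic_extend[OF _ subgrp_gen a] unfolding eq by blast
qed

lemma solv_imp_polycyclic:
  assumes "solv H" "fin_gen H" "poly_growth H"
  shows "polycyclic H"
  using assms
proof (induction rule: solv.induct)
  case solv_trivial
  then show ?case by (simp add: polycyclic_trivial)
next
  case (solv_extend K H)
  obtain S where S: "finite S" "H = gen S" using solv_extend.prems by (auto simp: fin_gen_def)
  have SH: "S \<subseteq> H" using gen_incl S(2) by blast
  have H: "gen (K \<union> S) = H"
    by (rule gen_eqI) (use solv_extend S SH gen_mono[of S "K \<union> S"] in auto)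
  have "fin_gen K \<and> (polycyclic K \<longrightarrow> polycyclic (gen (K \<union> S)))"
    by (rule polycyclic_abelian_extension[of S H]) (use S SH H solv_extend in auto)
  then show ?case using solv_extend poly_growth_subset H by metis
qed

text \<open>L is generated by its intersection with K and one element whose exponent of t generates
  all exponents occurring in L. This is needed for the terms of a lower central series.\<close>

lemma polycyclic_subgroup_fin_gen:
  assumes "polycyclic K" "subgrp L" "L \<subseteq> K"
  shows "fin_gen L"
  using assms
proof (induction arbitrary: L rule: polycyclic.induct)
  case polycyclic_trivial
  then have "L = gen {}"
    using gen_self[OF polycyclic_trivial(1)] gen_least[of L "{}"] gen_one[of "{}"] subgrp_one[of L]
    by blast
  then show ?case by (auto simp: fin_gen_def)
next
  case (polycyclic_extend K t)
  note ins = gen_insert_eq[OF polycyclic_extend.hyps(2,3)]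
  note K = polycyclic_extend.hyps(2) and L = polycyclic_extend.prems(1)
  obtain S where S: "finite S" "L \<inter> K = gen S"
    using polycyclic_extend.IH[of "L \<inter> K"] subgrp_Int[OF L K] by (auto simp: fin_gen_def)
  \<comment> \<open>The image of L in the cyclic quotient by K, pulled back to exponents of
    t.\<close>
  define Z where "Z = {i. \<exists>k\<in>K. k * zpow t i \<in> L}"
  have Z0: "0 \<in> Z" using subgrp_one[OF K] subgrp_one[OF L] by (auto simp: Z_def)
  have "i - j \<in> Z" if ij: "i \<in> Z" "j \<in> Z" for i j
  proof -
    obtain k k' where k: "k \<in> K" "k' \<in> K" "k * zpow t i \<in> L" "k' * zpow t j \<in> L"
      using ij unfolding Z_def by blast
    have "k * zpow t i * inverse (k' * zpow t j) \<in> L"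
      by (rule subgrp_mult[OF L k(3) subgrp_inv[OF L k(4)]])
    moreover have "k * zpow t i * inverse (k' * zpow t j) =
        (k * (zpow t (i - j) * inverse k' * inverse (zpow t (i - j)))) * zpow t (i - j)"
      using zpow_add[of t i "- j"] by (simp add: mult.assoc zpow_minus)
    moreover have "k * (zpow t (i - j) * inverse k' * inverse (zpow t (i - j))) \<in> K"
      by (intro subgrp_mult[OF K] k normz_conj[OF subgrp_zpow[OF subgrp_normz]]
          polycyclic_extend.hyps(3) subgrp_inv[OF K])
    ultimately show ?thesis by (auto simp: Z_def)
  qed
  from int_subgroup_cyclic[OF Z0 this]
  obtain m where m: "m \<in> Z" "\<And>z. z \<in> Z \<Longrightarrow> m dvd z" by metis
  then obtain k where k: "k \<in> K" "k * zpow t m \<in> L" by (auto simp: Z_def)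
  let ?u = "k * zpow t m"
  \<comment> \<open>Modulo K the element \<open>?u\<close> is t^m, so its powers realize every
    exponent in Z.\<close>
  have pow: "\<exists>c\<in>K. zpow ?u q = c * zpow t (m * q)" for q
  proof (induction q rule: int_induct[where k = 0])
    case base
    show ?case using subgrp_one[OF K] by auto
  next
    case (step1 q)
    then obtain c where c: "c \<in> K" "zpow ?u q = c * zpow t (m * q)" by blast
    let ?z = "zpow t (m * q)"
    have "zpow ?u (q + 1) = (c * (?z * k * inverse ?z)) * zpow t (m * (q + 1))"
      by (simp add: zpow_plus1 c distrib_left zpow_add mult.assoc)
    moreover have "c * (?z * k * inverse ?z) \<in> K"
      by (intro subgrp_mult[OF K] c k normz_conj[OF subgrp_zpow[OF subgrp_normz]]
          polycyclic_extend.hyps(3))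
    ultimately show ?case by blast
  next
    case (step2 q)
    then obtain c where c: "c \<in> K" "zpow ?u q = c * zpow t (m * q)" by blast
    let ?z = "zpow t (m * (q - 1))"
    have q: "m * q = m * (q - 1) + m" by (simp add: algebra_simps)
    have "zpow ?u (q - 1) = (c * (?z * inverse k * inverse ?z)) * ?z"
      unfolding zpow_minus1 c q zpow_add by (simp add: mult.assoc)
    moreover have "c * (?z * inverse k * inverse ?z) \<in> K"
      by (intro subgrp_mult[OF K] c k normz_conj[OF subgrp_zpow[OF subgrp_normz]]
          polycyclic_extend.hyps(3) subgrp_inv[OF K])
    ultimately show ?case by blast
  qed
  have "gen (insert ?u S) = L"
  proof (rule gen_eqI[OF L])
    show "insert ?u S \<subseteq> L" using k S(2) gen_incl[of S] by auto
    show "L \<subseteq> gen (insert ?u S)"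
    proof
      fix x assume x: "x \<in> L"
      then obtain c i where c: "c \<in> K" "x = c * zpow t i"
        using polycyclic_extend.prems(2) ins by blast
      then have "i \<in> Z" using x by (auto simp: Z_def)
      then obtain q where q: "i = m * q" using m(2) by (auto elim: dvdE)
      obtain c' where c': "c' \<in> K" "zpow ?u q = c' * zpow t i" using pow q by blast
      have uL: "zpow ?u q \<in> L" using subgrp_zpow[OF L k(2)] .
      have eq: "x = (c * inverse c') * zpow ?u q" by (simp add: c c' mult.assoc)
      then have "c * inverse c' \<in> L" using x subgrp_mult_right_iff[OF L uL] by metis
      moreover have "c * inverse c' \<in> K" by (intro subgrp_mult[OF K] subgrp_inv[OF K] c c')
      ultimately have "c * inverse c' \<in> gen (insert ?u S)"
        using S(2) gen_mono[of S "insert ?u S"] by blast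
      then show "x \<in> gen (insert ?u S)"
        unfolding eq by (rule gen_mult[OF _ subgrp_zpow[OF subgrp_gen gen_base]]) simp
    qed
  qed
  then show ?case using S(1) by (auto simp: fin_gen_def intro!: exI[of _ "insert ?u S"])
qed

text \<open>K is covered by finitely many right cosets of N. N need not lie in K, and T may list a
  coset twice.\<close>

definition fin_index :: "'a::mult_group set \<Rightarrow> 'a set \<Rightarrow> bool" where
  "fin_index N K \<longleftrightarrow> (\<exists>T. finite T \<and> (\<forall>x\<in>K. \<exists>y\<in>N. \<exists>z\<in>T. x = y * z))"

text \<open>Exponents of t are reduced modulo m, since t^m lies in M; the new representatives are
  t^r z with 0 <= r < m and z from the old ones.\<close>

lemma fin_index_cyclic_extension:
  assumes K: "subgrp K" "t \<in> normz K" and N: "fin_index N K" "t \<in> normz N"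
    and M: "subgrp M" "N \<subseteq> M" "t ^ m \<in> M" "m > 0"
  shows "fin_index M (gen (insert t K))"
proof -
  obtain T where T: "finite T" "\<And>x. x \<in> K \<Longrightarrow> \<exists>y\<in>N. \<exists>z\<in>T. x = y * z"
    using N(1) by (auto simp: fin_index_def)
  let ?T = "(\<lambda>(r, z). zpow t r * z) ` ({0..<int m} \<times> T)"
  have "\<exists>y\<in>M. \<exists>z\<in>?T. x = y * z" if x: "x \<in> gen (insert t K)" for x
  proof -
    \<comment> \<open>The normal form has the power of t on the right. Inverting puts it on the
      left, where t^m can be absorbed into M.\<close>
    from gen_inv[OF x] obtain k i where k: "k \<in> K" "inverse x = k * zpow t i"
      unfolding gen_insert_eq[OF K] by blast
    from k(2) have "inverse (inverse x) = inverse (k * zpow t i)" by simp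
    then have xe: "x = zpow t (- i) * inverse k" by (simp add: zpow_minus)
    obtain y z where y: "y \<in> N" "z \<in> T" "inverse k = y * z"
      using T(2)[OF subgrp_inv[OF K(1) k(1)]] by blast
    define q r where "q = (- i) div int m" and "r = (- i) mod int m"
    have "- i = int m * q + r" by (simp add: q_def r_def)
    then have "zpow t (- i) = zpow (t ^ m) q * zpow t r"
      by (simp only: zpow_add zpow_mult zpow_of_nat)
    then have "x = (zpow (t ^ m) q * (zpow t r * y * inverse (zpow t r))) * (zpow t r * z)"
      by (simp add: xe y mult.assoc)
    moreover have "zpow t r * y * inverse (zpow t r) \<in> M"
      using normz_conj[OF subgrp_zpow[OF subgrp_normz N(2)] y(1)] M(2) by blast
    then have "zpow (t ^ m) q * (zpow t r * y * inverse (zpow t r)) \<in> M"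
      by (rule subgrp_mult[OF M(1) subgrp_zpow[OF M(1) M(3)]])
    moreover have "zpow t r * z \<in> ?T"
      using y(2) M(4) by (intro image_eqI[of _ _ "(r, z)"]) (auto simp: r_def)
    ultimately show ?thesis by blast
  qed
  moreover have "finite ?T" using T(1) by simp
  ultimately show ?thesis unfolding fin_index_def by blast
qed

text \<open>Climb the polycyclic series: N meets K in finite index by induction, and t^q in N bounds
  the contribution of the cyclic quotient.\<close>

lemma fin_index_if_powers:
  assumes "polycyclic K" "subgrp N" "K \<subseteq> normz N" "q > 0" "\<And>x. x \<in> K \<Longrightarrow> x ^ q \<in> N"
  shows "fin_index N K"
  using assms(1,2,3,5)
proof (induction arbitrary: N rule: polycyclic.induct)
  case polycyclic_trivial
  then show ?case unfolding fin_index_def by (intro exI[of _ "{1}"]) (auto intro: subgrp_one)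
next
  case (polycyclic_extend K t)
  have sub: "insert t K \<subseteq> gen (insert t K)" by (rule gen_incl)
  have K: "K \<subseteq> normz (N \<inter> K)" and t: "t \<in> normz (N \<inter> K)"
    using sub polycyclic_extend.prems(2) polycyclic_extend.hyps(3) normz_Int[of N K]
      subset_normz[OF polycyclic_extend.hyps(2)] by blast+
  have "fin_index (N \<inter> K) K"
    by (rule polycyclic_extend.IH)
       (use K polycyclic_extend sub in \<open>auto intro: subgrp_Int subgrp_power\<close>)
  then show ?case
    by (rule fin_index_cyclic_extension[OF polycyclic_extend.hyps(2,3) _ t polycyclic_extend.prems(1) _ _ assms(4)])
       (use sub polycyclic_extend.prems(3) in auto)
qed

section \<open>Ideals of integer polynomials and roots of unity\<close>

abbreviation cpoly :: "int poly \<Rightarrow> complex poly" where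
  "cpoly \<equiv> map_poly of_int"

lemma coeff_cpoly [simp]: "coeff (cpoly p) i = of_int (coeff p i)"
  by (simp add: coeff_map_poly)

lemma cpoly_add: "cpoly (p + q) = cpoly p + cpoly q"
  by (intro poly_eqI) simp

lemma cpoly_diff: "cpoly (p - q) = cpoly p - cpoly q"
  by (intro poly_eqI) simp

lemma cpoly_smult: "cpoly (smult c p) = smult (of_int c) (cpoly p)"
  by (intro poly_eqI) simp

lemma cpoly_pCons [simp]: "cpoly (pCons c p) = pCons (of_int c) (cpoly p)"
  by (intro poly_eqI) (simp add: coeff_pCons split: nat.splits)

lemma cpoly_mult: "cpoly (p * q) = cpoly p * cpoly q"
  by (induction p) (simp_all add: cpoly_add cpoly_smult)

lemma cpoly_one [simp]: "cpoly 1 = 1"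
  by (simp add: one_pCons)

lemma cpoly_power: "cpoly (p ^ n) = cpoly p ^ n"
  by (induction n) (simp_all add: cpoly_mult)

lemma degree_cpoly [simp]: "degree (cpoly p) = degree p"
  by (simp add: degree_map_poly)

lemma cpoly_eq_0 [simp]: "cpoly p = 0 \<longleftrightarrow> p = 0"
  by (auto simp: poly_eq_iff)

lemma cpoly_monom: "cpoly (monom c n) = monom (of_int c) n"
  by (intro poly_eqI) simp

lemma pderiv_cpoly: "pderiv (cpoly p) = cpoly (pderiv p)"
  by (intro poly_eqI) (simp add: coeff_pderiv)

lemma poly_pcompose_monom_cpoly: "poly (cpoly (pcompose p (monom 1 j))) z = poly (cpoly p) (z ^ j)"
  by (induction p) (simp_all add: pcompose_pCons cpoly_add cpoly_mult cpoly_monom poly_monom)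

text \<open>If |z| > 2, the lower terms add up to at most (|z|^n - 1) / (|z| - 1) < |z|^n and cannot
  cancel the leading term.\<close>

lemma root_norm_le_2:
  assumes "p \<noteq> 0" "\<And>i. coeff p i \<in> {- 1, 0, 1}" "poly (cpoly p) z = 0"
  shows "norm z \<le> 2"
proof (rule ccontr)
  assume "\<not> norm z \<le> 2"
  then have z: "norm z > 2" by simp
  define n where "n = degree p"
  have c: "norm (of_int (coeff p i) :: complex) \<le> 1" for i using assms(2)[of i] by auto
  have lead: "norm (of_int (coeff p n) :: complex) = 1"
    using assms(2)[of n] assms(1) leading_coeff_0_iff[of p] by (auto simp: n_def)
  have "0 = (\<Sum>i\<le>n. of_int (coeff p i) * z ^ i)"
    using assms(3) by (simp add: poly_altdef n_def)
  also have "\<dots> = (\<Sum>i<n. of_int (coeff p i) * z ^ i) + of_int (coeff p n) * z ^ n"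
    by (simp flip: lessThan_Suc_atMost)
  finally have "of_int (coeff p n) * z ^ n = - (\<Sum>i<n. of_int (coeff p i) * z ^ i)"
    by (simp add: eq_neg_iff_add_eq_0 add.commute)
  then have "norm z ^ n = norm (\<Sum>i<n. of_int (coeff p i) * z ^ i)"
    using lead by (metis mult_1 norm_minus_cancel norm_mult norm_power)
  also have "\<dots> \<le> (\<Sum>i<n. norm z ^ i)"
    by (rule sum_norm_le) (use c in \<open>auto simp: norm_mult norm_power intro: mult_left_le_one_le\<close>)
  also have "\<dots> = (norm z ^ n - 1) / (norm z - 1)"
    using z by (intro geometric_sum) auto
  also have "\<dots> \<le> (norm z ^ n - 1) / 1"
    using z by (intro divide_left_mono) auto
  finally show False by simp
qed

lemma finite_bounded_int_polys:
  "finite {p :: int poly. degree p \<le> d \<and> (\<forall>i. \<bar>coeff p i\<bar> \<le> B)}"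
proof (rule finite_subset)
  show "{p :: int poly. degree p \<le> d \<and> (\<forall>i. \<bar>coeff p i\<bar> \<le> B)} \<subseteq>
      Poly ` {xs. set xs \<subseteq> {- B..B} \<and> length xs \<le> d + 1}"
  proof
    fix p :: "int poly" assume p: "p \<in> {p. degree p \<le> d \<and> (\<forall>i. \<bar>coeff p i\<bar> \<le> B)}"
    have "set (coeffs p) \<subseteq> {- B..B}"
    proof
      fix c assume "c \<in> set (coeffs p)"
      then obtain i where "c = coeff p i" by (auto simp: coeffs_def split: if_splits)
      moreover from p have "\<bar>coeff p i\<bar> \<le> B" by blast
      ultimately show "c \<in> {- B..B}" by auto
    qed
    moreover have "length (coeffs p) \<le> d + 1" using p by (simp add: coeffs_def)
    ultimately show "p \<in> Poly ` {xs. set xs \<subseteq> {- B..B} \<and> length xs \<le> d + 1}"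
      by (intro image_eqI[of _ _ "coeffs p"]) auto
  qed
qed (intro finite_imageI finite_lists_length_le finite_atLeastAtMost_int)

section \<open>Divisibility and minimal polynomials over the integers\<close>

lemma monic_division:
  fixes f g :: "int poly"
  assumes "lead_coeff g = 1"
  obtains q r where "f = g * q + r" "r = 0 \<or> degree r < degree g"
proof -
  obtain q r where qr: "pseudo_divmod f g = (q, r)" by fastforce
  from assms have "g \<noteq> 0" by auto
  from pseudo_divmod[OF this qr] that assms show ?thesis by simp
qed

text \<open>Gauss's lemma: contents multiply, so c divides the content of the cofactor of p and can
  be cancelled.\<close>

lemma gauss_primitive_dvd:
  fixes p h :: "int poly"
  assumes "content p = 1" "p dvd smult c h" "c \<noteq> 0"
  shows "p dvd h"
proof -
  obtain s where s: "smult c h = p * s" using assms(2) by (auto elim: dvdE)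
  have "c dvd content (p * s)" by (simp flip: s)
  then have "c dvd content s" by (simp add: content_mult assms(1))
  then have "[:c:] dvd s" by (simp add: const_poly_dvd_iff_dvd_content)
  then obtain s' where "s = [:c:] * s'" by (rule dvdE)
  then have "s = smult c s'" by simp
  with s have "smult c h = smult c (p * s')" by simp
  then have "h = p * s'" using assms(3) by (metis smult_cancel)
  then show ?thesis by simp
qed

lemma smult_unit_dvd:
  fixes p h :: "int poly"
  assumes "p dvd h" "u * u = 1"
  shows "smult u p dvd h"
proof -
  obtain s where "h = p * s" using assms(1) by (rule dvdE)
  then have "h = smult u p * smult u s" using assms(2) by simp
  then show ?thesis by (rule dvdI)
qed

text \<open>Pseudo-division by an element f of least degree leaves remainder 0, so f divides h up to
  an integer, which Gauss's lemma removes. The primitive part of f need not belong to I.\<close>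

lemma min_degree_generates:
  fixes I :: "int poly set"
  assumes add: "\<And>p q. p \<in> I \<Longrightarrow> q \<in> I \<Longrightarrow> p + q \<in> I"
    and mult: "\<And>p r. p \<in> I \<Longrightarrow> r * p \<in> I"
    and ex: "P \<in> I" "P \<noteq> 0"
  shows "\<exists>f\<in>I. f \<noteq> 0 \<and> (\<forall>h\<in>I. primitive_part f dvd h)"
proof -
  obtain f where f: "f \<in> I" "f \<noteq> 0" and min: "\<And>h. h \<in> I \<Longrightarrow> h \<noteq> 0 \<Longrightarrow> degree f \<le> degree h"
    using ex_has_least_nat[of "\<lambda>f. f \<in> I \<and> f \<noteq> 0" P degree] ex by auto
  have "primitive_part f dvd h" if h: "h \<in> I" for h
  proof -
    obtain q r where qr: "pseudo_divmod h f = (q, r)" by fastforce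
    define c where "c = coeff f (degree f) ^ (Suc (degree h) - degree f)"
    have c: "smult c h = f * q + r" "r = 0 \<or> degree r < degree f" "c \<noteq> 0"
      using pseudo_divmod[OF f(2) qr] f(2) by (auto simp: c_def)
    have "r = [:c:] * h + (- q) * f" using c(1) by (simp add: algebra_simps)
    then have "r \<in> I" using add mult h f(1) by metis
    then have "r = 0" using min c(2) by force
    then have "f dvd smult c h" using c(1) by simp
    then have "primitive_part f dvd smult c h"
      by (metis content_times_primitive_part dvd_smult dvd_trans dvd_refl smult_dvd_cancel)
    moreover have "content (primitive_part f) = 1" using f(2) by simp
    ultimately show ?thesis using gauss_primitive_dvd c(3) by blast
  qed
  with f show ?thesis by blast
qed

text \<open>For the ideal of polynomials vanishing at z the content can be cancelled inside the
  ideal, as a nonzero integer is invertible in the complex numbers.\<close>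

lemma minimal_int_poly:
  fixes z :: complex
  assumes "P \<noteq> 0" "poly (cpoly P) z = 0"
  obtains p where "p \<noteq> 0" "poly (cpoly p) z = 0" "\<And>h. poly (cpoly h) z = 0 \<Longrightarrow> p dvd h"
proof -
  have "\<exists>f\<in>{h. poly (cpoly h) z = 0}. f \<noteq> 0 \<and>
      (\<forall>h\<in>{h. poly (cpoly h) z = 0}. primitive_part f dvd h)"
    by (rule min_degree_generates[of _ P]) (use assms in \<open>auto simp: cpoly_add cpoly_mult\<close>)
  then obtain f where f: "poly (cpoly f) z = 0" "f \<noteq> 0"
    "\<And>h. poly (cpoly h) z = 0 \<Longrightarrow> primitive_part f dvd h"
    by auto
  have "cpoly f = smult (of_int (content f)) (cpoly (primitive_part f))"
    by (metis content_times_primitive_part cpoly_smult)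
  with f(1,2) have "poly (cpoly (primitive_part f)) z = 0" by simp
  moreover have "primitive_part f \<noteq> 0" using f(2) by simp
  ultimately show ?thesis using that f(3) by blast
qed

section \<open>Interpolation and Kronecker's theorem\<close>

lemma lagrange_interpolation:
  fixes R :: "complex set"
  assumes "finite R" "degree r < card R"
  shows "r = (\<Sum>z\<in>R. smult (poly r z) (\<Prod>w\<in>R - {z}. smult (1 / (z - w)) [:- w, 1:]))"
proof -
  let ?L = "\<lambda>z. \<Prod>w\<in>R - {z}. smult (1 / (z - w)) [:- w, 1:]"
  define d where "d = r - (\<Sum>z\<in>R. smult (poly r z) (?L z))"
  have L: "poly (?L z) y = (if y = z then 1 else 0)" if "z \<in> R" "y \<in> R" for y z
  proof (cases "y = z")
    case False
    then have "(\<Prod>w\<in>R - {z}. poly (smult (1 / (z - w)) [:- w, 1:]) y) = 0"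
      using that assms(1) by (intro prod_zero bexI[of _ y]) auto
    with False show ?thesis by (simp add: poly_prod)
  next
    case True
    have "(\<Prod>w\<in>R - {z}. poly (smult (1 / (z - w)) [:- w, 1:]) z) = 1"
      by (rule prod.neutral) (auto simp: divide_simps)
    with True show ?thesis by (simp add: poly_prod)
  qed
  have "poly d y = 0" if "y \<in> R" for y
  proof -
    have "(\<Sum>z\<in>R. poly r z * poly (?L z) y) = (\<Sum>z\<in>R. if z = y then poly r y else 0)"
      using that L by (intro sum.cong) auto
    then show ?thesis using that assms(1) by (simp add: d_def poly_sum)
  qed
  then have sub: "R \<subseteq> {x. poly d x = 0}" by blast
  have "degree (?L z) \<le> card R - 1" if "z \<in> R" for z
  proof -
    have "degree (?L z) \<le> (\<Sum>w\<in>R - {z}. degree (smult (1 / (z - w)) [:- w, 1:]))"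
      using degree_prod_sum_le[of "R - {z}" "\<lambda>w. smult (1 / (z - w)) [:- w, 1:]"] assms(1)
      by (simp add: o_def)
    also have "\<dots> \<le> (\<Sum>w\<in>R - {z}. 1)" by (intro sum_mono) simp
    finally show ?thesis using that assms(1) by simp
  qed
  then have "degree d \<le> card R - 1"
    unfolding d_def using assms
    by (intro degree_diff_le degree_sum_le) (auto intro: order_trans[OF degree_smult_le])
  then have "degree d < card R" using assms(2) by linarith
  have "d = 0"
  proof (rule ccontr)
    assume "d \<noteq> 0"
    then have "card R \<le> degree d"
      using card_mono[OF poly_roots_finite[OF \<open>d \<noteq> 0\<close>] sub] card_poly_roots_bound[of d] by simp
    with \<open>degree d < card R\<close> show False by simp
  qed
  then show ?thesis by (simp add: d_def)
qed

text \<open>Kronecker's theorem: the remainders of \<open>x\<^sup>n\<close> modulo the minimal polynomial have bounded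
  coefficients, by interpolation at its simple roots, so two of them coincide.\<close>

lemma kronecker_root_of_unity:
  assumes g: "g dvd P" "lead_coeff P = 1" and root: "poly (cpoly g) \<alpha> = 0"
    and disc: "\<And>z. poly (cpoly g) z = 0 \<Longrightarrow> norm z \<le> 1"
  shows "\<alpha> = 0 \<or> (\<exists>m>0. \<alpha> ^ m = 1)"
proof -
  have P0: "P \<noteq> 0" using g(2) by auto
  then have g0: "g \<noteq> 0" using g(1) by auto
  obtain p0 where p0: "p0 \<noteq> 0" "poly (cpoly p0) \<alpha> = 0"
    "\<And>h. poly (cpoly h) \<alpha> = 0 \<Longrightarrow> p0 dvd h"
    using minimal_int_poly[OF g0 root] by blast
  have "p0 dvd P" using p0(3)[OF root] g(1) by (rule dvd_trans)
  \<comment> \<open>A divisor of a monic integer polynomial has leading coefficient 1 or -1, so a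
    change of sign makes the minimal polynomial monic.\<close>
  then have "lead_coeff p0 dvd 1" using g(2) by (metis dvdE dvd_triv_left lead_coeff_mult)
  then have lc: "lead_coeff p0 * lead_coeff p0 = 1" by (auto simp: zdvd1_eq abs_if split: if_splits)
  define p where "p = smult (lead_coeff p0) p0"
  have p: "lead_coeff p = 1" "poly (cpoly p) \<alpha> = 0" using lc p0(2) by (auto simp: p_def cpoly_smult)
  have min: "p dvd h" if "poly (cpoly h) \<alpha> = 0" for h
    unfolding p_def by (rule smult_unit_dvd[OF p0(3)[OF that] lc])
  have p_nz: "p \<noteq> 0" using p(1) by auto
  have pdisc: "norm z \<le> 1" if "poly (cpoly p) z = 0" for z
    using disc that min[OF root] by (auto elim!: dvdE simp: cpoly_mult)
  \<comment> \<open>All roots are simple: the minimal polynomial r of a double root z divides p = r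
    s and p'. If r vanishes at alpha it has the degree of p, too large to divide p'; if s does, r
    would be constant.\<close>
  have "poly (pderiv (cpoly p)) z \<noteq> 0" if z: "poly (cpoly p) z = 0" for z
  proof
    assume der: "poly (pderiv (cpoly p)) z = 0"
    obtain r where r: "r \<noteq> 0" "poly (cpoly r) z = 0" "\<And>h. poly (cpoly h) z = 0 \<Longrightarrow> r dvd h"
      using minimal_int_poly[OF p_nz z] by blast
    obtain s where s: "p = r * s" using r(3)[OF z] by (auto elim: dvdE)
    have s0: "s \<noteq> 0" using s p_nz by auto
    have deg: "degree p = degree r + degree s" using s r(1) s0 by (simp add: degree_mult_eq)
    have "degree r \<noteq> 0"
    proof
      assume "degree r = 0"
      then obtain a where "r = [:a:]" by (rule degree_eq_zeroE)
      with r show False by simp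
    qed
    have "poly (cpoly r) \<alpha> = 0 \<or> poly (cpoly s) \<alpha> = 0" using p(2) by (simp add: s cpoly_mult)
    then show False
    proof
      assume "poly (cpoly r) \<alpha> = 0"
      then have "degree p \<le> degree r" using min r(1) by (intro dvd_imp_degree_le) auto
      moreover have "r dvd pderiv p" using der r(3) by (simp add: pderiv_cpoly)
      moreover have "pderiv p \<noteq> 0" using \<open>degree r \<noteq> 0\<close> deg by (simp add: pderiv_eq_0_iff)
      ultimately show False
        using dvd_imp_degree_le[of r "pderiv p"]   \<open>degree r \<noteq> 0\<close> deg
        by (simp add: degree_pderiv)
    next
      assume "poly (cpoly s) \<alpha> = 0"
      then have "degree p \<le> degree s" using min s0 by (intro dvd_imp_degree_le) auto
      with deg \<open>degree r \<noteq> 0\<close> show False by simp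
    qed
  qed
  then have sqf: "rsquarefree (cpoly p)" by (auto simp: rsquarefree_roots)
  define R where "R = {z. poly (cpoly p) z = 0}"
  have finR: "finite R" using p_nz by (auto simp: R_def intro!: poly_roots_finite)
  have "degree p = degree (smult (lead_coeff (cpoly p)) (\<Prod>z\<in>R. [:- z, 1:]))"
    using complex_poly_decompose_rsquarefree[OF sqf] by (simp add: R_def)
  also have "\<dots> = card R"
    using p_nz by (simp add: degree_prod_eq_sum_degree)
  finally have cardR: "degree p = card R" .
  have \<alpha>R: "\<alpha> \<in> R" using p(2) by (simp add: R_def)
  then have Rpos: "card R > 0" using finR by (auto simp: card_gt_0_iff)
  let ?L = "\<lambda>z. \<Prod>w\<in>R - {z}. smult (1 / (z - w)) [:- w, 1:]"
  have "\<exists>r. \<exists>q. monom 1 n = p * q + r \<and> (r = 0 \<or> degree r < degree p)" for n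
    using monic_division[OF p(1)] by metis
  then obtain r where r: "\<And>n. \<exists>q. monom 1 n = p * q + r n \<and> (r n = 0 \<or> degree (r n) < degree p)"
    by metis
  have ev: "poly (cpoly (r n)) z = z ^ n" if "z \<in> R" for n z
  proof -
    obtain q where "monom 1 n = p * q + r n" using r by blast
    then have "poly (cpoly (monom 1 n)) z = poly (cpoly p) z * poly (cpoly q) z + poly (cpoly (r n)) z"
      by (simp add: cpoly_mult cpoly_add)
    with that show ?thesis by (simp add: R_def cpoly_monom poly_monom)
  qed
  have deg_r: "degree (r n) < card R" for n using r[of n] Rpos cardR by auto
  \<comment> \<open>By interpolation r_n is a combination of the Lagrange basis with weights z^n of
    norm at most 1, so B bounds its coefficients independently of n.\<close>
  define B where "B = (\<Sum>z\<in>R. \<Sum>i\<le>card R. norm (coeff (?L z) i))"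
  have bound: "\<bar>coeff (r n) i\<bar> \<le> \<lceil>B\<rceil>" for n i
  proof (cases "i \<le> card R")
    case True
    have "cpoly (r n) = (\<Sum>z\<in>R. smult (poly (cpoly (r n)) z) (?L z))"
      by (rule lagrange_interpolation[OF finR]) (simp add: deg_r)
    also have "\<dots> = (\<Sum>z\<in>R. smult (z ^ n) (?L z))"
      by (intro sum.cong) (simp_all add: ev)
    finally have "of_int (coeff (r n) i) = (\<Sum>z\<in>R. z ^ n * coeff (?L z) i)"
      by (metis (no_types, lifting) coeff_cpoly coeff_smult coeff_sum sum.cong)
    then have "norm (of_int (coeff (r n) i) :: complex) \<le> (\<Sum>z\<in>R. norm (z ^ n * coeff (?L z) i))"
      by (simp add: norm_sum)
    also have "\<dots> \<le> (\<Sum>z\<in>R. norm (coeff (?L z) i))"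
      using pdisc by (intro sum_mono)
        (auto simp: R_def norm_mult norm_power intro!: mult_left_le_one_le power_le_one)
    also have "\<dots> \<le> B" unfolding B_def
      using True by (intro sum_mono member_le_sum[of i "{..card R}" "\<lambda>i. norm (coeff _ i)"]) auto
    finally show ?thesis by (simp add: le_ceiling_iff)
  next
    case False
    then have "coeff (r n) i = 0" using deg_r[of n] by (intro coeff_eq_0) simp
    moreover have "B \<ge> 0" by (auto simp: B_def intro!: sum_nonneg)
    ultimately show ?thesis by simp
  qed
  have "range r \<subseteq> {p. degree p \<le> card R \<and> (\<forall>i. \<bar>coeff p i\<bar> \<le> \<lceil>B\<rceil>)}"
    using deg_r bound by (auto intro: less_imp_le)
  then have "finite (range r)" using finite_bounded_int_polys finite_subset by blast
  then have "\<not> inj r" using finite_imageD infinite_UNIV_nat by blast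
  then obtain a b where ab: "r a = r b" "a < b" by (metis injI linorder_neqE_nat)
  then have "\<alpha> ^ a = \<alpha> ^ b" using ev[OF \<alpha>R] by metis
  also have "\<alpha> ^ b = \<alpha> ^ a * \<alpha> ^ (b - a)" using ab(2) by (simp flip: power_add)
  finally have "\<alpha> = 0 \<or> \<alpha> ^ (b - a) = 1" by auto
  with ab(2) show ?thesis by (meson zero_less_diff)
qed

text \<open>For a common order L every root of g is a root of x (x^L - 1), and the total
  multiplicity of the roots is enough as exponent k.\<close>

lemma unit_circle_roots_dvd:
  assumes g: "lead_coeff g = 1" and root: "\<And>z. poly (cpoly g) z = 0 \<Longrightarrow> z = 0 \<or> (\<exists>m>0. z ^ m = 1)"
  obtains L k where "L > 0" "g dvd (monom 1 1 * (monom 1 L - 1)) ^ k"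
proof -
  have g0: "g \<noteq> 0" using g by auto
  define R where "R = {z. poly (cpoly g) z = 0}"
  have finR: "finite R" using g0 by (auto simp: R_def intro!: poly_roots_finite)
  have "\<forall>z\<in>R. \<exists>m>0. z = 0 \<or> z ^ m = 1" using root by (auto simp: R_def)
  then obtain m where m: "\<And>z. z \<in> R \<Longrightarrow> m z > 0 \<and> (z = 0 \<or> z ^ m z = 1)" by metis
  define L where "L = (\<Prod>z\<in>R. m z)"
  have "L > 0" unfolding L_def using m by (intro prod_pos) auto
  let ?W = "monom 1 1 * (monom 1 L - 1) :: int poly"
  have "poly (cpoly ?W) z = 0" if z: "z \<in> R" for z
  proof -
    have "m z dvd L" unfolding L_def using finR z by (rule dvd_prodI)
    then have "z = 0 \<or> z ^ L = 1" using m[OF z] by (auto elim!: dvdE simp: power_mult)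
    then show ?thesis by (auto simp: cpoly_mult cpoly_diff cpoly_monom poly_monom)
  qed
  then have lin: "[:- z, 1:] dvd cpoly ?W" if "z \<in> R" for z using that by (simp add: poly_eq_0_iff_dvd)
  define k where "k = (\<Sum>z\<in>R. order z (cpoly g))"
  have "(\<Prod>z\<in>R. [:- z, 1:] ^ order z (cpoly g)) dvd (\<Prod>z\<in>R. cpoly ?W ^ order z (cpoly g))"
    using lin by (intro prod_dvd_prod dvd_power_same) auto
  then have "(\<Prod>z\<in>R. [:- z, 1:] ^ order z (cpoly g)) dvd cpoly (?W ^ k)"
    by (subst k_def, subst cpoly_power, subst power_sum)
  moreover have "cpoly g = (\<Prod>z\<in>R. [:- z, 1:] ^ order z (cpoly g))"
    using complex_poly_decompose[of "cpoly g"] g by (simp add: R_def)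
  ultimately have dvdC: "cpoly g dvd cpoly (?W ^ k)" by simp
  \<comment> \<open>Divisibility descends from complex to integer polynomials because g is monic:
    the integral remainder is a complex multiple of g of smaller degree.\<close>
  obtain q r where qr: "?W ^ k = g * q + r" "r = 0 \<or> degree r < degree g"
    using monic_division[OF g] by blast
  have "cpoly (?W ^ k) = cpoly g * cpoly q + cpoly r" by (simp only: qr(1) cpoly_add cpoly_mult)
  with dvdC have "cpoly g dvd cpoly r" by (metis dvd_add_right_iff dvd_triv_left)
  then have "r = 0" using qr(2) dvd_imp_degree_le[of "cpoly g" "cpoly r"] by force
  then have "g dvd ?W ^ k" using qr(1) by simp
  with \<open>L > 0\<close> that show ?thesis by blast
qed

lemma monom_minus_one_dvd: "(monom 1 u - 1 :: int poly) dvd monom 1 (u * v) - 1"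
proof -
  have "(monom 1 u :: int poly) ^ v - 1 = (monom 1 u - 1) * (\<Sum>i<v. monom 1 u ^ i)"
    by (rule power_diff_1_eq)
  then show ?thesis by (simp add: monom_power mult.commute)
qed

text \<open>The relations \<open>P(x\<^sup>j)\<close> with coefficients in \<open>{-1, 0, 1}\<close> bound the \<open>j\<close>-th powers of the common roots
  of \<open>I\<close> by \<open>2\<close>, so these roots lie in the closed unit disc and Kronecker's theorem applies.  This gives
  a multiple of a power of \<open>x\<^sup>m - 1\<close>; the integer factor is removed by counting modulo it.\<close>

lemma unipotent_in_ideal:
  fixes I :: "int poly set"
  assumes add: "\<And>p q. p \<in> I \<Longrightarrow> q \<in> I \<Longrightarrow> p + q \<in> I"
    and mult: "\<And>p r. p \<in> I \<Longrightarrow> r * p \<in> I"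
    and cancel: "\<And>p. pCons 0 p \<in> I \<Longrightarrow> p \<in> I"
    and small: "\<And>j. j > 0 \<Longrightarrow> \<exists>P. P \<noteq> 0 \<and> (\<forall>i. coeff P i \<in> {- 1, 0, 1}) \<and> pcompose P (monom 1 j) \<in> I"
  shows "\<exists>m>0. \<exists>k. (monom 1 m - 1) ^ k \<in> I"
proof -
  have cancel_power: "p \<in> I" if "monom 1 n * p \<in> I" for n p
    using that
  proof (induction n)
    case (Suc n)
    have "monom 1 (Suc n) * p = pCons 0 (monom 1 n * p)" by (simp add: monom_Suc)
    with Suc cancel show ?case by metis
  qed simp
  have X: "monom 1 1 = [:0, 1 :: int:]" by (simp add: monom_Suc one_pCons)
  have "\<exists>P. P \<noteq> 0 \<and> (\<forall>i. coeff P i \<in> {- 1, 0, 1}) \<and> P \<in> I"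
    using small[OF zero_less_one] unfolding X pcompose_idR .
  then obtain P where P: "P \<noteq> 0" "\<forall>i. coeff P i \<in> {- 1, 0, 1}" "P \<in> I" by auto
  have "lead_coeff P \<in> {- 1, 1}" using P(1) spec[OF P(2), of "degree P"] leading_coeff_0_iff[of P] by auto
  then have lcP: "lead_coeff P * lead_coeff P = 1" by auto
  \<comment> \<open>The case j = 1 supplies a monic element of I. It makes the roots integral and
    later allows division with remainder modulo I.\<close>
  define Q where "Q = smult (lead_coeff P) P"
  have Q: "lead_coeff Q = 1" "Q \<in> I" using lcP mult[OF P(3), of "[:lead_coeff P:]"] by (auto simp: Q_def)
  then have Q0: "Q \<noteq> 0" by auto
  from min_degree_generates[OF add mult Q(2) Q0]
  obtain f where f: "f \<in> I" "f \<noteq> 0" "\<And>h. h \<in> I \<Longrightarrow> primitive_part f dvd h" by auto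
  define g0 where "g0 = primitive_part f"
  have "g0 dvd Q" using f(3)[OF Q(2)] by (simp add: g0_def)
  then have "lead_coeff g0 dvd 1" using Q(1) by (metis dvdE dvd_triv_left lead_coeff_mult)
  then have lc: "lead_coeff g0 * lead_coeff g0 = 1" by (auto simp: zdvd1_eq abs_if split: if_splits)
  define g where "g = smult (lead_coeff g0) g0"
  have g: "lead_coeff g = 1" using lc by (auto simp: g_def)
  have g0g: "g0 = smult (lead_coeff g0) g" using lc by (simp add: g_def)
  have gdvd: "g dvd h" if "h \<in> I" for h
    unfolding g_def by (rule smult_unit_dvd[OF f(3)[OF that, folded g0_def] lc])
  have disc: "norm z \<le> 1" if z: "poly (cpoly g) z = 0" for z
  proof (rule ccontr)
    assume "\<not> norm z \<le> 1"
    then obtain j where j: "norm z ^ j > 2" using real_arch_pow[of "norm z" 2] by auto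
    then have "j > 0" by (cases j) auto
    then obtain P where P: "P \<noteq> 0" "\<And>i. coeff P i \<in> {- 1, 0, 1}" "pcompose P (monom 1 j) \<in> I"
      using small by metis
    have "poly (cpoly (pcompose P (monom 1 j))) z = 0"
      using z gdvd[OF P(3)] by (auto elim!: dvdE simp: cpoly_mult)
    then have "norm (z ^ j) \<le> 2"
      by (intro root_norm_le_2[OF P(1,2)]) (simp add: poly_pcompose_monom_cpoly)
    with j show False by (simp add: norm_power)
  qed
  obtain L k where L: "L > 0" "g dvd (monom 1 1 * (monom 1 L - 1)) ^ k"
    using unit_circle_roots_dvd[OF g kronecker_root_of_unity[OF gdvd[OF Q(2)] Q(1) _ disc]] by blast
  let ?V = "(monom 1 L - 1) ^ k :: int poly"
  \<comment> \<open>The integer by which the least-degree element f differs from the monic g. So far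
    only c (x^L - 1)^k is reached in I.\<close>
  define c where "c = content f * lead_coeff g0"
  have c0: "c \<noteq> 0" using f(2) lc by (auto simp: c_def)
  have "f = smult c g"
    by (metis c_def content_times_primitive_part g0_def g0g smult_smult)
  obtain s where s: "(monom 1 1 * (monom 1 L - 1)) ^ k = g * s" using L(2) by (auto elim: dvdE)
  have "s * f = [:c:] * (monom 1 1 * (monom 1 L - 1)) ^ k"
    unfolding s \<open>f = smult c g\<close> by (simp add: mult.commute)
  also have "\<dots> = monom 1 k * smult c ?V" by (simp add: power_mult_distrib monom_power)
  finally have cV: "smult c ?V \<in> I" using mult[OF f(1), of s] cancel_power by metis
  have "\<exists>r. \<exists>q. monom 1 n = Q * q + r \<and> (r = 0 \<or> degree r < degree Q)" for n
    using monic_division[OF Q(1)] by metis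
  then obtain r where r: "\<And>n. \<exists>q. monom 1 n = Q * q + r n \<and> (r n = 0 \<or> degree (r n) < degree Q)"
    by metis
  \<comment> \<open>Modulo Q and c there are finitely many remainders, so some x^b - x^a lies in the
    ideal generated by Q and c. Multiplied by \<open>?V\<close> it lies in I, because both Q and c
    \<open>?V\<close> do.\<close>
  define \<rho> where "\<rho> n = map_poly (\<lambda>a. a mod c) (r n)" for n
  have "range \<rho> \<subseteq> {p. degree p \<le> degree Q \<and> (\<forall>i. \<bar>coeff p i\<bar> \<le> \<bar>c\<bar>)}"
  proof -
    have "degree (\<rho> n) \<le> degree Q" for n
      using r[of n] by (intro degree_le) (auto simp: \<rho>_def coeff_map_poly coeff_eq_0)
    moreover have "\<bar>coeff (\<rho> n) i\<bar> \<le> \<bar>c\<bar>" for n i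
      using c0 abs_mod_less[of c "coeff (r n) i"] by (auto simp: \<rho>_def coeff_map_poly)
    ultimately show ?thesis by blast
  qed
  then have "finite (range \<rho>)" using finite_bounded_int_polys finite_subset by blast
  then have "\<not> inj \<rho>" using finite_imageD infinite_UNIV_nat by blast
  then obtain a b where ab: "\<rho> a = \<rho> b" "a < b" by (metis injI linorder_neqE_nat)
  have "[:c:] dvd r b - r a"
    unfolding const_poly_dvd_iff
  proof
    fix i
    have "coeff (r b) i mod c = coeff (r a) i mod c"
      using arg_cong[OF ab(1), of "\<lambda>p. coeff p i"] by (simp add: \<rho>_def coeff_map_poly)
    then show "c dvd coeff (r b - r a) i" by (simp add: mod_eq_dvd_iff)
  qed
  then obtain e where e: "r b - r a = [:c:] * e" by (auto elim: dvdE)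
  obtain qa qb where q: "monom 1 a = Q * qa + r a" "monom 1 b = Q * qb + r b" using r by metis
  have "monom 1 a * (monom 1 (b - a) - 1) = monom 1 b - (monom 1 a :: int poly)"
    using ab(2) by (simp add: algebra_simps mult_monom)
  also have "\<dots> = (qb - qa) * Q + [:c:] * e"
    unfolding q e[symmetric] by (simp add: algebra_simps)
  finally have "monom 1 a * ((monom 1 (b - a) - 1) * ?V) = ((qb - qa) * Q + [:c:] * e) * ?V"
    by (metis mult.assoc)
  also have "\<dots> = (qb - qa) * ?V * Q + e * smult c ?V"
    by (simp add: algebra_simps)
  finally have "monom 1 a * ((monom 1 (b - a) - 1) * ?V) = (qb - qa) * ?V * Q + e * smult c ?V" .
  moreover have "(qb - qa) * ?V * Q + e * smult c ?V \<in> I" by (intro add mult Q(2) cV)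
  ultimately have lV: "(monom 1 (b - a) - 1) * ?V \<in> I" using cancel_power by metis
  \<comment> \<open>This exponent is a multiple of both L and b - a, so the two factors merge into
    one power of a single x^m - 1.\<close>
  let ?M = "monom 1 (L * (b - a)) - 1 :: int poly"
  have "(monom 1 (b - a) - 1) * ?V dvd ?M * ?M ^ k"
    using monom_minus_one_dvd[of L "b - a"] monom_minus_one_dvd[of "b - a" L] by (intro mult_dvd_mono dvd_power_same) (simp_all add: mult.commute)
  then have "?M ^ Suc k \<in> I" using mult[OF lV] by (metis dvdE mult.commute power_Suc)
  moreover have "L * (b - a) > 0" using L(1) ab(2) by simp
  ultimately show ?thesis by blast
qed

section \<open>Virtual nilpotency of polycyclic groups of polynomial growth\<close>

text \<open>\<open>zact t a p\<close> is \<open>p(t) a\<close> in multiplicative notation, with \<open>t\<close> acting by conjugation; it is additive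
  in \<open>p\<close> only modulo \<open>B\<close>, for \<open>a\<close> in an abelian section \<open>A / B\<close>.\<close>

definition zact :: "'a::mult_group \<Rightarrow> 'a \<Rightarrow> int poly \<Rightarrow> 'a" where
  "zact t a p = fold_coeffs (\<lambda>c y. zpow a c * (t * y * inverse t)) p 1"

lemma zact_0 [simp]: "zact t a 0 = 1"
  by (simp add: zact_def)

lemma zact_pCons [simp]: "zact t a (pCons c p) = zpow a c * (t * zact t a p * inverse t)"
proof (cases "c = 0 \<and> p = 0")
  case False
  then show ?thesis
    by (cases "p = 0") (simp_all add: zact_def fold_coeffs_pCons_not_0_0_eq fold_coeffs_pCons_coeff_not_0_eq)
qed simp

lemma zact_one [simp]: "zact t a 1 = a"
  by (simp add: one_pCons)

lemma zact_monom_mult: "zact t a (monom 1 j * p) = t ^ j * zact t a p * inverse (t ^ j)"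
proof (induction j)
  case (Suc j)
  have "monom 1 (Suc j) * p = pCons 0 (monom 1 j * p)" by (simp add: monom_Suc)
  with Suc show ?case by (simp add: mult.assoc)
qed simp

text \<open>Horner's scheme nests conjugations as the word nests letters t. Equal words of equal
  length thus give an exact relation between two polynomials with coefficients 0 and 1.\<close>

lemma bword_eq_zact: "bword t a l = zact t a (Poly (map of_bool l)) * t ^ length l"
  by (induction l) (simp_all add: mult.assoc)

section \<open>Abelian sections as modules over Z[x]\<close>

definition commu :: "'a::mult_group \<Rightarrow> 'a \<Rightarrow> 'a" where
  "commu x y = x * y * inverse x * inverse y"

lemma commu_conj: "g * commu x y * inverse g = commu (g * x * inverse g) (g * y * inverse g)"
  by (simp add: commu_def mult.assoc)

lemma inverse_commu: "inverse (commu x y) = commu y x"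
  by (simp add: commu_def mult.assoc)

text \<open>The quotient of A by B is abelian and carries an automorphism, conjugation by t.
  Normality of B in A comes from \<open>commu_B\<close>, as in \<open>conj_B\<close>.\<close>

locale abelian_section =
  fixes A B :: "'a::mult_group set" and t :: 'a
  assumes A: "subgrp A" and B: "subgrp B" and BA: "B \<subseteq> A"
    and commu_B: "\<And>x y. x \<in> A \<Longrightarrow> y \<in> A \<Longrightarrow> commu x y \<in> B"
    and tA: "t \<in> normz A" and tB: "t \<in> normz B"
begin

lemma section_power: "abelian_section A B (t ^ n)"
  using A B BA commu_B tA tB by unfold_locales (auto intro: subgrp_power[OF subgrp_normz])

lemma conj_B: "x \<in> A \<Longrightarrow> b \<in> B \<Longrightarrow> x * b * inverse x \<in> B"
proof -
  assume x: "x \<in> A" and b: "b \<in> B"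
  have "x * b * inverse x = commu x b * b" by (simp add: commu_def mult.assoc)
  moreover have "commu x b \<in> B" using commu_B x b BA by blast
  ultimately show ?thesis using subgrp_mult[OF B] b by simp
qed

text \<open>Equality in the quotient of A by B, without a quotient type; membership in A is built in
  so that the congruence rules carry it along.\<close>

definition eqv :: "'a \<Rightarrow> 'a \<Rightarrow> bool" where
  "eqv x y \<longleftrightarrow> x \<in> A \<and> y \<in> A \<and> x * inverse y \<in> B"

lemma eqv_refl: "x \<in> A \<Longrightarrow> eqv x x"
  by (simp add: eqv_def subgrp_one[OF B])

lemma eqv_sym: "eqv x y \<Longrightarrow> eqv y x"
  using subgrp_inv[OF B, of "x * inverse y"] by (auto simp: eqv_def)

lemma eqv_trans [trans]: "eqv x y \<Longrightarrow> eqv y z \<Longrightarrow> eqv x z"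
  using subgrp_mult[OF B, of "x * inverse y" "y * inverse z"] by (auto simp: eqv_def mult.assoc)

lemma eqv_B_iff: "eqv x y \<Longrightarrow> x \<in> B \<longleftrightarrow> y \<in> B"
proof -
  assume e: "eqv x y"
  have "x = (x * inverse y) * y" by (simp add: mult.assoc)
  then show ?thesis using e subgrp_mult_left_iff[OF B, of "x * inverse y" y] by (auto simp: eqv_def)
qed

lemma eqv_mult:
  assumes "eqv x x'" "eqv y y'"
  shows "eqv (x * y) (x' * y')"
proof -
  have "x * y * inverse (x' * y') = (x * (y * inverse y') * inverse x) * (x * inverse x')"
    by (simp add: mult.assoc)
  moreover have "x * (y * inverse y') * inverse x \<in> B" "x * inverse x' \<in> B"
    using assms conj_B by (auto simp: eqv_def)
  ultimately show ?thesis
    using assms subgrp_mult[OF B] by (auto simp: eqv_def intro: subgrp_mult[OF A])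
qed

lemma eqv_commute: "x \<in> A \<Longrightarrow> y \<in> A \<Longrightarrow> eqv (x * y) (y * x)"
  using commu_B[of x y] by (auto simp: eqv_def commu_def mult.assoc intro: subgrp_mult[OF A])

lemma eqv_inverse:
  assumes "eqv x y"
  shows "eqv (inverse x) (inverse y)"
proof -
  have "inverse x \<in> A" "inverse y \<in> A" using assms subgrp_inv[OF A] by (auto simp: eqv_def)
  moreover have "inverse x * inverse (inverse y) = inverse x * inverse (x * inverse y) * inverse (inverse x)"
    by (simp add: mult.assoc)
  moreover have "\<dots> \<in> B"
    using conj_B[OF \<open>inverse x \<in> A\<close> subgrp_inv[OF B, of "x * inverse y"]] assms by (auto simp: eqv_def)
  ultimately show ?thesis unfolding eqv_def by metis
qed

lemma eqv_conj: "eqv x y \<Longrightarrow> eqv (t * x * inverse t) (t * y * inverse t)"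
  using normz_conj[OF tA, of x] normz_conj[OF tA, of y] normz_conj[OF tB, of "x * inverse y"]
  by (auto simp: eqv_def mult.assoc)

lemma eqv_swap:
  assumes "x \<in> A" "y \<in> A" "z \<in> A" "w \<in> A"
  shows "eqv (x * y * (z * w)) (x * z * (y * w))"
proof -
  have "eqv (x * ((y * z) * w)) (x * ((z * y) * w))"
    using assms by (intro eqv_mult eqv_refl eqv_commute)
  then show ?thesis by (simp add: mult.assoc)
qed

lemma conj_A: "x \<in> A \<Longrightarrow> t * x * inverse t \<in> A"
  using normz_conj[OF tA] .

lemma zact_A: "a \<in> A \<Longrightarrow> zact t a p \<in> A"
  by (induction p) (auto intro!: subgrp_mult[OF A] subgrp_zpow[OF A] conj_A subgrp_one[OF A])

lemma zact_add:
  assumes a: "a \<in> A"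
  shows "eqv (zact t a (p + q)) (zact t a p * zact t a q)"
proof (induction p q rule: poly_induct2)
  case (pCons c p d q)
  let ?c = "\<lambda>x. t * x * inverse t"
  have "eqv (zpow a c * zpow a d * ?c (zact t a (p + q)))
    (zpow a c * zpow a d * (?c (zact t a p * zact t a q)))"
    using pCons a by (intro eqv_mult eqv_refl eqv_conj subgrp_mult[OF A] subgrp_zpow[OF A])
  also have "?c (zact t a p * zact t a q) = ?c (zact t a p) * ?c (zact t a q)"
    by (simp add: mult.assoc)
  also have "eqv (zpow a c * zpow a d * (?c (zact t a p) * ?c (zact t a q)))
    (zpow a c * ?c (zact t a p) * (zpow a d * ?c (zact t a q)))"
    using a by (intro eqv_swap conj_A zact_A subgrp_zpow[OF A])
  finally show ?case by (simp add: zpow_add)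
qed (simp add: eqv_refl subgrp_one[OF A])

lemma zact_minus:
  assumes a: "a \<in> A"
  shows "eqv (zact t a (- p)) (inverse (zact t a p))"
proof -
  have "eqv (zact t a (- p + p)) (zact t a (- p) * zact t a p)" by (rule zact_add[OF a])
  from eqv_sym[OF this] show ?thesis
    using a by (auto simp: eqv_def zact_A intro: subgrp_inv[OF A])
qed

lemma zact_diff:
  assumes a: "a \<in> A"
  shows "eqv (zact t a (p - q)) (zact t a p * inverse (zact t a q))"
proof -
  have "eqv (zact t a (p + (- q))) (zact t a p * zact t a (- q))" by (rule zact_add[OF a])
  also have "eqv \<dots> (zact t a p * inverse (zact t a q))"
    by (intro eqv_mult eqv_refl zact_A zact_minus a)
  finally show ?thesis by simp
qed

text \<open>Translates relations for t^j into relations for t, so that all j contribute to one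
  annihilator ideal.\<close>

lemma zact_pcompose:
  assumes a: "a \<in> A"
  shows "eqv (zact (t ^ j) a p) (zact t a (pcompose p (monom 1 j)))"
proof (induction p)
  case 0
  then show ?case by (simp add: eqv_refl subgrp_one[OF A])
next
  case (pCons c p)
  interpret j: abelian_section A B "t ^ j" by (rule section_power)
  let ?q = "pcompose p (monom 1 j)"
  have "eqv (zpow a c * (t ^ j * zact (t ^ j) a p * inverse (t ^ j)))
    (zpow a c * (t ^ j * zact t a ?q * inverse (t ^ j)))"
    by (rule eqv_mult[OF eqv_refl[OF subgrp_zpow[OF A a]] j.eqv_conj[OF pCons.IH]])
  also have "eqv \<dots> (zact t a ([:c:] + monom 1 j * ?q))"
    using eqv_sym[OF zact_add[OF a, of "[:c:]" "monom 1 j * ?q"]] by (simp add: zact_monom_mult)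
  finally show ?case by (simp add: pcompose_pCons)
qed

section \<open>The annihilator ideal of an element\<close>

lemma ann_add: "a \<in> A \<Longrightarrow> zact t a p \<in> B \<Longrightarrow> zact t a q \<in> B \<Longrightarrow> zact t a (p + q) \<in> B"
  using eqv_B_iff[OF zact_add] subgrp_mult[OF B] by blast

lemma ann_diff: "a \<in> A \<Longrightarrow> zact t a p \<in> B \<Longrightarrow> zact t a q \<in> B \<Longrightarrow> zact t a (p - q) \<in> B"
  using eqv_B_iff[OF zact_diff] subgrp_mult[OF B] subgrp_inv[OF B] by blast

lemma ann_smult:
  assumes a: "a \<in> A" "zact t a p \<in> B"
  shows "zact t a (smult c p) \<in> B"
proof (induction c rule: int_induct[where k = 0])
  case (step1 i)
  then show ?case using ann_add[OF a(1) step1(2) a(2)] by (simp add: smult_add_left)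
next
  case (step2 i)
  then show ?case using ann_diff[OF a(1) step2(2) a(2)] by (simp add: smult_diff_left)
qed (simp add: subgrp_one[OF B])

lemma ann_mult:
  assumes a: "a \<in> A" "zact t a p \<in> B"
  shows "zact t a (r * p) \<in> B"
proof (induction r)
  case (pCons c r)
  have "zact t a (pCons 0 (r * p)) \<in> B" using normz_conj[OF tB pCons.IH] by simp
  from ann_add[OF a(1) ann_smult[OF a] this] show ?case by simp
qed (simp add: subgrp_one[OF B])

lemma ann_dvd: "a \<in> A \<Longrightarrow> zact t a p \<in> B \<Longrightarrow> p dvd q \<Longrightarrow> zact t a q \<in> B"
  by (metis ann_mult dvdE mult.commute)

text \<open>Two distinct words in t^j and a that coincide give two polynomials with coefficients 0
  and 1. Their difference annihilates a; it is nonzero since the bit lists have the same length and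
  differ somewhere.\<close>

lemma ann_small:
  assumes gr: "poly_growth H" "subgrp H" "t \<in> H" "a \<in> H" and a: "a \<in> A"
  shows "\<exists>P. P \<noteq> 0 \<and> (\<forall>i. coeff P i \<in> {- 1, 0, 1}) \<and> zact t a (pcompose P (monom 1 j)) \<in> B"
proof -
  obtain l l' where l: "length l = length l'" "l \<noteq> l'" "bword (t ^ j) a l = bword (t ^ j) a l'"
    using growth_collision[OF gr(1) subgrp_power[OF gr(2,3)] gr(4)] .
  let ?p = "Poly (map of_bool l) :: int poly" and ?p' = "Poly (map of_bool l') :: int poly"
  have eq: "zact (t ^ j) a ?p = zact (t ^ j) a ?p'"
    using l(1,3) by (simp add: bword_eq_zact)
  obtain i where i: "i < length l" "l ! i \<noteq> l' ! i" using l(1,2) nth_equalityI by blast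
  have "coeff ?p i \<noteq> coeff ?p' i" using i l(1) by (simp add: nth_default_def)
  then have "?p \<noteq> ?p'" by metis
  then have "?p - ?p' \<noteq> 0" by simp
  moreover have "coeff (?p - ?p') i \<in> {- 1, 0, 1}" for i by (auto simp: nth_default_def)
  moreover have "zact t a (pcompose (?p - ?p') (monom 1 j)) \<in> B"
  proof -
    have "eqv (zact t a (pcompose ?p (monom 1 j))) (zact t a (pcompose ?p' (monom 1 j)))"
      using eqv_trans[OF eqv_sym[OF zact_pcompose[OF a]], of j ?p] zact_pcompose[OF a, of j ?p']
      by (simp add: eq)
    then have "zact t a (pcompose ?p (monom 1 j)) * inverse (zact t a (pcompose ?p' (monom 1 j))) \<in> B"
      by (simp add: eqv_def)
    then show ?thesis using eqv_B_iff[OF zact_diff[OF a]] by (simp add: pcompose_diff)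
  qed
  ultimately show ?thesis by blast
qed

lemma ann_unipotent:
  assumes "poly_growth H" "subgrp H" "t \<in> H" "a \<in> H" and a: "a \<in> A"
  shows "\<exists>m>0. \<exists>k. zact t a ((monom 1 m - 1) ^ k) \<in> B"
proof -
  \<comment> \<open>The variable x acts invertibly because t normalizes B in both
    directions.\<close>
  have cancel: "zact t a p \<in> B" if "zact t a (pCons 0 p) \<in> B" for p
    using normz_conj'[OF tB that] by (simp add: mult.assoc)
  have "\<exists>m>0. \<exists>k. (monom 1 m - 1) ^ k \<in> {p. zact t a p \<in> B}"
    by (rule unipotent_in_ideal; unfold mem_Collect_eq)
       (rule ann_add[OF a] ann_mult[OF a] cancel ann_small[OF assms]; assumption)+
  then show ?thesis by simp
qed

section \<open>The unipotent filtration of a section\<close>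

lemma commu_A: "x \<in> A \<Longrightarrow> commu t x \<in> A"
  unfolding commu_def by (intro subgrp_mult[OF A] conj_A subgrp_inv[OF A])

lemma commu_eqv: "eqv x y \<Longrightarrow> eqv (commu t x) (commu t y)"
  unfolding commu_def by (intro eqv_mult eqv_conj eqv_inverse)

text \<open>On the quotient of A by B the map \<open>commu t\<close> is the endomorphism t - 1,
  written multiplicatively.\<close>

lemma commu_mult:
  assumes "x \<in> A" "y \<in> A"
  shows "eqv (commu t (x * y)) (commu t x * commu t y)"
proof -
  have "commu t (x * y) = commu t x * (x * commu t y * inverse x)"
    by (simp add: commu_def mult.assoc)
  moreover have "eqv (commu t x * (x * commu t y * inverse x)) (commu t x * (commu t y * x * inverse x))"
    using assms by (intro eqv_mult eqv_refl eqv_commute commu_A subgrp_inv[OF A])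
  ultimately show ?thesis by (simp add: mult.assoc)
qed

lemma commu_iter_A: "x \<in> A \<Longrightarrow> (commu t ^^ k) x \<in> A"
  by (induction k) (auto intro: commu_A)

lemma commu_iter_mult:
  assumes "x \<in> A" "y \<in> A"
  shows "eqv ((commu t ^^ k) (x * y)) ((commu t ^^ k) x * (commu t ^^ k) y)"
proof (induction k)
  case 0
  then show ?case using assms by (simp add: eqv_refl subgrp_mult[OF A])
next
  case (Suc k)
  from commu_eqv[OF this] eqv_trans commu_mult[OF commu_iter_A commu_iter_A] assms
  show ?case by simp
qed

lemma commu_iter_B: "x \<in> B \<Longrightarrow> (commu t ^^ k) x \<in> B"
proof (induction k)
  case (Suc k)
  then show ?case
    unfolding funpow.simps o_def commu_def
    by (intro subgrp_mult[OF B _ subgrp_inv[OF B]] normz_conj[OF tB]) auto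
qed simp

text \<open>The kernel of (t - 1)^k on the quotient, pulled back to A. These subgroups increase from
  B and exhaust A when t acts unipotently.\<close>

definition fixlayer :: "nat \<Rightarrow> 'a set" where
  "fixlayer k = {x \<in> A. (commu t ^^ k) x \<in> B}"

lemma B_fixlayer: "B \<subseteq> fixlayer k"
  using BA commu_iter_B by (auto simp: fixlayer_def)

lemma fixlayer_0: "fixlayer 0 = B"
  using BA by (auto simp: fixlayer_def)

lemma subgrp_fixlayer: "subgrp (fixlayer k)"
proof (rule subgrpI)
  show "1 \<in> fixlayer k" using B_fixlayer subgrp_one[OF B] by blast
next
  fix x y assume "x \<in> fixlayer k" "y \<in> fixlayer k"
  then show "x * y \<in> fixlayer k"
    using eqv_B_iff[OF commu_iter_mult] subgrp_mult[OF A] subgrp_mult[OF B]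
    by (auto simp: fixlayer_def)
next
  fix x assume x: "x \<in> fixlayer k"
  then have xA: "x \<in> A" "inverse x \<in> A" using subgrp_inv[OF A] by (auto simp: fixlayer_def)
  have "(commu t ^^ k) (x * inverse x) \<in> B" using commu_iter_B[OF subgrp_one[OF B]] by simp
  then have "(commu t ^^ k) x * (commu t ^^ k) (inverse x) \<in> B"
    using eqv_B_iff[OF commu_iter_mult[OF xA]] by simp
  then show "inverse x \<in> fixlayer k"
    using x xA subgrp_mult_left_iff[OF B] by (auto simp: fixlayer_def)
qed

lemma commu_fixlayer: "x \<in> fixlayer (Suc k) \<Longrightarrow> commu t x \<in> fixlayer k"
  using commu_A by (auto simp: fixlayer_def funpow_swap1)

lemma commu_conj_self: "commu t (t * x * inverse t) = t * commu t x * inverse t"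
  and commu_conj_self': "commu t (inverse t * x * t) = inverse t * commu t x * t"
  by (simp_all add: commu_def mult.assoc)

lemma commu_iter_conj: "(commu t ^^ k) (t * x * inverse t) = t * (commu t ^^ k) x * inverse t"
  and commu_iter_conj': "(commu t ^^ k) (inverse t * x * t) = inverse t * (commu t ^^ k) x * t"
  by (induction k) (simp_all add: commu_conj_self commu_conj_self')

lemma normz_fixlayer: "t \<in> normz (fixlayer k)"
  unfolding normz_def fixlayer_def
  using normz_conj[OF tA] normz_conj'[OF tA] normz_conj[OF tB] normz_conj'[OF tB]
  by (auto simp: commu_iter_conj commu_iter_conj')

end

text \<open>Links the two descriptions of (t^m - 1)^k: the polynomial that annihilates a and the
  iterated commutator.\<close>

lemma (in abelian_section) zact_commu_iter:
  assumes a: "a \<in> A"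
  shows "eqv (zact t a ((monom 1 m - 1) ^ k)) ((commu (t ^ m) ^^ k) a)"
proof (induction k)
  case 0
  then show ?case using a by (simp add: eqv_refl)
next
  case (Suc k)
  interpret m: abelian_section A B "t ^ m" by (rule section_power)
  let ?q = "(monom 1 m - 1) ^ k :: int poly"
  have "(monom 1 m - 1) ^ Suc k = monom 1 m * ?q - ?q" by (simp add: algebra_simps)
  then have "eqv (zact t a ((monom 1 m - 1) ^ Suc k)) (zact t a (monom 1 m * ?q) * inverse (zact t a ?q))"
    using zact_diff[OF a] by metis
  also have "zact t a (monom 1 m * ?q) * inverse (zact t a ?q) = commu (t ^ m) (zact t a ?q)"
    by (simp add: zact_monom_mult commu_def)
  also have "eqv \<dots> (commu (t ^ m) ((commu (t ^ m) ^^ k) a))"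
    by (rule m.commu_eqv[OF Suc])
  finally show ?case by simp
qed

text \<open>It suffices to treat generators, as the layers are subgroups: their m are multiplied and
  their k added. Allowing every multiple n of m lets several sections share one power of t.\<close>

lemma (in abelian_section) eventually_unipotent:
  assumes gr: "poly_growth H" "subgrp H" "t \<in> H" "A \<subseteq> H" and fg: "fin_gen A"
  shows "\<exists>m>0. \<exists>k. \<forall>n. m dvd n \<longrightarrow> (\<forall>x\<in>A. (commu (t ^ n) ^^ k) x \<in> B)"
proof -
  obtain F where F: "finite F" "A = gen F" using fg by (auto simp: fin_gen_def)
  have FA: "F \<subseteq> A" using F gen_incl by blast
  have "\<exists>m k. m > 0 \<and> zact t a ((monom 1 m - 1) ^ k) \<in> B" if "a \<in> F" for a
    using ann_unipotent[OF gr(1-3), of a] that FA gr(4) by blast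
  then obtain m k where mk: "\<And>a. a \<in> F \<Longrightarrow> m a > (0::nat) \<and> zact t a ((monom 1 (m a) - 1) ^ k a) \<in> B"
    by metis
  let ?m = "\<Prod>a\<in>F. m a" and ?k = "\<Sum>a\<in>F. k a"
  have "?m > 0" using mk by (intro prod_pos) auto
  moreover have "(commu (t ^ n) ^^ ?k) x \<in> B" if n: "?m dvd n" and x: "x \<in> A" for n x
  proof -
    interpret n: abelian_section A B "t ^ n" by (rule section_power)
    have "a \<in> n.fixlayer ?k" if a: "a \<in> F" for a
    proof -
      have "m a dvd n" using dvd_prodI[OF F(1) a, of m] n by (rule dvd_trans)
      then have "(monom 1 (m a) - 1 :: int poly) dvd monom 1 n - 1"
        using monom_minus_one_dvd by (metis dvdE)
      moreover have "k a \<le> ?k" using F(1) a by (intro member_le_sum) auto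
      ultimately have "(monom 1 (m a) - 1 :: int poly) ^ k a dvd (monom 1 n - 1) ^ ?k"
        by (meson dvd_power_same dvd_trans le_imp_power_dvd)
      then have "zact t a ((monom 1 n - 1) ^ ?k) \<in> B" using ann_dvd mk[OF a] a FA by blast
      moreover have "a \<in> A" using a FA by blast
      ultimately show ?thesis using eqv_B_iff[OF zact_commu_iter] by (simp add: n.fixlayer_def)
    qed
    then have "A \<subseteq> n.fixlayer ?k" using gen_least[OF n.subgrp_fixlayer, of F] F(2) by blast
    with x show ?thesis by (auto simp: n.fixlayer_def)
  qed
  ultimately show ?thesis by blast
qed

section \<open>Lower central series and nilpotent extensions\<close>

primrec lcs :: "'a::mult_group set \<Rightarrow> nat \<Rightarrow> 'a set" where
  "lcs H 0 = H"
| "lcs H (Suc n) = gen {commu x y | x y. x \<in> lcs H n \<and> y \<in> H}"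

declare lcs.simps(2) [simp del]

lemma subgrp_lcs: "subgrp H \<Longrightarrow> subgrp (lcs H n)"
  by (cases n) (auto simp: lcs.simps intro: subgrp_gen)

lemma commu_lcs: "x \<in> lcs H n \<Longrightarrow> y \<in> H \<Longrightarrow> commu x y \<in> lcs H (Suc n)"
  by (auto simp: lcs.simps intro: gen_base)

lemma normz_lcs: "g \<in> normz H \<Longrightarrow> g \<in> normz (lcs H n)"
proof (induction n)
  case (Suc n)
  then have n: "g \<in> normz (lcs H n)" by blast
  show ?case unfolding lcs.simps
  proof (rule normz_gen)
    fix z assume "z \<in> {commu x y | x y. x \<in> lcs H n \<and> y \<in> H}"
    then obtain x y where z: "z = commu x y" "x \<in> lcs H n" "y \<in> H" by blast
    show "g * z * inverse g \<in> gen {commu x y | x y. x \<in> lcs H n \<and> y \<in> H}"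
      unfolding z(1) commu_conj
      using normz_conj[OF n z(2)] normz_conj[OF Suc.prems z(3)] by (intro gen_base) blast
    show "inverse g * z * g \<in> gen {commu x y | x y. x \<in> lcs H n \<and> y \<in> H}"
      using commu_conj[of "inverse g" x y] normz_conj'[OF n z(2)] normz_conj'[OF Suc.prems z(3)]
      by (intro gen_base) (auto simp: z(1))
  qed
qed simp

lemma lcs_Suc_subset: "subgrp H \<Longrightarrow> lcs H (Suc n) \<subseteq> lcs H n"
proof -
  assume H: "subgrp H"
  have "commu x y \<in> lcs H n" if "x \<in> lcs H n" "y \<in> H" for x y
  proof -
    have "y \<in> normz (lcs H n)" using normz_lcs subset_normz[OF H] that(2) by blast
    then have "y * inverse x * inverse y \<in> lcs H n"
      using normz_conj subgrp_inv[OF subgrp_lcs[OF H]] that(1) by blast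
    with that(1) have "x * (y * inverse x * inverse y) \<in> lcs H n" by (rule subgrp_mult[OF subgrp_lcs[OF H]])
    then show ?thesis by (simp add: commu_def mult.assoc)
  qed
  then show ?thesis unfolding lcs.simps by (intro gen_least subgrp_lcs H) auto
qed

lemma lcs_subset: "subgrp H \<Longrightarrow> lcs H n \<subseteq> H"
  by (induction n) (use lcs_Suc_subset in auto)

lemma lcs_mono: "N \<subseteq> H \<Longrightarrow> lcs N n \<subseteq> lcs H n"
proof (induction n)
  case (Suc n)
  then show ?case unfolding lcs.simps by (intro gen_mono) blast
qed simp

lemma abelian_section_lcs:
  assumes "subgrp H" "t \<in> normz H"
  shows "abelian_section (lcs H n) (lcs H (Suc n)) t"
  by (unfold_locales)
     (use assms subgrp_lcs lcs_Suc_subset normz_lcs lcs_subset commu_lcs in \<open>blast+\<close>)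

text \<open>The lower central series of N is refined by the kernels of (u - 1)^l on its sections. N
  acts trivially on each section and u lowers l by one, so the refined series is central for the
  extended group.\<close>

lemma nilpotent_unipotent_extension:
  assumes N: "subgrp N" "u \<in> normz N" "lcs N c \<subseteq> {1}"
    and uni: "\<And>i. i < c \<Longrightarrow> \<exists>k. \<forall>x\<in>lcs N i. (commu u ^^ k) x \<in> lcs N (Suc i)"
  shows "\<exists>c'. lcs (gen (insert u N)) c' \<subseteq> {1}"
proof -
  let ?M = "gen (insert u N)"
  note M = gen_insert_eq[OF N(1,2)]
  \<comment> \<open>The quotient of \<open>?M\<close> by N is cyclic, hence abelian: one commutator
    step enters N.\<close>
  have commM: "commu x y \<in> N" if xy: "x \<in> ?M" "y \<in> ?M" for x y
  proof -
    obtain a p b q where *: "x = a * zpow u p" "y = b * zpow u q" "a \<in> N" "b \<in> N"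
      using xy unfolding M by blast
    have z: "zpow u i * x * inverse (zpow u i) \<in> N" if "x \<in> N" for x i
      using normz_conj[OF subgrp_zpow[OF subgrp_normz N(2)] that] .
    have comm: "zpow u p * (zpow u q * inverse (zpow u p)) = zpow u q"
    proof -
      have "zpow u p * zpow u q = zpow u q * zpow u p" by (metis add.commute zpow_add)
      then have "zpow u p * zpow u q * inverse (zpow u p) = zpow u q * zpow u p * inverse (zpow u p)"
        by simp
      then show ?thesis by (simp add: mult.assoc)
    qed
    have "commu x y = a * (zpow u p * b * inverse (zpow u p)) *
        ((zpow u p * (zpow u q * inverse (zpow u p))) * inverse a * inverse (zpow u q)) * inverse b"
      by (simp add: commu_def * mult.assoc)
    then have "commu x y = a * (zpow u p * b * inverse (zpow u p)) *
        (zpow u q * inverse a * inverse (zpow u q)) * inverse b"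
      by (simp only: comm)
    then show ?thesis
      using * by (auto intro!: subgrp_mult[OF N(1)] subgrp_inv[OF N(1)] z simp del: group_inverse_mult)
  qed
  have "i \<le> c \<Longrightarrow> \<exists>j. lcs ?M j \<subseteq> lcs N i" for i
  proof (induction i)
    case 0
    have "lcs ?M (Suc 0) \<subseteq> lcs N 0" using commM by (auto simp: lcs.simps intro!: gen_least[OF N(1)])
    then show ?case by blast
  next
    case (Suc i)
    then obtain j where j: "lcs ?M j \<subseteq> lcs N i" by auto
    obtain k where k: "\<And>x. x \<in> lcs N i \<Longrightarrow> (commu u ^^ k) x \<in> lcs N (Suc i)"
      using uni[of i] Suc.prems by auto
    interpret s: abelian_section "lcs N i" "lcs N (Suc i)" u
      by (rule abelian_section_lcs[OF N(1,2)])
    have cN: "commu x n \<in> s.fixlayer l" if "x \<in> lcs N i" "n \<in> N" for x n l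
      using commu_lcs[OF that] s.B_fixlayer by blast
    have "insert u N \<subseteq> normz (s.fixlayer l)" for l
    proof -
      have "n * x * inverse n \<in> s.fixlayer l" if n: "n \<in> N" and x: "x \<in> s.fixlayer l" for n x
      proof -
        have "x \<in> lcs N i" using x by (simp add: s.fixlayer_def)
        from subgrp_mult[OF s.subgrp_fixlayer subgrp_inv[OF s.subgrp_fixlayer cN[OF this n]] x]
        show ?thesis by (simp add: commu_def mult.assoc)
      qed
      from this this[OF subgrp_inv[OF N(1)]] show ?thesis
        using s.normz_fixlayer by (auto simp: normz_def)
    qed
    then have norm: "?M \<subseteq> normz (s.fixlayer l)" for l by (intro gen_least subgrp_normz)
    have step: "commu x y \<in> s.fixlayer l" if x: "x \<in> s.fixlayer (Suc l)" and y: "y \<in> ?M" for x y l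
      using y
    proof induction
      case gen_one
      then show ?case using subgrp_one[OF s.subgrp_fixlayer] by (simp add: commu_def)
    next
      case (gen_base y)
      have "commu u x \<in> s.fixlayer l" using s.commu_fixlayer[OF x] .
      then have "commu x u \<in> s.fixlayer l"
        using subgrp_inv[OF s.subgrp_fixlayer] inverse_commu by metis
      with gen_base cN[of x] x show ?case by (auto simp: s.fixlayer_def)
    next
      case (gen_mult y z)
      have "commu x (y * z) = commu x y * (y * commu x z * inverse y)"
        by (simp add: commu_def mult.assoc)
      moreover have "y * commu x z * inverse y \<in> s.fixlayer l"
        using normz_conj norm gen_mult by blast
      ultimately show ?case using subgrp_mult[OF s.subgrp_fixlayer gen_mult.IH(1)] by simp
    next
      case (gen_inv y)
      have "commu x (inverse y) = inverse y * inverse (commu x y) * y"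
        by (simp add: commu_def mult.assoc)
      then show ?case
        using normz_conj' norm gen_inv subgrp_inv[OF s.subgrp_fixlayer] by (metis subsetD)
    qed
    \<comment> \<open>Since (u - 1)^k kills the section, k commutator steps with \<open>?M\<close>
      pass from \<open>lcs N i\<close> to \<open>lcs N (Suc i)\<close>.\<close>
    have "s' \<le> k \<Longrightarrow> lcs ?M (j + s') \<subseteq> s.fixlayer (k - s')" for s'
    proof (induction s')
      case 0
      then show ?case using j k by (auto simp: s.fixlayer_def)
    next
      case (Suc s')
      then have "lcs ?M (j + s') \<subseteq> s.fixlayer (Suc (k - Suc s'))"
        by (simp add: Suc_diff_Suc)
      then have "{commu x y | x y. x \<in> lcs ?M (j + s') \<and> y \<in> ?M} \<subseteq> s.fixlayer (k - Suc s')"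
        using step by blast
      from gen_least[OF s.subgrp_fixlayer this] show ?case by (simp add: lcs.simps(2)[of ?M])
    qed
    from this[of k] show ?case by (auto simp: s.fixlayer_0)
  qed
  from this[of c] N(3) show ?thesis by blast
qed

text \<open>N need not be normal, so pigeonhole replaces the order of a quotient: two of the powers
  x^0, ..., x^(card T) share a coset, and their exponent difference divides the factorial.\<close>

lemma fin_index_power_in:
  assumes N: "subgrp N" "fin_index N K" and K: "subgrp K"
  obtains q where "q > 0" "\<And>x. x \<in> K \<Longrightarrow> x ^ q \<in> N"
proof -
  obtain T where T: "finite T" "\<And>x. x \<in> K \<Longrightarrow> \<exists>y\<in>N. \<exists>z\<in>T. x = y * z"
    using N(2) by (auto simp: fin_index_def)
  have "x ^ fact (card T) \<in> N" if x: "x \<in> K" for x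
  proof -
    have "\<exists>z. \<exists>y\<in>N. z \<in> T \<and> x ^ i = y * z" for i
      using T(2)[OF subgrp_power[OF K x]] by blast
    then obtain z where z: "\<And>i. \<exists>y\<in>N. z i \<in> T \<and> x ^ i = y * z i" by metis
    have "\<not> inj_on z {..card T}"
    proof
      assume "inj_on z {..card T}"
      then have "card {..card T} \<le> card T"
        using z T(1) by (intro card_inj_on_le[of z]) auto
      then show False by simp
    qed
    then obtain i j where ij: "z i = z j" "i < j" "j \<le> card T"
      by (auto simp: inj_on_def) (metis linorder_neqE_nat)
    obtain y y' where y: "y \<in> N" "y' \<in> N" "x ^ i = y * z i" "x ^ j = y' * z i" using z ij(1) by metis
    have "x ^ j = x ^ (j - i) * x ^ i" using ij(2) by (simp flip: power_add)
    then have "x ^ (j - i) = x ^ j * inverse (x ^ i)" by (simp add: mult.assoc)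
    also have "\<dots> = y' * inverse y" by (simp add: y mult.assoc)
    finally have "x ^ (j - i) \<in> N" using y N(1) by (simp add: subgrp_mult subgrp_inv)
    moreover have "j - i dvd fact (card T)" using ij by (intro dvd_fact) auto
    ultimately show ?thesis using subgrp_power[OF N(1)] by (auto elim!: dvdE simp: power_mult)
  qed
  with that[of "fact (card T)"] show ?thesis by simp
qed

theorem polycyclic_poly_growth_virtually_nilpotent:
  assumes "polycyclic H" "poly_growth H"
  shows "\<exists>N c. subgrp N \<and> N \<subseteq> H \<and> fin_index N H \<and> lcs N c \<subseteq> {1}"
  using assms
proof (induction rule: polycyclic.induct)
  case polycyclic_trivial
  have "subgrp {1 :: 'a}" by (auto intro: subgrpI)
  moreover have "fin_index {1} {1 :: 'a}" unfolding fin_index_def by (intro exI[of _ "{1}"]) auto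
  moreover have "lcs {1 :: 'a} 0 \<subseteq> {1}" by simp
  ultimately show ?case by blast
next
  case (polycyclic_extend K t)
  let ?H = "gen (insert t K)"
  note K = polycyclic_extend.hyps(2) and t = polycyclic_extend.hyps(3)
  have KH: "K \<subseteq> ?H" and tH: "t \<in> ?H" by (auto intro: gen_base)
  obtain N0 c where N0: "subgrp N0" "N0 \<subseteq> K" "fin_index N0 K" "lcs N0 c \<subseteq> {1}"
    using polycyclic_extend.IH[OF poly_growth_subset[OF polycyclic_extend.prems KH]] by blast
  obtain q where q: "q > 0" "\<And>x. x \<in> K \<Longrightarrow> x ^ q \<in> N0"
    using fin_index_power_in[OF N0(1,3) K] by blast
  \<comment> \<open>N0 need not be normalized by t. The subgroup generated by all q-th powers is
    invariant under everything normalizing K, lies in N0, and still has finite index.\<close>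
  define N where "N = gen ((\<lambda>x. x ^ q) ` K)"
  have N: "subgrp N" by (simp add: N_def subgrp_gen)
  have NN0: "N \<subseteq> N0" unfolding N_def using q by (intro gen_least N0) auto
  then have NK: "N \<subseteq> K" using N0(2) by blast
  have normN: "g \<in> normz N" if g: "g \<in> normz K" for g
    unfolding N_def
  proof (rule normz_gen)
    fix x assume "x \<in> (\<lambda>x. x ^ q) ` K"
    then obtain y where y: "y \<in> K" "x = y ^ q" by blast
    show "g * x * inverse g \<in> gen ((\<lambda>x. x ^ q) ` K)"
      unfolding y(2) conj_power[symmetric] using normz_conj[OF g y(1)] by (intro gen_base imageI)
    have "inverse g * x * g = (inverse g * y * g) ^ q" using conj_power[of "inverse g" y q] y(2) by simp
    then show "inverse g * x * g \<in> gen ((\<lambda>x. x ^ q) ` K)"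
      using normz_conj'[OF g y(1)] by (auto intro: gen_base)
  qed
  have idx: "fin_index N K"
    by (rule fin_index_if_powers[OF polycyclic_extend.hyps(1) N _ q(1)])
       (use normN subset_normz[OF K] in \<open>auto simp: N_def intro: gen_base\<close>)
  have tN: "t \<in> normz N" by (rule normN[OF t])
  have nil: "lcs N c \<subseteq> {1}" using lcs_mono[OF NN0] N0(4) by blast
  have "\<exists>m k. m > 0 \<and> (\<forall>n. m dvd n \<longrightarrow> (\<forall>x\<in>lcs N i. (commu (t ^ n) ^^ k) x \<in> lcs N (Suc i)))" for i
  proof -
    interpret abelian_section "lcs N i" "lcs N (Suc i)" t by (rule abelian_section_lcs[OF N tN])
    have sub: "lcs N i \<subseteq> K" using lcs_subset[OF N] NK by blast
    then have "lcs N i \<subseteq> ?H" using KH by blast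
    from eventually_unipotent[OF polycyclic_extend.prems subgrp_gen tH this
        polycyclic_subgroup_fin_gen[OF polycyclic_extend.hyps(1) subgrp_lcs[OF N] sub]]
    show ?thesis by blast
  qed
  then obtain m k where mk: "\<And>i. m i > (0::nat) \<and>
      (\<forall>n. m i dvd n \<longrightarrow> (\<forall>x\<in>lcs N i. (commu (t ^ n) ^^ k i) x \<in> lcs N (Suc i)))" by metis
  \<comment> \<open>One power of t that acts unipotently on all c sections of the lower central
    series of N.\<close>
  define n where "n = (\<Prod>i<c. m i)"
  have n0: "n > 0" unfolding n_def using mk by (intro prod_pos) auto
  have dvd: "m i dvd n" if "i < c" for i unfolding n_def using that by (intro dvd_prodI) auto
  let ?M = "gen (insert (t ^ n) N)"
  have "\<exists>c'. lcs ?M c' \<subseteq> {1}"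
    by (rule nilpotent_unipotent_extension[OF N subgrp_power[OF subgrp_normz tN] nil])
       (use mk dvd in blast)
  moreover have "?M \<subseteq> ?H"
    using NK KH subgrp_power[OF subgrp_gen tH] by (intro gen_least subgrp_gen) auto
  moreover have "fin_index ?M ?H"
    by (rule fin_index_cyclic_extension[OF K t idx tN subgrp_gen _ _ n0]) (auto intro: gen_base)
  ultimately show ?case using subgrp_gen by blast
qed

section \<open>Foelner sets in solvable groups\<close>

text \<open>Demanded for every finite S, so that it makes sense for infinitely generated terms of a
  solvable series.\<close>

definition folner :: "'a::mult_group set \<Rightarrow> bool" where
  "folner H \<longleftrightarrow> (\<forall>S \<delta>. finite S \<and> S \<subseteq> H \<and> \<delta> > 0 \<longrightarrow> (\<exists>F. finite F \<and> F \<noteq> {} \<and> F \<subseteq> H \<and>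
     (\<forall>s\<in>S. real (card {x\<in>F. x * s \<notin> F}) \<le> \<delta> * real (card F))))"

section \<open>Growth of abelian quotients\<close>

definition rcos :: "'a::mult_group set \<Rightarrow> 'a \<Rightarrow> 'a set" where
  "rcos K x = (\<lambda>k. k * x) ` K"

lemma rcos_eq_iff:
  assumes "subgrp K"
  shows "rcos K x = rcos K y \<longleftrightarrow> x * inverse y \<in> K"
proof
  assume "rcos K x = rcos K y"
  moreover have "x \<in> rcos K x" using subgrp_one[OF assms] by (auto simp: rcos_def intro: image_eqI[of _ _ 1])
  ultimately obtain k where "k \<in> K" "x = k * y" by (auto simp: rcos_def)
  then show "x * inverse y \<in> K" by (simp add: mult.assoc)
next
  assume k: "x * inverse y \<in> K"
  show "rcos K x = rcos K y"
  proof (intro equalityI subsetI)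
    fix z assume "z \<in> rcos K x"
    then obtain l where "l \<in> K" "z = l * x" by (auto simp: rcos_def)
    then have "z = (l * (x * inverse y)) * y" "l * (x * inverse y) \<in> K"
      using subgrp_mult[OF assms] k by (simp_all add: mult.assoc)
    then show "z \<in> rcos K y" unfolding rcos_def by (rule image_eqI)
  next
    fix z assume "z \<in> rcos K y"
    then obtain l where "l \<in> K" "z = l * y" by (auto simp: rcos_def)
    then have "z = (l * inverse (x * inverse y)) * x" "l * inverse (x * inverse y) \<in> K"
      using subgrp_mult[OF assms _ subgrp_inv[OF assms k]] by (simp_all add: mult.assoc)
    then show "z \<in> rcos K x" unfolding rcos_def by (rule image_eqI)
  qed
qed

lemma rcos_mult: "rcos K (x * y) = (\<lambda>z. z * y) ` rcos K x"
  by (simp add: rcos_def image_image mult.assoc)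

lemma rcos_commute:
  assumes K: "subgrp K"
    and comm: "x \<in> H" "y \<in> H" "\<And>x y. x \<in> H \<Longrightarrow> y \<in> H \<Longrightarrow> x * y * inverse x * inverse y \<in> K"
  shows "rcos K (x * y) = rcos K (y * x)"
  unfolding rcos_eq_iff[OF K] using comm(3)[OF comm(1,2)] by (simp add: mult.assoc)

text \<open>Equality of cosets K x is evidently preserved by right factors only, so y is first
  carried to the front and then past z.\<close>

lemma rcos_commute_left:
  assumes K: "subgrp K" and H: "subgrp H"
    and comm: "z \<in> H" "x \<in> H" "y \<in> H" "\<And>x y. x \<in> H \<Longrightarrow> y \<in> H \<Longrightarrow> x * y * inverse x * inverse y \<in> K"
  shows "rcos K (z * x * y) = rcos K (z * y * x)"
proof -
  have "rcos K (z * x * y) = rcos K (y * (z * x))"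
    using comm by (intro rcos_commute[OF K]) (auto intro: subgrp_mult[OF H])
  also have "\<dots> = (\<lambda>w. w * x) ` rcos K (y * z)" by (simp add: rcos_mult image_image flip: mult.assoc)
  also have "rcos K (y * z) = rcos K (z * y)"
    using comm by (intro rcos_commute[OF K])
  finally show ?thesis by (simp add: rcos_mult)
qed

text \<open>Modulo K everything commutes, so all letters s are collected at the end, with an
  exponent between -n and n.\<close>

lemma word_ball_insert_rcos:
  assumes K: "subgrp K" and H: "subgrp H" "insert s S \<subseteq> H"
    and comm: "\<And>x y. x \<in> H \<Longrightarrow> y \<in> H \<Longrightarrow> x * y * inverse x * inverse y \<in> K"
    and x: "x \<in> word_ball (insert s S) n"
  shows "\<exists>y\<in>word_ball S n. \<exists>i\<in>{- int n..int n}. rcos K x = rcos K (y * zpow s i)"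
  using x
proof (induction n arbitrary: x)
  case (Suc n)
  have BH: "word_ball S m \<subseteq> H" for m
    using word_ball_subset_gen[of S m] gen_least[OF H(1), of S] H(2) by blast
  from Suc.prems consider "x \<in> word_ball (insert s S) n"
    | x' g where "x = x' * g" "x' \<in> word_ball (insert s S) n" "g \<in> insert s S \<union> inverse ` insert s S"
    by auto
  then show ?case
  proof cases
    case 1
    from Suc.IH[OF this] obtain y i where "y \<in> word_ball S n" "i \<in> {- int n..int n}"
      "rcos K x = rcos K (y * zpow s i)" by blast
    then show ?thesis by (intro bexI[of _ y] bexI[of _ i]) auto
  next
    case 2
    from Suc.IH[OF 2(2)] obtain y i where y: "y \<in> word_ball S n" "i \<in> {- int n..int n}"
      "rcos K x' = rcos K (y * zpow s i)" by blast
    have xg: "rcos K x = rcos K (y * zpow s i * g)"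
      unfolding 2(1) rcos_mult[of K x'] rcos_mult[of K "y * zpow s i"] y(3) ..
    have ySuc: "y \<in> word_ball S (Suc n)" using y(1) by simp
    consider "g = s" | "g = inverse s" | "g \<in> S \<union> inverse ` S" using 2(3) by auto
    then show ?thesis
    proof cases
      case 1
      then have "rcos K x = rcos K (y * zpow s (i + 1))" using xg by (simp add: zpow_plus1 mult.assoc)
      then show ?thesis using ySuc y(2) by (intro bexI[of _ y] bexI[of _ "i + 1"]) auto
    next
      case 2
      then have "rcos K x = rcos K (y * zpow s (i - 1))" using xg by (simp add: zpow_minus1 mult.assoc)
      then show ?thesis using ySuc y(2) by (intro bexI[of _ y] bexI[of _ "i - 1"]) auto
    next
      case 3
      have gH: "g \<in> H" using 3 H subgrp_inv[OF H(1)] by auto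
      have "rcos K x = rcos K (y * g * zpow s i)"
        unfolding xg using BH y(1) gH H by (intro rcos_commute_left[OF K H(1) _ _ _ comm])
          (auto intro: subgrp_zpow)
      moreover have "y * g \<in> word_ball S (Suc n)" using y(1) 3 by force
      ultimately show ?thesis using y(2) by (intro bexI[of _ "y * g"] bexI[of _ i]) auto
    qed
  qed
qed (auto intro!: bexI[of _ 0])

lemma card_rcos_word_ball:
  assumes K: "subgrp K" and H: "subgrp H"
    and comm: "\<And>x y. x \<in> H \<Longrightarrow> y \<in> H \<Longrightarrow> x * y * inverse x * inverse y \<in> K"
    and S: "finite S" "S \<subseteq> H"
  shows "card (rcos K ` word_ball S n) \<le> (n * 2 + 1) ^ card S"
  using S
proof (induction S)
  case empty
  have "word_ball {} n = {1 :: 'a}" by (induction n) auto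
  then show ?case by simp
next
  case (insert s S)
  let ?f = "\<lambda>(i, c). (\<lambda>z. z * zpow s i) ` c"
  have "rcos K ` word_ball (insert s S) n \<subseteq> ?f ` ({- int n..int n} \<times> rcos K ` word_ball S n)"
  proof
    fix c assume "c \<in> rcos K ` word_ball (insert s S) n"
    then obtain x where x: "x \<in> word_ball (insert s S) n" "c = rcos K x" by blast
    obtain y i where y: "y \<in> word_ball S n" "i \<in> {- int n..int n}" "rcos K x = rcos K (y * zpow s i)"
      using word_ball_insert_rcos[OF K H insert.prems comm x(1)] by blast
    then have "c = ?f (i, rcos K y)" by (simp add: x rcos_mult)
    with y show "c \<in> ?f ` ({- int n..int n} \<times> rcos K ` word_ball S n)" by blast
  qed
  then have "card (rcos K ` word_ball (insert s S) n) \<le> card (?f ` ({- int n..int n} \<times> rcos K ` word_ball S n))"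
    using insert.hyps(1) by (intro card_mono) (auto intro!: finite_word_ball)
  also have "\<dots> \<le> card ({- int n..int n} \<times> rcos K ` word_ball S n)"
    using insert.hyps(1) by (intro card_image_le finite_cartesian_product) (auto intro!: finite_word_ball)
  also have "card {- int n..int n} = n * 2 + 1" by simp
  then have "card ({- int n..int n} \<times> rcos K ` word_ball S n) = (n * 2 + 1) * card (rcos K ` word_ball S n)"
    by (simp only: card_cartesian_product)
  also have "\<dots> \<le> (n * 2 + 1) * (n * 2 + 1) ^ card S"
    using insert by (intro mult_left_mono) auto
  finally show ?case using insert.hyps by simp
qed

lemma poly_less_exp:
  fixes x :: real
  assumes "x > 1"
  shows "\<exists>n. real ((n * 2 + 1) ^ d) < x ^ n"
proof -
  obtain p where p: "2 < x ^ p" using real_arch_pow[OF assms] by blast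
  have p1: "p \<ge> 1" using p by (cases p) auto
  obtain m where m: "p ^ d * (m * 2 + 1) ^ d < (2::nat) ^ m" using poly_less_two_power by blast
  have "(p * m * 2 + 1) ^ d \<le> (p * (m * 2 + 1)) ^ d"
    using p1 by (intro power_mono) (auto simp: algebra_simps)
  also have "\<dots> < 2 ^ m" using m by (simp only: power_mult_distrib)
  finally have "real ((p * m * 2 + 1) ^ d) < 2 ^ m"
    using of_nat_less_iff[of "(p * m * 2 + 1) ^ d" "2 ^ m", where ?'a = real] by simp
  also have "\<dots> \<le> (x ^ p) ^ m" using p by (intro power_mono) auto
  finally show ?thesis by (intro exI[of _ "p * m"]) (simp only: power_mult)
qed

lemma slow_growth_step:
  fixes f :: "nat \<Rightarrow> nat"
  assumes "f 0 \<ge> 1" "\<And>n. f n \<le> (n * 2 + 1) ^ d" "\<delta> > (0::real)"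
  shows "\<exists>n. real (f (Suc n)) \<le> (1 + \<delta>) * real (f n)"
proof (rule ccontr)
  assume "\<not> ?thesis"
  then have step: "real (f (Suc n)) > (1 + \<delta>) * real (f n)" for n by (simp add: not_le)
  have "real (f n) \<ge> (1 + \<delta>) ^ n" for n
  proof (induction n)
    case (Suc n)
    have "(1 + \<delta>) ^ Suc n \<le> (1 + \<delta>) * real (f n)" using Suc assms(3) by simp
    with step[of n] show ?case by linarith
  qed (use assms(1) in simp)
  moreover obtain n where "real ((n * 2 + 1) ^ d) < (1 + \<delta>) ^ n" using poly_less_exp[of "1 + \<delta>" d] assms(3) by auto
  ultimately show False using assms(2)[of n] by (meson not_le of_nat_mono order_trans)
qed

text \<open>Polynomial growth of the quotient makes some ball grow by a factor of at most 1 + delta,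
  hence almost invariant. T picks one representative for each coset in that ball.\<close>

lemma folner_transversal:
  assumes K: "subgrp K" and H: "subgrp H"
    and comm: "\<And>x y. x \<in> H \<Longrightarrow> y \<in> H \<Longrightarrow> x * y * inverse x * inverse y \<in> K"
    and S: "finite S" "S \<subseteq> H" and \<delta>: "\<delta> > (0::real)"
  shows "\<exists>T. finite T \<and> T \<noteq> {} \<and> T \<subseteq> H \<and> inj_on (rcos K) T \<and>
    (\<forall>s\<in>S. real (card {x\<in>T. rcos K (x * s) \<notin> rcos K ` T}) \<le> \<delta> * real (card T))"
proof -
  let ?Q = "\<lambda>n. rcos K ` word_ball S n"
  have finQ: "finite (?Q n)" for n using S by (intro finite_imageI finite_word_ball)
  obtain n where n: "real (card (?Q (Suc n))) \<le> (1 + \<delta>) * real (card (?Q n))"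
    using slow_growth_step[of "\<lambda>n. card (?Q n)" "card S" \<delta>] card_rcos_word_ball[OF K H comm S] \<delta>
    by (auto simp del: word_ball.simps(2))
  obtain T where T: "T \<subseteq> word_ball S n" "inj_on (rcos K) T" "?Q n = rcos K ` T"
    using subset_image_inj[of "?Q n" "rcos K" "word_ball S n"] by auto
  have finT: "finite T" using T(1) finite_word_ball[OF S(1)] finite_subset by blast
  have BH: "word_ball S n \<subseteq> H" using word_ball_subset_gen[of S n] gen_least[OF H S(2)] by blast
  have cardT: "card T = card (?Q n)" by (simp add: T(3) card_image[OF T(2)])
  have "real (card {x\<in>T. rcos K (x * s) \<notin> rcos K ` T}) \<le> \<delta> * real (card T)" if s: "s \<in> S" for s
  proof -
    let ?B = "{x\<in>T. rcos K (x * s) \<notin> rcos K ` T}"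
    have "inj_on (\<lambda>x. rcos K (x * s)) ?B"
    proof (rule inj_onI)
      fix x y assume xy: "x \<in> ?B" "y \<in> ?B" "rcos K (x * s) = rcos K (y * s)"
      then have "x * inverse y \<in> K" by (simp add: rcos_eq_iff[OF K] mult.assoc)
      then have "rcos K x = rcos K y" by (simp add: rcos_eq_iff[OF K])
      with xy T(2) show "x = y" by (auto dest: inj_onD)
    qed
    moreover have "(\<lambda>x. rcos K (x * s)) ` ?B \<subseteq> ?Q (Suc n) - ?Q n"
    proof
      fix c assume "c \<in> (\<lambda>x. rcos K (x * s)) ` ?B"
      then obtain x where x: "x \<in> T" "c = rcos K (x * s)" "c \<notin> rcos K ` T" by blast
      have "x * s \<in> word_ball S (Suc n)" using x(1) T(1) s by force
      with x show "c \<in> ?Q (Suc n) - ?Q n" unfolding T(3) by blast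
    qed
    ultimately have "card ?B \<le> card (?Q (Suc n) - ?Q n)" 
      using finQ[of "Suc n"] by (intro card_inj_on_le[of "\<lambda>x. rcos K (x * s)"] finite_Diff)
    also have "\<dots> = card (?Q (Suc n)) - card (?Q n)"
      using finQ[of n] by (intro card_Diff_subset image_mono word_ball_mono_Suc)
    finally have "real (card ?B) \<le> real (card (?Q (Suc n)) - card (?Q n))" by simp
    also have "\<dots> = real (card (?Q (Suc n))) - real (card (?Q n))"
      using finQ[of "Suc n"] by (intro of_nat_diff card_mono image_mono word_ball_mono_Suc)
    finally show ?thesis using n by (simp add: cardT algebra_simps)
  qed
  moreover have "word_ball S n \<noteq> {}" using one_in_word_ball by blast
  then have "T \<noteq> {}" using T(3) by auto
  ultimately show ?thesis using finT T(1,2) BH by blast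
qed

text \<open>The set is E T, with T representing an almost invariant set of the quotient and E almost
  invariant in K under the finitely many corrections x s r^-1 by which T fails to be closed.\<close>

lemma folner_extension:
  assumes fK: "folner K" and K: "subgrp K" and H: "subgrp H" "K \<subseteq> H"
    and comm: "\<And>x y. x \<in> H \<Longrightarrow> y \<in> H \<Longrightarrow> x * y * inverse x * inverse y \<in> K"
  shows "folner H"
  unfolding folner_def
proof (intro allI impI)
  fix S and \<delta> :: real assume S: "finite S \<and> S \<subseteq> H \<and> \<delta> > 0"
  then have S': "finite S" "S \<subseteq> H" "\<delta> / 2 > 0" by auto
  from folner_transversal[OF K H(1) comm S']
  obtain T where T: "finite T" "T \<noteq> {}" "T \<subseteq> H" "inj_on (rcos K) T"
    "\<And>s. s \<in> S \<Longrightarrow> real (card {x\<in>T. rcos K (x * s) \<notin> rcos K ` T}) \<le> \<delta> / 2 * real (card T)"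
    by auto
  let ?good = "\<lambda>s. {x\<in>T. rcos K (x * s) \<in> rcos K ` T}"
  define r where "r x s = (SOME y. y \<in> T \<and> x * s * inverse y \<in> K)" for x s
  have r: "r x s \<in> T" "x * s * inverse (r x s) \<in> K" if "x \<in> ?good s" for x s
  proof -
    have "\<exists>y. y \<in> T \<and> x * s * inverse y \<in> K" using that by (auto simp: rcos_eq_iff[OF K])
    from someI_ex[OF this] show "r x s \<in> T" "x * s * inverse (r x s) \<in> K"
      unfolding r_def by blast+
  qed
  \<comment> \<open>T comes first: only then are the finitely many elements of K known for which E
    must be chosen.\<close>
  define K0 where "K0 = (\<Union>s\<in>S. (\<lambda>x. x * s * inverse (r x s)) ` ?good s)"
  have K0: "finite K0 \<and> K0 \<subseteq> K \<and> \<delta> / 2 > 0"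
    using S T(1) r(2) unfolding K0_def by auto
  from fK[unfolded folner_def, rule_format, OF K0]
  obtain E where E: "finite E" "E \<noteq> {}" "E \<subseteq> K"
    and Es: "\<forall>k\<in>K0. real (card {x\<in>E. x * k \<notin> E}) \<le> \<delta> / 2 * real (card E)"
    by blast
  define F where "F = (\<lambda>(e, x). e * x) ` (E \<times> T)"
  have inj: "inj_on (\<lambda>(e, x). e * x) (E \<times> T)"
  proof (rule inj_onI, clarify)
    fix e x e' x' assume *: "e \<in> E" "x \<in> T" "e' \<in> E" "x' \<in> T" "e * x = e' * x'"
    then have "x * inverse x' = inverse e * e'"
      by (metis group_right_cancel inverse_mult_cancel inverse_mult_self mult.assoc mult_1_right)
    moreover have "inverse e * e' \<in> K"
      by (rule subgrp_mult[OF K subgrp_inv[OF K]]) (use * E(3) in blast)+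
    ultimately have "rcos K x = rcos K x'" by (simp add: rcos_eq_iff[OF K])
    then have "x = x'" using T(4) * by (auto dest: inj_onD)
    with * show "e = e' \<and> x = x'" by simp
  qed
  have cardF: "card F = card E * card T"
    unfolding F_def by (simp add: card_image[OF inj] card_cartesian_product)
  have "real (card {z\<in>F. z * s \<notin> F}) \<le> \<delta> * real (card F)" if s: "s \<in> S" for s
  proof -
    let ?bad = "{x\<in>T. rcos K (x * s) \<notin> rcos K ` T}"
    let ?k = "\<lambda>x. x * s * inverse (r x s)"
    let ?P = "E \<times> ?bad" and ?Q = "SIGMA x:?good s. {e\<in>E. e * ?k x \<notin> E}"
    \<comment> \<open>A point e x leaves F because its coset leaves T or because its K-part leaves
      E. Each accounts for at most half of delta.\<close>
    have "{z\<in>F. z * s \<notin> F} \<subseteq> (\<lambda>(e, x). e * x) ` ?P \<union> (\<lambda>(x, e). e * x) ` ?Q"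
    proof
      fix z assume z: "z \<in> {z\<in>F. z * s \<notin> F}"
      then obtain e x where ex: "e \<in> E" "x \<in> T" "z = e * x" by (auto simp: F_def)
      show "z \<in> (\<lambda>(e, x). e * x) ` ?P \<union> (\<lambda>(x, e). e * x) ` ?Q"
      proof (cases "x \<in> ?good s")
        case True
        have "e * ?k x \<notin> E"
        proof
          assume "e * ?k x \<in> E"
          then have "e * ?k x * r x s \<in> F" using r[OF True] unfolding F_def by (intro image_eqI[of _ _ "(e * ?k x, r x s)"]) auto
          with z show False by (simp add: ex mult.assoc)
        qed
        then have "(x, e) \<in> ?Q" using True ex by blast
        then show ?thesis using ex(3) by force
      next
        case False
        then have "(e, x) \<in> ?P" using ex by blast
        then show ?thesis using ex(3) by force
      qed
    qed
    then have "card {z\<in>F. z * s \<notin> F} \<le> card ((\<lambda>(e, x). e * x) ` ?P \<union> (\<lambda>(x, e). e * x) ` ?Q)"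
      using E(1) T(1) by (intro card_mono) auto
    also have "\<dots> \<le> card ((\<lambda>(e, x). e * x) ` ?P) + card ((\<lambda>(x, e). e * x) ` ?Q)" by (rule card_Un_le)
    also have "\<dots> \<le> card ?P + card ?Q"
      using E(1) T(1) by (intro add_mono card_image_le) auto
    also have "\<dots> = card E * card ?bad + (\<Sum>x\<in>?good s. card {e\<in>E. e * ?k x \<notin> E})"
      using E(1) T(1) by (simp add: card_cartesian_product)
    finally have "real (card {z\<in>F. z * s \<notin> F}) \<le>
        real (card E * card ?bad + (\<Sum>x\<in>?good s. card {e\<in>E. e * ?k x \<notin> E}))"
      by (simp only: of_nat_le_iff)
    also have "\<dots> = real (card E) * real (card ?bad) + (\<Sum>x\<in>?good s. real (card {e\<in>E. e * ?k x \<notin> E}))"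
      by (simp only: of_nat_add of_nat_mult of_nat_sum)
    also have "(\<Sum>x\<in>?good s. real (card {e\<in>E. e * ?k x \<notin> E})) \<le> (\<Sum>x\<in>?good s. \<delta> / 2 * real (card E))"
      using s by (intro sum_mono Es[rule_format]) (auto simp: K0_def)
    also have "\<dots> \<le> (\<Sum>x\<in>T. \<delta> / 2 * real (card E))"
      using T(1) S'(3) by (intro sum_mono2) auto
    also have "real (card E) * real (card ?bad) \<le> real (card E) * (\<delta> / 2 * real (card T))"
      using T(5)[OF s] by (intro mult_left_mono) auto
    finally show ?thesis by (simp add: cardF algebra_simps)
  qed
  moreover have "F \<subseteq> H" using E(3) T(3) H by (auto simp: F_def intro: subgrp_mult[OF H(1)])
  moreover have "finite F" "F \<noteq> {}" using E T by (auto simp: F_def)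
  ultimately show "\<exists>F. finite F \<and> F \<noteq> {} \<and> F \<subseteq> H \<and> (\<forall>s\<in>S. real (card {x\<in>F. x * s \<notin> F}) \<le> \<delta> * real (card F))"
    by blast
qed

lemma solv_folner: "solv H \<Longrightarrow> folner H"
proof (induction rule: solv.induct)
  case solv_trivial
  show ?case unfolding folner_def by (intro allI impI exI[of _ "{1}"]) auto
next
  case (solv_extend K H)
  then show ?case by (intro folner_extension[of K H])
qed

section \<open>Growth from separation\<close>

definition adj :: "'a::mult_group set \<Rightarrow> 'a \<Rightarrow> 'a \<Rightarrow> bool" where
  "adj S x y \<longleftrightarrow> (\<exists>s\<in>S. y = x * s \<or> x = y * s)"

text \<open>Pairs are oriented from X to Y, so between disjoint sets each undirected edge counts
  once.\<close>

definition edges_between :: "'a::mult_group set \<Rightarrow> 'a set \<Rightarrow> 'a set \<Rightarrow> ('a \<times> 'a) set" where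
  "edges_between S X Y = {(x, y). x \<in> X \<and> y \<in> Y \<and> adj S x y}"

lemma adj_sym: "adj S x y \<longleftrightarrow> adj S y x"
  by (auto simp: adj_def)

lemma adj_iff: "adj S x y \<longleftrightarrow> (\<exists>s\<in>S \<union> inverse ` S. y = x * s)"
proof -
  have "x = y * s \<longleftrightarrow> y = x * inverse s" for s by (auto simp: mult.assoc)
  then show ?thesis by (auto simp: adj_def)
qed

lemma finite_edges_between: "finite S \<Longrightarrow> finite X \<Longrightarrow> finite (edges_between S X Y)"
  by (rule finite_subset[of _ "(\<lambda>(x, s). (x, x * s)) ` (X \<times> (S \<union> inverse ` S))"])
     (auto simp: edges_between_def adj_iff)

lemma card_edges_between_commute: "card (edges_between S X Y) = card (edges_between S Y X)"
  by (rule bij_betw_same_card[of prod.swap], rule bij_betw_byWitness[of _ prod.swap])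
     (auto simp: edges_between_def adj_sym)

lemma card_edges_between_Un:
  assumes "finite S" "finite X" "Y \<inter> Z = {}"
  shows "card (edges_between S X (Y \<union> Z)) = card (edges_between S X Y) + card (edges_between S X Z)"
proof -
  have "edges_between S X (Y \<union> Z) = edges_between S X Y \<union> edges_between S X Z"
    by (auto simp: edges_between_def)
  moreover have "edges_between S X Y \<inter> edges_between S X Z = {}"
    using assms(3) by (auto simp: edges_between_def)
  ultimately show ?thesis using assms by (simp add: card_Un_disjoint finite_edges_between)
qed

lemma card_edges_between_Un_left:
  assumes "finite S" "finite X" "finite Y" "X \<inter> Y = {}"
  shows "card (edges_between S (X \<union> Y) Z) = card (edges_between S X Z) + card (edges_between S Y Z)"
proof -
  have "edges_between S (X \<union> Y) Z = edges_between S X Z \<union> edges_between S Y Z"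
    by (auto simp: edges_between_def)
  moreover have "edges_between S X Z \<inter> edges_between S Y Z = {}"
    using assms(4) by (auto simp: edges_between_def)
  ultimately show ?thesis using assms by (simp add: card_Un_disjoint finite_edges_between)
qed

text \<open>Edges between A and F - A belong to both boundaries, once from each side; every other
  boundary edge stays a boundary edge of F.\<close>

lemma card_boundary_split:
  assumes "finite S" "finite F" "A \<subseteq> F"
  shows "card (edges_between S A (- A)) + card (edges_between S (F - A) (- (F - A))) =
    card (edges_between S F (- F)) + 2 * card (edges_between S A (F - A))"
proof -
  have fin: "finite A" "finite (F - A)" using assms finite_subset by auto
  have "card (edges_between S A ((F - A) \<union> - F)) =
      card (edges_between S A (F - A)) + card (edges_between S A (- F))"
    using assms fin by (intro card_edges_between_Un) auto
  moreover have "(F - A) \<union> - F = - A" using assms(3) by auto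
  moreover have "card (edges_between S (F - A) (A \<union> - F)) =
      card (edges_between S (F - A) A) + card (edges_between S (F - A) (- F))"
    using assms fin by (intro card_edges_between_Un) auto
  moreover have "A \<union> - F = - (F - A)" by auto
  moreover have "card (edges_between S (A \<union> (F - A)) (- F)) =
      card (edges_between S A (- F)) + card (edges_between S (F - A) (- F))"
    using assms fin by (intro card_edges_between_Un_left) auto
  moreover have "A \<union> (F - A) = F" using assms(3) by auto
  moreover have "card (edges_between S (F - A) A) = card (edges_between S A (F - A))"
    by (rule card_edges_between_commute)
  ultimately show ?thesis by simp
qed

text \<open>Cutting \<open>F\<close> along \<open>A\<close>, either \<open>F - A\<close> has boundary ratio at most that of \<open>F\<close>, or \<open>A\<close>, which
  has at most half the size, loses only \<open>2 c |F|\<^sup>-\<^sup>\<epsilon>\<close>; these losses add up geometrically.\<close>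

lemma cut_down:
  fixes \<epsilon> c \<mu> :: real
  assumes S: "finite S" and \<epsilon>: "\<epsilon> > 0" "\<epsilon> < 1" and c: "c > 0" and n: "n > 0"
    and sep: "\<And>F. finite F \<Longrightarrow> F \<subseteq> H \<Longrightarrow> n < card F \<Longrightarrow>
      \<exists>A. A \<subseteq> F \<and> A \<noteq> {} \<and> 2 * card A \<le> card F \<and>
        real (card (edges_between S A (F - A))) \<le> c * real (card F) powr (- \<epsilon>) * real (card A)"
    and F: "finite F" "F \<subseteq> H" "F \<noteq> {}"
    and \<mu>: "real (card (edges_between S F (- F))) \<le> \<mu> * real (card F)"
  defines "C \<equiv> 2 * c / (2 powr \<epsilon> - 1)"
  shows "\<exists>F'. finite F' \<and> F' \<subseteq> H \<and> F' \<noteq> {} \<and> card F' \<le> n \<and>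
    real (card (edges_between S F' (- F'))) \<le> (\<mu> + 2 * C * real n powr (- \<epsilon>)) * real (card F')"
proof -
  have pw: "2 powr \<epsilon> > 1" "2 powr \<epsilon> < 2"
    using \<epsilon> powr_less_mono[of 0 \<epsilon> "2::real"] powr_less_mono[of \<epsilon> 1 "2::real"] by auto
  have C0: "C > 0" using pw c by (simp add: C_def)
  have C2: "2 * c \<le> C" using pw c by (simp add: C_def field_simps)
  have Ceq: "2 * c = C * (2 powr \<epsilon> - 1)" using pw \<epsilon> by (simp add: C_def)
  have mono: "real k powr (- \<epsilon>) \<le> real l powr (- \<epsilon>)" if "0 < l" "l \<le> k" for k l :: nat
    using that \<epsilon> by (intro powr_mono2') auto
  \<comment> \<open>Total loss allowed from size m down to n. As 2 c = C (2^epsilon - 1), halving m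
    releases at least 2 c m^-epsilon; the 2 in front pays for the cut that falls to size n or
    below.\<close>
  define b where "b m = (if m \<le> n then 0 else C * (2 * real n powr (- \<epsilon>) - real m powr (- \<epsilon>)))" for m
  have b_nonneg: "0 \<le> b m" for m
  proof (cases "m \<le> n")
    case False
    then have "real m powr (- \<epsilon>) \<le> real n powr (- \<epsilon>)" using mono[of n m] n by simp
    then have "0 \<le> 2 * real n powr (- \<epsilon>) - real m powr (- \<epsilon>)"
      using powr_ge_zero[of "real n" "- \<epsilon>"] by linarith
    then show ?thesis using C0 False by (simp add: b_def)
  qed (simp add: b_def)
  have b_mono: "b l \<le> b m" if "0 < l" "l \<le> m" for l m
  proof (cases "l \<le> n")
    case True
    then show ?thesis using b_nonneg[of m] by (simp add: b_def)
  next
    case False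
    then show ?thesis using that mono[of l m] C0 by (simp add: b_def)
  qed
  have b_half: "2 * c * real m powr (- \<epsilon>) + b l \<le> b m" if "0 < l" "2 * l \<le> m" "n < m" for l m
  proof (cases "l \<le> n")
    case True
    have "2 * c * real m powr (- \<epsilon>) \<le> C * real m powr (- \<epsilon>)" using C2 by (intro mult_right_mono) auto
    also have "\<dots> \<le> C * (2 * real n powr (- \<epsilon>) - real m powr (- \<epsilon>))"
      using mono[of n m] that n C0 by (intro mult_left_mono) auto
    finally show ?thesis using True that by (simp add: b_def)
  next
    case False
    have "real m powr (- \<epsilon>) \<le> real (2 * l) powr (- \<epsilon>)" using that by (intro mono) auto
    also have "\<dots> = 2 powr (- \<epsilon>) * real l powr (- \<epsilon>)" by (simp add: powr_mult)
    finally have "2 powr \<epsilon> * real m powr (- \<epsilon>) \<le> 2 powr \<epsilon> * (2 powr (- \<epsilon>) * real l powr (- \<epsilon>))"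
      by (intro mult_left_mono) auto
    also have "\<dots> = real l powr (- \<epsilon>)" by (simp add: powr_minus)
    finally have "C * (2 powr \<epsilon> * real m powr (- \<epsilon>)) \<le> C * real l powr (- \<epsilon>)"
      using C0 by (intro mult_left_mono) auto
    then show ?thesis using False that unfolding Ceq b_def by (simp add: algebra_simps)
  qed
  have "\<exists>F'. finite F' \<and> F' \<subseteq> H \<and> F' \<noteq> {} \<and> card F' \<le> n \<and>
      real (card (edges_between S F' (- F'))) \<le> (\<mu> + b (card F)) * real (card F')"
    using F \<mu>
  proof (induction "card F" arbitrary: F \<mu> rule: less_induct)
    case less
    show ?case
    proof (cases "card F \<le> n")
      case True
      then show ?thesis using less.prems by (intro exI[of _ F]) (simp add: b_def)
    next
      case False
      let ?m = "real (card F)"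
      obtain A where A: "A \<subseteq> F" "A \<noteq> {}" "2 * card A \<le> card F"
        "real (card (edges_between S A (F - A))) \<le> c * ?m powr (- \<epsilon>) * real (card A)"
        using sep[OF less.prems(1,2)] False by auto
      have finA: "finite A" using A(1) less.prems(1) finite_subset by blast
      have cA: "card A > 0" using A(2) finA by (simp add: card_gt_0_iff)
      have cFA: "card (F - A) + card A = card F"
        using card_Diff_subset[OF finA A(1)] card_mono[OF less.prems(1) A(1)] by simp
      let ?a = "real (card (edges_between S A (- A)))"
      let ?d = "real (card (edges_between S (F - A) (- (F - A))))"
      have "?a + ?d = real (card (edges_between S F (- F))) + 2 * real (card (edges_between S A (F - A)))"
        using card_boundary_split[OF S less.prems(1) A(1)] by (simp flip: of_nat_add)
      also have "\<dots> \<le> \<mu> * ?m + 2 * (c * ?m powr (- \<epsilon>) * real (card A))"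
        using less.prems(4) A(4) by linarith
      also have "?m = real (card (F - A)) + real (card A)" using cFA by linarith
      \<comment> \<open>The whole loss is charged to A, which is possible because the cut is bounded
        by a multiple of card A. One of the two pieces must then meet its share.\<close>
      finally have sum: "?a + ?d \<le> \<mu> * real (card (F - A)) +
          (\<mu> + 2 * c * ?m powr (- \<epsilon>)) * real (card A)"
        unfolding cFA[symmetric] by (simp add: algebra_simps)
      show ?thesis
      proof (cases "?a \<le> (\<mu> + 2 * c * ?m powr (- \<epsilon>)) * real (card A)")
        case True
        have "card A < card F" using A(3) cA by linarith
        from less.hyps[OF this finA _ A(2) True] A(1) less.prems(2)
        obtain F' where F': "finite F'" "F' \<subseteq> H" "F' \<noteq> {}" "card F' \<le> n"
          "real (card (edges_between S F' (- F'))) \<le> (\<mu> + 2 * c * ?m powr (- \<epsilon>) + b (card A)) * real (card F')"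
          by blast
        note F'(5)
        also have "(\<mu> + 2 * c * ?m powr (- \<epsilon>) + b (card A)) * real (card F') \<le> (\<mu> + b (card F)) * real (card F')"
          using b_half[OF cA A(3)] False by (intro mult_right_mono) auto
        finally show ?thesis using F' by blast
      next
        case False
        with sum have d: "?d \<le> \<mu> * real (card (F - A))" by linarith
        have lt: "card (F - A) < card F" using cFA cA by linarith
        have pos: "card (F - A) > 0" using cFA A(3) cA by linarith
        then have "F - A \<noteq> {}" by (metis card_gt_0_iff)
        from less.hyps[OF lt _ _ this d] less.prems(1,2)
        obtain F' where F': "finite F'" "F' \<subseteq> H" "F' \<noteq> {}" "card F' \<le> n"
          "real (card (edges_between S F' (- F'))) \<le> (\<mu> + b (card (F - A))) * real (card F')"
          by blast
        note F'(5)
        also have "(\<mu> + b (card (F - A))) * real (card F') \<le> (\<mu> + b (card F)) * real (card F')"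
          using b_mono[OF pos less_imp_le[OF lt]] by (intro mult_right_mono) auto
        finally show ?thesis using F' by blast
      qed
    qed
  qed
  then obtain F' where F': "finite F'" "F' \<subseteq> H" "F' \<noteq> {}" "card F' \<le> n"
    "real (card (edges_between S F' (- F'))) \<le> (\<mu> + b (card F)) * real (card F')" by blast
  have "b (card F) \<le> 2 * C * real n powr (- \<epsilon>)" using C0 by (simp add: b_def)
  then have "(\<mu> + b (card F)) * real (card F') \<le> (\<mu> + 2 * C * real n powr (- \<epsilon>)) * real (card F')"
    by (intro mult_right_mono) auto
  with F' show ?thesis by (meson order_trans)
qed

text \<open>If x lies in F and x g does not, the path from x spelled by g crosses the boundary at
  some letter. For a fixed letter, x is determined by the edge crossed.\<close>

lemma card_escape_le:
  assumes S: "finite S" and F: "finite F"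
  shows "g \<in> word_ball S R \<Longrightarrow> card {x\<in>F. x * g \<notin> F} \<le> R * card (edges_between S F (- F))"
proof (induction R arbitrary: g)
  case (Suc R)
  let ?E = "edges_between S F (- F)"
  from Suc.prems consider "g \<in> word_ball S R"
    | h s where "g = h * s" "h \<in> word_ball S R" "s \<in> S \<union> inverse ` S"
    by auto
  then show ?case
  proof cases
    case 1
    from Suc.IH[OF this] show ?thesis by simp
  next
    case 2
    let ?Y = "{x\<in>F. x * h \<in> F \<and> x * g \<notin> F}"
    have "inj_on (\<lambda>x. (x * h, x * g)) ?Y" by (auto simp: inj_on_def)
    moreover have "(\<lambda>x. (x * h, x * g)) ` ?Y \<subseteq> ?E"
      using 2 by (auto simp: edges_between_def adj_iff mult.assoc)
    ultimately have "card ?Y \<le> card ?E"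
      using finite_edges_between[OF S F] by (intro card_inj_on_le) auto
    moreover have "card {x\<in>F. x * g \<notin> F} \<le> card ({x\<in>F. x * h \<notin> F} \<union> ?Y)"
      using F by (intro card_mono) auto
    moreover have "card ({x\<in>F. x * h \<notin> F} \<union> ?Y) \<le> card {x\<in>F. x * h \<notin> F} + card ?Y"
      by (rule card_Un_le)
    ultimately show ?thesis using Suc.IH[OF 2(2)] by simp
  qed
qed simp

text \<open>The inequality of Coulhon and Saloff-Coste: on average over \<open>g\<close> in a ball twice as large as \<open>F\<close>,
  right translation by \<open>g\<close> moves half of \<open>F\<close> out of \<open>F\<close>.\<close>

lemma card_word_ball_le:
  assumes S: "finite S" and F: "finite F" "F \<noteq> {}"
    and small: "2 * R * card (edges_between S F (- F)) \<le> card F"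
  shows "card (word_ball S R) \<le> 2 * card F"
proof -
  let ?B = "word_ball S R"
  have finB: "finite ?B" by (rule finite_word_ball[OF S])
  let ?in = "SIGMA g:?B. {x\<in>F. x * g \<in> F}" and ?out = "SIGMA g:?B. {x\<in>F. x * g \<notin> F}"
  have fin: "finite ?in" "finite ?out" using finB F(1) by auto
  have "?B \<times> F = ?in \<union> ?out" by auto
  then have "card ?B * card F = card (?in \<union> ?out)" by (metis card_cartesian_product)
  also have "\<dots> = card ?in + card ?out" using fin by (intro card_Un_disjoint) auto
  \<comment> \<open>A pair (g, x) that stays in F is determined by the two points x and x g of
    F.\<close>
  also have "card ?in \<le> card (F \<times> F)"
    by (rule card_inj_on_le[of "\<lambda>(g, x). (x, x * g)"]) (use F(1) in \<open>auto simp: inj_on_def\<close>)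
  also have "card ?out = (\<Sum>g\<in>?B. card {x\<in>F. x * g \<notin> F})" using finB F(1) by simp
  also have "\<dots> \<le> (\<Sum>g\<in>?B. R * card (edges_between S F (- F)))"
    by (intro sum_mono card_escape_le[OF S F(1)])
  finally have "card ?B * card F \<le> card F * card F + card ?B * (R * card (edges_between S F (- F)))"
    by (simp add: card_cartesian_product)
  moreover have "2 * (card ?B * (R * card (edges_between S F (- F)))) \<le> card ?B * card F"
    using mult_le_mono2[OF small, of "card ?B"] by (simp only: mult_ac)
  ultimately have "card ?B * card F \<le> 2 * (card F * card F)" by linarith
  then have "card ?B * card F \<le> (2 * card F) * card F" by (simp only: mult.assoc)
  then show ?thesis using F by (simp add: card_gt_0_iff)
qed

lemma folner_boundary:
  assumes "folner H" "finite S" "S \<subseteq> H" "subgrp H" "\<mu> > 0"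
  shows "\<exists>F. finite F \<and> F \<noteq> {} \<and> F \<subseteq> H \<and> real (card (edges_between S F (- F))) \<le> \<mu> * real (card F)"
proof -
  let ?S = "S \<union> inverse ` S"
  let ?\<delta> = "\<mu> / (real (card ?S) + 1)"
  have "finite ?S \<and> ?S \<subseteq> H \<and> ?\<delta> > 0"
    using assms subgrp_inv[OF assms(4)] by auto
  from assms(1)[unfolded folner_def, rule_format, OF this]
  obtain F where F: "finite F" "F \<noteq> {}" "F \<subseteq> H"
    and Fs: "\<forall>s\<in>?S. real (card {x\<in>F. x * s \<notin> F}) \<le> ?\<delta> * real (card F)"
    by blast
  have "edges_between S F (- F) \<subseteq> (\<lambda>(s, x). (x, x * s)) ` (SIGMA s:?S. {x\<in>F. x * s \<notin> F})"
  proof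
    fix p assume "p \<in> edges_between S F (- F)"
    then obtain x s where "p = (x, x * s)" "x \<in> F" "x * s \<notin> F" "s \<in> ?S"
      by (auto simp: edges_between_def adj_iff)
    then show "p \<in> (\<lambda>(s, x). (x, x * s)) ` (SIGMA s:?S. {x\<in>F. x * s \<notin> F})"
      by (intro image_eqI[of _ _ "(s, x)"]) auto
  qed
  then have "card (edges_between S F (- F)) \<le> card (SIGMA s:?S. {x\<in>F. x * s \<notin> F})"
    using assms(2) F(1) by (intro surj_card_le) auto
  also have "\<dots> = (\<Sum>s\<in>?S. card {x\<in>F. x * s \<notin> F})" using assms(2) F(1) by simp
  finally have "real (card (edges_between S F (- F))) \<le> (\<Sum>s\<in>?S. real (card {x\<in>F. x * s \<notin> F}))"
    by (simp flip: of_nat_sum)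
  also have "\<dots> \<le> (\<Sum>s\<in>?S. ?\<delta> * real (card F))" by (intro sum_mono) (use Fs in blast)
  also have "\<dots> = (real (card ?S) / (real (card ?S) + 1)) * (\<mu> * real (card F))" by simp
  also have "\<dots> \<le> 1 * (\<mu> * real (card F))" using assms(5) by (intro mult_right_mono) auto
  finally show ?thesis using F by auto
qed

text \<open>A Foelner set of boundary ratio n^-epsilon is cut down to at most n elements and ratio D
  n^-epsilon. Choosing n of order R^(1/epsilon) lets it bound the ball of radius R.\<close>

theorem separation_poly_growth:
  fixes \<epsilon> c :: real
  assumes sv: "solv H" and H: "H = gen S" and S: "finite S" and \<epsilon>: "\<epsilon> > 0" "\<epsilon> < 1" and c: "c > 0"
    and sep: "\<And>F. finite F \<Longrightarrow> F \<subseteq> H \<Longrightarrow> N \<le> card F \<Longrightarrow> 2 \<le> card F \<Longrightarrow>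
      \<exists>A. A \<subseteq> F \<and> A \<noteq> {} \<and> 2 * card A \<le> card F \<and>
        real (card (edges_between S A (F - A))) \<le> c * real (card F) powr (- \<epsilon>) * real (card A)"
  shows "poly_growth H"
proof -
  define C where "C = 2 * c / (2 powr \<epsilon> - 1)"
  define D where "D = 1 + 2 * C"
  have "2 powr \<epsilon> > 1" using \<epsilon> powr_less_mono[of 0 \<epsilon> "2::real"] by auto
  then have "C > 0" using c by (simp add: C_def)
  then have D: "D > 0" by (simp add: D_def)
  have sH: "subgrp H" "S \<subseteq> H" using H subgrp_gen gen_incl by auto
  have small: "\<exists>F. finite F \<and> F \<noteq> {} \<and> card F \<le> n \<and>
      real (card (edges_between S F (- F))) \<le> D * real n powr (- \<epsilon>) * real (card F)"
    if n: "n \<ge> N" "n > 0" for n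
  proof -
    have "real n powr (- \<epsilon>) > 0" using n by simp
    from folner_boundary[OF solv_folner[OF sv] S sH(2,1) this]
    obtain F where F: "finite F" "F \<noteq> {}" "F \<subseteq> H"
      "real (card (edges_between S F (- F))) \<le> real n powr (- \<epsilon>) * real (card F)" by blast
    have "\<exists>F'. finite F' \<and> F' \<subseteq> H \<and> F' \<noteq> {} \<and> card F' \<le> n \<and>
        real (card (edges_between S F' (- F'))) \<le>
          (real n powr (- \<epsilon>) + 2 * C * real n powr (- \<epsilon>)) * real (card F')"
      unfolding C_def using n
      by (intro cut_down[OF S \<epsilon> c n(2) _ F(1,3,2,4)] sep) auto
    moreover have "real n powr (- \<epsilon>) + 2 * C * real n powr (- \<epsilon>) = D * real n powr (- \<epsilon>)"
      by (simp add: D_def algebra_simps)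
    ultimately show ?thesis by auto
  qed
  define d where "d = nat \<lceil>1 / \<epsilon>\<rceil>"
  define C' where "C' = nat \<lceil>2 * ((2 * D + 1) ^ d + 2 + real N)\<rceil>"
  have "card (word_ball S R) \<le> C' * (R + 1) ^ d" for R
  proof -
    let ?q = "(2 * D * real R) powr (1 / \<epsilon>)"
    \<comment> \<open>This makes D n^-epsilon at most 1 / (2 R), the ratio required by
      \<open>card_word_ball_le\<close>; adding N + 1 makes the separation hypothesis
      available.\<close>
    define n where "n = nat \<lceil>?q\<rceil> + N + 1"
    have n: "n \<ge> N" "n > 0" by (auto simp: n_def)
    have nq: "real n \<ge> ?q" unfolding n_def by linarith
    obtain F where F: "finite F" "F \<noteq> {}" "card F \<le> n"
      "real (card (edges_between S F (- F))) \<le> D * real n powr (- \<epsilon>) * real (card F)"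
      using small[OF n] by blast
    have "2 * D * real R = ?q powr \<epsilon>" using \<epsilon> D by (simp add: powr_powr)
    also have "\<dots> \<le> real n powr \<epsilon>" using nq \<epsilon> by (intro powr_mono2) auto
    finally have "2 * D * real R * real n powr (- \<epsilon>) \<le> real n powr \<epsilon> * real n powr (- \<epsilon>)"
      by (intro mult_right_mono) auto
    also have "\<dots> = 1" using n by (simp add: powr_minus)
    finally have le1: "2 * D * real R * real n powr (- \<epsilon>) \<le> 1" .
    have "2 * real R * real (card (edges_between S F (- F))) \<le>
        2 * real R * (D * real n powr (- \<epsilon>) * real (card F))"
      using F(4) by (intro mult_left_mono) auto
    also have "\<dots> = (2 * D * real R * real n powr (- \<epsilon>)) * real (card F)" by simp
    also have "\<dots> \<le> 1 * real (card F)" using le1 by (intro mult_right_mono) auto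
    finally have "real (2 * R * card (edges_between S F (- F))) \<le> real (card F)" by simp
    then have "card (word_ball S R) \<le> 2 * card F"
      using card_word_ball_le[OF S F(1,2)] by (simp only: of_nat_le_iff)
    then have "real (card (word_ball S R)) \<le> 2 * real n" using F(3) by linarith
    also have "real n \<le> ?q + 2 + real N" unfolding n_def using powr_ge_zero[of "2 * D * real R" "1 / \<epsilon>"] by linarith
    also have "?q \<le> ((2 * D + 1) * (real R + 1)) powr (1 / \<epsilon>)"
      using \<epsilon> D by (intro powr_mono2) (auto simp: algebra_simps)
    also have "\<dots> \<le> ((2 * D + 1) * (real R + 1)) powr (real d)"
    proof (rule powr_mono)
      show "1 / \<epsilon> \<le> real d" unfolding d_def by linarith
      have "1 * 1 \<le> (2 * D + 1) * (real R + 1)" using D by (intro mult_mono) auto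
      then show "1 \<le> (2 * D + 1) * (real R + 1)" by simp
    qed
    also have "\<dots> = (2 * D + 1) ^ d * (real R + 1) ^ d"
      using D by (subst powr_realpow) (auto simp: power_mult_distrib intro!: mult_pos_pos)
    finally have "real (card (word_ball S R)) \<le> 2 * ((2 * D + 1) ^ d * (real R + 1) ^ d + 2 + real N)" by simp
    also have "\<dots> \<le> 2 * ((2 * D + 1) ^ d * (real R + 1) ^ d + (2 + real N) * (real R + 1) ^ d)"
    proof -
      have "(2 + real N) * 1 \<le> (2 + real N) * (real R + 1) ^ d"
        by (intro mult_left_mono one_le_power) auto
      moreover have "2 * (x + 2 + y) \<le> 2 * (x + z)" if "(2 + y) * 1 \<le> z" for x y z :: real
        using that by simp
      ultimately show ?thesis by blast
    qed
    also have "\<dots> = (2 * ((2 * D + 1) ^ d + 2 + real N)) * (real R + 1) ^ d" by (simp add: algebra_simps)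
    also have "\<dots> \<le> real C' * (real R + 1) ^ d"
      unfolding C'_def by (intro mult_right_mono) (linarith, simp)
    also have "\<dots> = real (C' * (R + 1) ^ d)" by (simp add: add.commute)
    finally show ?thesis by (simp only: of_nat_le_iff)
  qed
  then show ?thesis unfolding H by (intro poly_growth_gen[OF S])
qed

section \<open>Embedding an abstract group into a group type\<close>

text \<open>The permutations of the whole type, in which a group with an arbitrary carrier embeds by
  Cayley's theorem.\<close>

typedef 'a bijection = "{f :: 'a \<Rightarrow> 'a. bij f}"
  by (rule exI[of _ id]) simp

setup_lifting type_definition_bijection

instantiation bijection :: (type) mult_group
begin

lift_definition one_bijection :: "'a bijection" is id by simp

lift_definition times_bijection :: "'a bijection \<Rightarrow> 'a bijection \<Rightarrow> 'a bijection" is "(\<circ>)"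
  by (rule bij_comp)

lift_definition inverse_bijection :: "'a bijection \<Rightarrow> 'a bijection" is "inv_into UNIV"
  by (rule bij_imp_bij_inv)

text \<open>The class \<open>inverse\<close> includes division, so the instance has to interpret
  it.\<close>

definition divide_bijection :: "'a bijection \<Rightarrow> 'a bijection \<Rightarrow> 'a bijection" where
  "divide_bijection f g = f * inverse g"

instance
  by standard (transfer; simp add: comp_assoc bij_is_inj)+

end

locale group_embedding = group G for G (structure) +
  fixes \<psi> :: "'a \<Rightarrow> 'b::mult_group"
  assumes inj: "inj_on \<psi> (carrier G)"
    and hom: "\<And>x y. x \<in> carrier G \<Longrightarrow> y \<in> carrier G \<Longrightarrow> \<psi> (x \<otimes> y) = \<psi> x * \<psi> y"

lemma (in group) cayley_embedding: "\<exists>\<psi> :: 'a \<Rightarrow> 'a bijection. group_embedding G \<psi>"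
proof -
  \<comment> \<open>Left translation, extended by the identity outside the carrier so that it
    permutes the whole type.\<close>
  define f where "f g x = (if x \<in> carrier G then g \<otimes> x else x)" for g x
  have bij: "bij (f g)" if g: "g \<in> carrier G" for g
    by (rule bij_betw_byWitness[of _ "f (inv g)"]) (use g in \<open>auto simp: f_def m_assoc[symmetric]\<close>)
  have f_mult: "f (g \<otimes> h) = f g \<circ> f h" if "g \<in> carrier G" "h \<in> carrier G" for g h
    using that by (auto simp: f_def m_assoc)
  define \<psi> where "\<psi> g = Abs_bijection (f g)" for g
  have rep: "Rep_bijection (\<psi> g) = f g" if "g \<in> carrier G" for g
    unfolding \<psi>_def using bij[OF that] by (simp add: Abs_bijection_inverse)
  have "group_embedding G \<psi>"
  proof
    show "inj_on \<psi> (carrier G)"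
    proof (rule inj_onI)
      fix x y assume xy: "x \<in> carrier G" "y \<in> carrier G" "\<psi> x = \<psi> y"
      then have "f x \<one> = f y \<one>" using rep by metis
      with xy show "x = y" by (simp add: f_def)
    qed
  next
    fix x y assume xy: "x \<in> carrier G" "y \<in> carrier G"
    then have "Rep_bijection (\<psi> (x \<otimes> y)) = Rep_bijection (\<psi> x * \<psi> y)"
      by (simp add: rep f_mult times_bijection.rep_eq)
    then show "\<psi> (x \<otimes> y) = \<psi> x * \<psi> y" by (simp add: Rep_bijection_inject)
  qed
  then show ?thesis by blast
qed

context group_embedding
begin

lemma emb_one: "\<psi> \<one> = 1"
  using hom[OF one_closed one_closed] group_left_cancel[of "\<psi> \<one>" "\<psi> \<one>" 1] by simp

lemma emb_inv: "x \<in> carrier G \<Longrightarrow> \<psi> (inv x) = inverse (\<psi> x)"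
  using hom[of x "inv x"] group_inverse_unique[of "\<psi> x" "\<psi> (inv x)"] by (simp add: emb_one)

lemma emb_subgrp: "subgroup K G \<Longrightarrow> subgrp (\<psi> ` K)"
proof (rule subgrpI)
  assume K: "subgroup K G"
  note KG = subgroup.mem_carrier[OF K]
  show "1 \<in> \<psi> ` K" using subgroup.one_closed[OF K] emb_one by force
  show "x * y \<in> \<psi> ` K" if xy: "x \<in> \<psi> ` K" "y \<in> \<psi> ` K" for x y
  proof -
    obtain a b where ab: "a \<in> K" "b \<in> K" "x = \<psi> a" "y = \<psi> b" using xy by blast
    then have "x * y = \<psi> (a \<otimes> b)" by (simp add: hom KG)
    then show ?thesis by (rule image_eqI) (rule subgroup.m_closed[OF K ab(1,2)])
  qed
  show "inverse x \<in> \<psi> ` K" if x: "x \<in> \<psi> ` K" for x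
  proof -
    obtain a where a: "a \<in> K" "x = \<psi> a" using x by blast
    then have "inverse x = \<psi> (inv a)" by (simp add: emb_inv KG)
    then show ?thesis by (rule image_eqI) (rule subgroup.m_inv_closed[OF K a(1)])
  qed
qed

section \<open>Transfer between the abstract group and its image\<close>

lemma emb_generate:
  assumes S: "S \<subseteq> carrier G"
  shows "\<psi> ` generate G S = gen (\<psi> ` S)"
proof
  show "\<psi> ` generate G S \<subseteq> gen (\<psi> ` S)"
  proof
    fix y assume "y \<in> \<psi> ` generate G S"
    then obtain x where x: "x \<in> generate G S" "y = \<psi> x" by blast
    from x(1) have "x \<in> carrier G \<and> \<psi> x \<in> gen (\<psi> ` S)"
    proof induction
      case one
      then show ?case by (simp add: emb_one gen_one)
    next
      case (incl h)
      then show ?case using S by (auto intro: gen_base)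
    next
      case (inv h)
      then have "h \<in> carrier G" using S by blast
      moreover from inv have "inverse (\<psi> h) \<in> gen (\<psi> ` S)" by (intro gen_inv gen_base imageI)
      ultimately show ?case by (simp add: emb_inv)
    next
      case (eng h1 h2)
      then show ?case by (simp add: hom gen_mult)
    qed
    then show "y \<in> gen (\<psi> ` S)" by (simp add: x)
  qed
  show "gen (\<psi> ` S) \<subseteq> \<psi> ` generate G S"
    by (rule gen_least[OF emb_subgrp[OF generate_is_subgroup[OF S]]]) (auto intro: generate.incl)
qed

lemma emb_solv:
  assumes "solvable G"
  shows "solv (\<psi> ` carrier G)"
proof -
  obtain n where n: "(derived G ^^ n) (carrier G) = {\<one>}"
    using assms solvable_iff_trivial_derived_seq by blast
  have "solv (\<psi> ` H)" if "subgroup H G" "(derived G ^^ n) H = {\<one>}" for n H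
    using that
  proof (induction n arbitrary: H)
    case 0
    then show ?case by (simp add: emb_one solv_trivial)
  next
    case (Suc n)
    let ?D = "derived G H"
    have HG: "H \<subseteq> carrier G" using Suc.prems(1) subgroup.subset by blast
    have D: "subgroup ?D G" using derived_is_subgroup[OF HG] .
    have "solv (\<psi> ` ?D)" using Suc.IH[OF D] Suc.prems(2) by (simp add: funpow_swap1)
    moreover have "x * y * inverse x * inverse y \<in> \<psi> ` ?D" if "x \<in> \<psi> ` H" "y \<in> \<psi> ` H" for x y
    proof -
      obtain a b where ab: "x = \<psi> a" "y = \<psi> b" "a \<in> H" "b \<in> H" using \<open>x \<in> \<psi> ` H\<close> \<open>y \<in> \<psi> ` H\<close> by blast
      then have "a \<otimes> b \<otimes> inv a \<otimes> inv b \<in> ?D" unfolding derived_def by (intro generate.incl) blast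
      moreover have "\<psi> (a \<otimes> b \<otimes> inv a \<otimes> inv b) = x * y * inverse x * inverse y"
        using ab HG by (simp add: hom emb_inv subsetD)
      ultimately show ?thesis by force
    qed
    moreover have "\<psi> ` ?D \<subseteq> \<psi> ` H" using derived_incl[OF subset_refl Suc.prems(1)] by blast
    ultimately show ?case
      using solv_extend[OF _ emb_subgrp[OF D] emb_subgrp[OF Suc.prems(1)]] by blast
  qed
  from this[OF subgroup_self n] show ?thesis .
qed

lemma subgroup_vimage:
  assumes "subgrp M"
  shows "subgroup {x \<in> carrier G. \<psi> x \<in> M} G"
  by (rule subgroupI)
     (use assms in \<open>auto simp: hom emb_inv emb_one subgrp_def intro!: exI[of _ \<one>]\<close>)

text \<open>It is enough that the embedding sends each lower central term into the corresponding
  \<open>lcs\<close>; injectivity then makes the last term trivial.\<close>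

lemma nilpotent_vimage:
  assumes M: "subgrp M" "lcs M c \<subseteq> {1}"
  shows "nilpotent_group (G \<lparr> carrier := {x \<in> carrier G. \<psi> x \<in> M} \<rparr>)"
proof -
  let ?M = "{x \<in> carrier G. \<psi> x \<in> M}"
  let ?G = "G \<lparr> carrier := ?M \<rparr>"
  have sub: "subgroup ?M G" by (rule subgroup_vimage[OF M(1)])
  have inv_eq: "inv\<^bsub>?G\<^esub> x = inv x" if "x \<in> ?M" for x
    using m_inv_consistent[OF sub that] .
  have in_lcs: "x \<in> ?M \<and> \<psi> x \<in> lcs M n" if "x \<in> lower_central ?G n" for x n
    using that
  proof (induction n arbitrary: x)
    case (Suc n)
    have gens: "h \<in> ?M \<and> \<psi> h \<in> lcs M (Suc n)"
      if h: "h \<in> (\<Union>x \<in> lower_central ?G n. \<Union>y \<in> carrier ?G.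
        {x \<otimes>\<^bsub>?G\<^esub> y \<otimes>\<^bsub>?G\<^esub> inv\<^bsub>?G\<^esub> x \<otimes>\<^bsub>?G\<^esub> inv\<^bsub>?G\<^esub> y})" for h
    proof -
      from h obtain x y where xy: "x \<in> lower_central ?G n" "y \<in> ?M"
        "h = x \<otimes> y \<otimes> inv\<^bsub>?G\<^esub> x \<otimes> inv\<^bsub>?G\<^esub> y" by auto
      from Suc.IH[OF xy(1)] have x: "x \<in> ?M" "\<psi> x \<in> lcs M n" by auto
      have h: "h = x \<otimes> y \<otimes> inv x \<otimes> inv y" using xy x by (simp add: inv_eq)
      then have "\<psi> h = commu (\<psi> x) (\<psi> y)" using x xy(2) by (simp add: hom emb_inv commu_def)
      moreover have "commu (\<psi> x) (\<psi> y) \<in> lcs M (Suc n)" using x xy(2) by (intro commu_lcs) auto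
      ultimately show ?thesis using lcs_subset[OF M(1), of "Suc n"] h x xy(2) by auto
    qed
    from Suc.prems[unfolded lower_central.simps] show ?case
    proof induction
      case one
      then show ?case
        using subgroup.one_closed[OF sub] subgrp_one[OF subgrp_lcs[OF M(1)]] by (simp add: emb_one)
    next
      case (incl h)
      then show ?case by (rule gens)
    next
      case (inv h)
      from gens[OF this] have h: "h \<in> ?M" "\<psi> h \<in> lcs M (Suc n)" by auto
      then have "\<psi> (inv h) \<in> lcs M (Suc n)"
        using subgrp_inv[OF subgrp_lcs[OF M(1)]] by (simp add: emb_inv)
      then show ?case using subgroup.m_inv_closed[OF sub h(1)] by (simp add: inv_eq[OF h(1)])
    next
      case (eng h1 h2)
      then show ?case
        using subgroup.m_closed[OF sub, of h1 h2] subgrp_mult[OF subgrp_lcs[OF M(1)], of "\<psi> h1" "Suc n" "\<psi> h2"]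
        by (simp add: hom)
    qed
  qed simp
  have "x = \<one>" if x: "x \<in> lower_central ?G c" for x
    using in_lcs[OF x] M(2) inj_onD[OF inj, of x \<one>] by (auto simp: emb_one)
  then have "lower_central ?G c \<subseteq> {\<one>}" by blast
  \<comment> \<open>\<open>nilpotent_group\<close> asks for equality with the trivial subgroup, not
    just inclusion.\<close>
  moreover have "\<one> \<in> lower_central ?G c"
    using subgroup.one_closed[OF sub] generate.one[of ?G] by (cases c) auto
  ultimately show ?thesis by (auto simp: nilpotent_group_def)
qed

text \<open>If the image of a is y z with y in M, the coset of a depends on z alone.\<close>

lemma finite_rcosets_vimage:
  assumes M: "subgrp M" "fin_index M (\<psi> ` carrier G)"
  shows "finite (rcosets {x \<in> carrier G. \<psi> x \<in> M})"
proof -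
  let ?M = "{x \<in> carrier G. \<psi> x \<in> M}"
  obtain T where T: "finite T" "\<And>x. x \<in> \<psi> ` carrier G \<Longrightarrow> \<exists>y\<in>M. \<exists>z\<in>T. x = y * z"
    using M(2) by (auto simp: fin_index_def)
  have "rcosets ?M \<subseteq> (\<lambda>z. {x \<in> carrier G. \<psi> x * inverse z \<in> M}) ` T"
  proof
    fix c assume "c \<in> rcosets ?M"
    then obtain a where a: "a \<in> carrier G" "c = ?M #> a" by (auto simp: RCOSETS_def)
    obtain y z where y: "y \<in> M" "z \<in> T" "\<psi> a = y * z" using T(2) a(1) by blast
    have "c = {x \<in> carrier G. \<psi> x * inverse z \<in> M}"
    proof (intro equalityI subsetI)
      fix x assume "x \<in> c"
      then obtain m where m: "m \<in> ?M" "x = m \<otimes> a" by (auto simp: a r_coset_def)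
      then have "\<psi> x * inverse z = \<psi> m * y" using a y by (simp add: hom mult.assoc)
      with m a y show "x \<in> {x \<in> carrier G. \<psi> x * inverse z \<in> M}"
        using subgrp_mult[OF M(1)] by auto
    next
      fix x assume x: "x \<in> {x \<in> carrier G. \<psi> x * inverse z \<in> M}"
      have "\<psi> (x \<otimes> inv a) = (\<psi> x * inverse z) * inverse y"
        using x a y by (simp add: hom emb_inv mult.assoc)
      then have "x \<otimes> inv a \<in> ?M" using x a subgrp_mult[OF M(1) _ subgrp_inv[OF M(1) y(1)]] by auto
      moreover have "x = (x \<otimes> inv a) \<otimes> a" using x a by (simp add: m_assoc)
      ultimately show "x \<in> c" unfolding a(2) r_coset_def by blast
    qed
    with y(2) show "c \<in> (\<lambda>z. {x \<in> carrier G. \<psi> x * inverse z \<in> M}) ` T" by blast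
  qed
  then show ?thesis using T(1) finite_subset by blast
qed

text \<open>The minimum in the Cheeger constant of F is attained at some A. Evaluating the profile
  at n = card F and dividing by card F turns c n^(1-epsilon) into the ratio c n^-epsilon.\<close>

lemma separation_cut:
  fixes c \<epsilon> :: real
  assumes S: "S \<subseteq> carrier G"
    and F: "finite F" "F \<subseteq> \<psi> ` carrier G" "2 \<le> card F"
    and sep: "sep_profile (cayley_graph G S) (card F) \<le> c * real (card F) powr (1 - \<epsilon>)"
  shows "\<exists>A. A \<subseteq> F \<and> A \<noteq> {} \<and> 2 * card A \<le> card F \<and>
    real (card (edges_between (\<psi> ` S) A (F - A))) \<le> c * real (card F) powr (- \<epsilon>) * real (card A)"
proof -
  define E where "E = {x \<in> carrier G. \<psi> x \<in> F}"
  have EG: "E \<subseteq> carrier G" by (auto simp: E_def)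
  have injE: "inj_on \<psi> E" using inj EG inj_on_subset by blast
  have imE: "\<psi> ` E = F" using F(2) by (auto simp: E_def)
  have finE: "finite E" using F(1) finite_imageD[OF _ injE] imE by simp
  have cardE: "card E = card F" using card_image[OF injE] imE by simp
  let ?H = "induced_pair_subgraph (cayley_graph G S) E"
  let ?P = "{A. A \<noteq> {} \<and> A \<subseteq> pverts ?H \<and> real (card A) \<le> real (card (pverts ?H)) / 2}"
  let ?f = "\<lambda>A. real (card (edge_boundary ?H A)) / real (card A)"
  have vH: "pverts ?H = E" by (simp add: induced_pair_subgraph_def)
  have ch: "cheeger ?H = Min (?f ` ?P)"
    using F(3) by (simp add: cheeger_def vH cardE)
  have "finite ?P" by (rule finite_subset[of _ "Pow E"]) (use finE vH in auto)
  moreover obtain x where "x \<in> E" using F(3) cardE by fastforce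
  then have "{x} \<in> ?P" using F(3) by (auto simp: vH cardE)
  ultimately have "cheeger ?H \<in> ?f ` ?P" unfolding ch by (intro Min_in) auto
  then obtain A where A: "A \<noteq> {}" "A \<subseteq> E" "real (card A) \<le> real (card F) / 2" "cheeger ?H = ?f A"
    by (auto simp: vH cardE)
  have finA: "finite A" using A(2) finE finite_subset by blast
  have "real (card E) * cheeger ?H \<le> sep_profile (cayley_graph G S) (card F)"
    unfolding sep_profile_def
    by (rule cSUP_upper[OF _ sep_profile_bdd_above])
       (use EG finE cardE in \<open>auto simp: cayley_graph_def\<close>)
  also note sep
  finally have "real (card F) * cheeger ?H \<le> c * real (card F) powr (1 - \<epsilon>)" by (simp add: cardE)
  also have "\<dots> = real (card F) * (c * real (card F) powr (- \<epsilon>))"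
    using F(3) by (simp add: powr_diff powr_minus divide_inverse)
  finally have "cheeger ?H \<le> c * real (card F) powr (- \<epsilon>)"
    by (rule mult_left_le_imp_le) (use F(3) in simp)
  then have "?f A \<le> c * real (card F) powr (- \<epsilon>)" by (simp only: A(4))
  then have bd: "real (card (edge_boundary ?H A)) \<le> c * real (card F) powr (- \<epsilon>) * real (card A)"
    using A(1) finA by (simp add: divide_le_eq card_gt_0_iff)
  let ?A = "\<psi> ` A"
  have cardA: "card ?A = card A" using card_image injE A(2) inj_on_subset by blast
  \<comment> \<open>Only an inclusion: \<open>edge_boundary\<close> contains both orientations of an
    edge, \<open>edges_between\<close> only the one leaving A.\<close>
  have "edges_between (\<psi> ` S) ?A (F - ?A) \<subseteq> (\<lambda>(x, y). (\<psi> x, \<psi> y)) ` edge_boundary ?H A"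
  proof
    fix p assume "p \<in> edges_between (\<psi> ` S) ?A (F - ?A)"
    then obtain x y where p: "p = (\<psi> x, \<psi> y)" "x \<in> A" "y \<in> E" "y \<notin> A" "adj (\<psi> ` S) (\<psi> x) (\<psi> y)"
      unfolding edges_between_def imE[symmetric] by blast
    have xy: "x \<in> carrier G" "y \<in> carrier G" using p(2,3) A(2) EG by auto
    obtain s where s: "s \<in> S" "\<psi> y = \<psi> x * \<psi> s \<or> \<psi> x = \<psi> y * \<psi> s" using p(5) by (auto simp: adj_def)
    have sG: "s \<in> carrier G" using s(1) S by blast
    have "y = x \<otimes> s \<or> x = y \<otimes> s"
      using s(2) xy sG inj by (auto simp flip: hom dest!: inj_onD)
    then have "(x, y) \<in> edge_boundary ?H A"
      using p(2-4) A(2) xy s(1)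
      by (auto simp: edge_boundary_def induced_pair_subgraph_def cayley_graph_def)
    then show "p \<in> (\<lambda>(x, y). (\<psi> x, \<psi> y)) ` edge_boundary ?H A" using p(1) by force
  qed
  moreover have "finite (edge_boundary ?H A)"
    by (rule finite_subset[of _ "E \<times> E"]) (use finE in \<open>auto simp: edge_boundary_def induced_pair_subgraph_def\<close>)
  ultimately have "card (edges_between (\<psi> ` S) ?A (F - ?A)) \<le> card (edge_boundary ?H A)"
    by (rule surj_card_le[rotated])
  with bd have "real (card (edges_between (\<psi> ` S) ?A (F - ?A))) \<le> c * real (card F) powr (- \<epsilon>) * real (card ?A)"
    by (simp add: cardA)
  moreover have "2 * card ?A \<le> card F" using A(3) by (simp add: cardA)
  ultimately show ?thesis using A(1,2) imE by (intro exI[of _ ?A]) auto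
qed

end

theorem theorem1p7:
  fixes G (structure) and S :: "'a set"
  assumes "group G" and "solvable G"
    and "finite S" and "S \<subseteq> carrier G" and "generate G S = carrier G"
    and "\<exists>\<epsilon> \<in> {0<..<1::real}. \<exists>c > (0::real). \<exists>N. \<forall>n \<ge> N.
           sep_profile (cayley_graph G S) n \<le> c * real n powr (1 - \<epsilon>)"
  shows "virtually_nilpotent G"
proof -
  obtain \<psi> :: "'a \<Rightarrow> 'a bijection" where "group_embedding G \<psi>"
    using group.cayley_embedding[OF assms(1)] by blast
  then interpret group_embedding G \<psi> .
  obtain \<epsilon> c N where *: "0 < \<epsilon>" "\<epsilon> < 1" "c > 0"
    "\<forall>n\<ge>N. sep_profile (cayley_graph G S) n \<le> c * real n powr (1 - \<epsilon>)"
    using assms(6) by auto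
  let ?H = "\<psi> ` carrier G"
  have gen: "?H = gen (\<psi> ` S)" using emb_generate[OF assms(4)] assms(5) by simp
  have fin: "finite (\<psi> ` S)" using assms(3) by simp
  have sv: "solv ?H" by (rule emb_solv[OF assms(2)])
  have growth: "poly_growth ?H"
    by (rule separation_poly_growth[OF sv gen fin *(1-3)]) (rule separation_cut[OF assms(4)], use *(4) in auto)
  have "polycyclic ?H"
    using solv_imp_polycyclic[OF sv _ growth] gen fin by (auto simp: fin_gen_def)
  from polycyclic_poly_growth_virtually_nilpotent[OF this growth]
  obtain M k where M: "subgrp M" "fin_index M ?H" "lcs M k \<subseteq> {1}" by blast
  show ?thesis unfolding virtually_nilpotent_def
    using subgroup_vimage[OF M(1)] finite_rcosets_vimage[OF M(1,2)] nilpotent_vimage[OF M(1,3)] by blast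
qed

end
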